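(* Consider the random walk $(B_3,\nu)$ where $\nu$ is a probability measure on $U=\{a\Delta^k,b\Delta^k,ab\Delta^k,ba\Delta^k\mid k\in\mathbb{Z}\}\subset B_3$ such that $\bigcup_n\mathrm{supp}(\nu^{*n})=B_3$ and $\sum_{x\in U}e^{\lambda|x|_S}\nu(x)<\infty$ for some $\lambda>0$. Let $(X_n)$ be a realization of the random walk $(B_3,\nu)$ and let $\widehat X_n\Delta^{k_n}$ be the Garside normal form of $X_n$. Then there exist two positive numbers $\sigma_{\Sigma}$ and $\sigma_{\Delta}$ such that, for all $t\in\mathbb{R}$, $$\lim_{n\to+\infty}P\left\{\frac{|\widehat X_n|_T-n\gamma_{\Sigma}}{\sigma_{\Sigma}\sqrt n}<t\right\}=\lim_{n\to+\infty}P\left\{\frac{k_n-n\gamma_{\Delta}}{\sigma_{\Delta}\sqrt n}<t\right\}=\frac{1}{\sqrt{2\pi}}\int_{-\infty}^{t}e^{-x^2/2}\,dx.$$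
   Context: $B_3=\langle a,b\mid aba=bab\rangle$ is the braid group on three strands, $S=\{a,a^{-1},b,b^{-1}\}$, and $|g|_S$ is the word length of $g\in B_3$ with respect to $S$. Put $\Delta=aba=bab$ and $T=\{a,b,ab,ba\}\subset B_3$. For $t\in T$, $\mathrm{First}(t)$ and $\mathrm{Last}(t)$ are the first and last letter of $t$ (e.g. $\mathrm{First}(a)=\mathrm{Last}(a)=a$, $\mathrm{First}(ab)=a$, $\mathrm{Last}(ab)=b$). Every $g\in B_3$ can be written in a unique way as $g=t_1\cdots t_l\Delta^{k}$ with $l\ge0$, $t_i\in T$, $\mathrm{Last}(t_i)=\mathrm{First}(t_{i+1})$ for $1\le i<l$, and $k\in\mathbb{Z}$ (Garside normal form); write $\widehat g=t_1\cdots t_l$ and $|\widehat g|_T=l$. A realization of the random walk $(B_3,\nu)$ is $X_n=x_1\cdots x_n$, $X_0=1$, with $(x_i)$ i.i.d. of law $\nu$. The drifts $\gamma_{\Sigma}=\lim_n|\widehat X_n|_T/n$ and $\gamma_{\Delta}=\lim_n k_n/n$ are the almost sure (constant) limits. *)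

theory Defs
  imports "HOL-Probability.Probability"
begin

section \<open>The braid group on three strands\<close>

datatype gen = GA | GB

text \<open>In a word, the letter \<open>(x, True)\<close> stands for the generator \<open>x\<close> and \<open>(x, False)\<close>
  for its inverse. The group presented by the generators \<open>a\<close> (\<^const>\<open>GA\<close>), \<open>b\<close> (\<^const>\<open>GB\<close>) and the relation
  \<open>aba = bab\<close> is the set of words modulo the equivalence generated by free cancellation and
  the relation, both applied inside an arbitrary word.\<close>

type_synonym word3 = "(gen \<times> bool) list"

inductive braid_step :: "word3 \<Rightarrow> word3 \<Rightarrow> bool" where
  cancel: "braid_step (u @ [(x, e), (x, \<not> e)] @ v) (u @ v)"
| braid: "braid_step (u @ [(GA, True), (GB, True), (GA, True)] @ v)
                     (u @ [(GB, True), (GA, True), (GB, True)] @ v)"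

definition braid_eq :: "word3 \<Rightarrow> word3 \<Rightarrow> bool" where
  "braid_eq = equivclp braid_step"

lemma braid_eq_equivp: "equivp braid_eq"
  unfolding braid_eq_def by simp

lemma braid_eq_step: "braid_step u v \<Longrightarrow> braid_eq u v"
  unfolding braid_eq_def by (rule r_into_equivclp)

lemma braid_eq_map:
  assumes "braid_eq u v" and "\<And>u v. braid_step u v \<Longrightarrow> braid_eq (f u) (f v)"
  shows "braid_eq (f u) (f v)"
  using assms(1) unfolding braid_eq_def
proof (induction rule: equivclp_induct)
  case base
  show ?case by simp
next
  case (step y z)
  then have "braid_eq (f y) (f z)"
    using assms(2) equivp_symp[OF braid_eq_equivp] by blast
  with step.IH show ?case
    unfolding braid_eq_def by (rule equivclp_trans)
qed

lemma braid_step_append: "braid_step u v \<Longrightarrow> braid_step (p @ u @ q) (p @ v @ q)"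
proof (induction rule: braid_step.induct)
  case (cancel u x e v)
  then show ?case using braid_step.cancel[of "p @ u" x e "v @ q"] by simp
next
  case (braid u v)
  then show ?case using braid_step.braid[of "p @ u" "v @ q"] by simp
qed

lemma braid_eq_append:
  assumes "braid_eq u u'" and "braid_eq v v'"
  shows "braid_eq (u @ v) (u' @ v')"
proof -
  have "braid_eq (u @ v) (u' @ v)"
    using assms(1) by (rule braid_eq_map) (metis append_Nil braid_eq_step braid_step_append)
  moreover have "braid_eq (u' @ v) (u' @ v')"
    using assms(2)
    by (rule braid_eq_map) (metis append_Nil2 append_assoc braid_eq_step braid_step_append)
  ultimately show ?thesis
    using equivp_transp[OF braid_eq_equivp] by blast
qed

definition inv_word :: "word3 \<Rightarrow> word3" where
  "inv_word w = rev (map (\<lambda>(x, e). (x, \<not> e)) w)"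

lemma inv_word_append: "inv_word (u @ v) = inv_word v @ inv_word u"
  by (simp add: inv_word_def)

lemma braid_eq_inv_left: "braid_eq (inv_word w @ w) []"
proof (induction w)
  case Nil
  then show ?case using equivp_reflp[OF braid_eq_equivp] by (simp add: inv_word_def)
next
  case (Cons l w)
  obtain x e where l: "l = (x, e)" by (cases l)
  have "braid_step (inv_word w @ [(x, \<not> e), (x, \<not> \<not> e)] @ w) (inv_word w @ w)"
    by (rule braid_step.cancel)
  then have "braid_step (inv_word (l # w) @ l # w) (inv_word w @ w)"
    by (simp add: l inv_word_def)
  then show ?case
    using Cons.IH braid_eq_step equivp_transp[OF braid_eq_equivp] by blast
qed

lemma inv_word_inv_word: "inv_word (inv_word w) = w"
  by (simp add: inv_word_def rev_map case_prod_beta comp_def)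

lemma braid_eq_inv_word:
  assumes "braid_eq u v" shows "braid_eq (inv_word u) (inv_word v)"
proof -
  note refl = equivp_reflp[OF braid_eq_equivp]
    and sym = equivp_symp[OF braid_eq_equivp] and trans = equivp_transp[OF braid_eq_equivp]
  have "braid_eq (v @ inv_word v) []"
    using braid_eq_inv_left[of "inv_word v"] by (simp add: inv_word_inv_word)
  from braid_eq_append[OF refl[of "inv_word u"] this]
  have 1: "braid_eq (inv_word u @ v @ inv_word v) (inv_word u)" by simp
  have 2: "braid_eq (inv_word u @ v @ inv_word v) (inv_word u @ u @ inv_word v)"
    by (intro braid_eq_append refl sym[OF assms])
  have 3: "braid_eq (inv_word u @ u @ inv_word v) (inv_word v)"
    using braid_eq_append[OF braid_eq_inv_left[of u] refl[of "inv_word v"]] by simp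
  show ?thesis using trans[OF trans[OF sym[OF 1] 2] 3] .
qed

quotient_type braid3 = word3 / braid_eq
  by (rule braid_eq_equivp)

instantiation braid3 :: "{monoid_mult, inverse}"
begin

lift_definition one_braid3 :: braid3 is "[]" .

lift_definition times_braid3 :: "braid3 \<Rightarrow> braid3 \<Rightarrow> braid3" is "(@)"
  by (rule braid_eq_append)

lift_definition inverse_braid3 :: "braid3 \<Rightarrow> braid3" is inv_word
  by (rule braid_eq_inv_word)

definition divide_braid3 :: "braid3 \<Rightarrow> braid3 \<Rightarrow> braid3" where
  "divide_braid3 g h = g * inverse h"

instance
  by standard (transfer; simp add: equivp_reflp[OF braid_eq_equivp])+

end

lemma braid3_left_inverse [simp]: "inverse g * g = (1 :: braid3)"
  by transfer (rule braid_eq_inv_left)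

lemma braid3_right_inverse [simp]: "g * inverse g = (1 :: braid3)"
  by transfer (metis braid_eq_inv_left inv_word_inv_word)

lift_definition gen3 :: "gen \<Rightarrow> braid3" is "\<lambda>x. [(x, True)]" .

definition br_a :: braid3 where "br_a = gen3 GA"
definition br_b :: braid3 where "br_b = gen3 GB"

lemma braid_relation: "br_a * br_b * br_a = br_b * br_a * br_b"
  unfolding br_a_def br_b_def
  by transfer (use braid_eq_step[OF braid_step.braid[of "[]" "[]"]] in simp)

definition S_gens :: "braid3 set" where
  "S_gens = {br_a, inverse br_a, br_b, inverse br_b}"

definition word_length :: "braid3 \<Rightarrow> nat" where
  "word_length g = (LEAST n. \<exists>w. set w \<subseteq> S_gens \<and> prod_list w = g \<and> length w = n)"


section \<open>Garside normal form\<close>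

definition Delta :: braid3 where
  "Delta = br_a * br_b * br_a"

definition T_set :: "braid3 set" where
  "T_set = {br_a, br_b, br_a * br_b, br_b * br_a}"

text \<open>These are meaningful only on \<^const>\<open>T_set\<close>, whose four elements are distinct
  (see \<open>T_set_distinct\<close> below).\<close>

definition First :: "braid3 \<Rightarrow> braid3" where
  "First t = (if t = br_a \<or> t = br_a * br_b then br_a else br_b)"

definition Last :: "braid3 \<Rightarrow> braid3" where
  "Last t = (if t = br_a \<or> t = br_b * br_a then br_a else br_b)"

definition T_normal :: "braid3 list \<Rightarrow> bool" where
  "T_normal ts \<longleftrightarrow> set ts \<subseteq> T_set \<and> successively (\<lambda>s t. Last s = First t) ts"

definition is_garside_nf :: "braid3 \<Rightarrow> braid3 list \<times> int \<Rightarrow> bool" where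
  "is_garside_nf g = (\<lambda>(ts, k). T_normal ts \<and> g = prod_list ts * Delta powi k)"

text \<open>The normal form of \<open>g\<close> is kept as the pair \<open>([t\<^sub>1, \<dots>, t\<^sub>l], k)\<close>. Existence and uniqueness
  are shown in \<open>garside_nf_ex1\<close> below.\<close>

definition garside_nf :: "braid3 \<Rightarrow> braid3 list \<times> int" where
  "garside_nf g = (THE p. is_garside_nf g p)"

definition T_length :: "braid3 \<Rightarrow> nat" where
  "T_length g = length (fst (garside_nf g))"

definition Delta_exp :: "braid3 \<Rightarrow> int" where
  "Delta_exp g = snd (garside_nf g)"

definition U_set :: "braid3 set" where
  "U_set = {t * Delta powi k |t k. t \<in> T_set}"


subsection \<open>Existence and uniqueness of the normal form\<close>

text \<open>An element of \<^const>\<open>T_set\<close> is coded by its first and last letter, and a normal form by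
  the reversed list of codes together with the exponent of \<^const>\<open>Delta\<close>. On such codes the words
  act from the right as on normal forms.\<close>

primrec other :: "gen \<Rightarrow> gen" where
  "other GA = GB"
| "other GB = GA"

lemma other_other [simp]: "other (other x) = x"
  by (cases x) auto

lemma other_neq [simp]: "other x \<noteq> x" "x \<noteq> other x"
  by (cases x; simp)+

lemma neq_other: "x \<noteq> y \<longleftrightarrow> x = other y"
  by (cases x; cases y; simp)

fun push :: "gen \<Rightarrow> (gen \<times> gen) list \<Rightarrow> int \<Rightarrow> (gen \<times> gen) list \<times> int" where
  "push x [] k = ([(x, x)], k)"
| "push x ((f, l) # r) k =
     (if l = x then ((x, x) # (f, l) # r, k)
      else if f = l then ((f, x) # r, k)
      else (r, k + 1))"

definition act :: "gen \<Rightarrow> (gen \<times> gen) list \<times> int \<Rightarrow> (gen \<times> gen) list \<times> int" where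
  "act x = (\<lambda>(r, k). push (if even k then x else other x) r k)"

definition valid :: "(gen \<times> gen) list \<times> int \<Rightarrow> bool" where
  "valid p \<longleftrightarrow> successively (\<lambda>t s. snd s = fst t) (fst p)"

definition shift :: "int \<Rightarrow> (gen \<times> gen) list \<times> int \<Rightarrow> (gen \<times> gen) list \<times> int" where
  "shift d = (\<lambda>(r, k). (r, k + d))"

fun lact :: "gen \<times> bool \<Rightarrow> (gen \<times> gen) list \<times> int \<Rightarrow> (gen \<times> gen) list \<times> int" where
  "lact (x, e) p = (if e then act x p else shift (- 1) (act x (act (other x) p)))"

lemma valid_act: "valid p \<Longrightarrow> valid (act x p)"
  by (cases p; cases "fst p"; cases "tl (fst p)")
     (auto simp: valid_def act_def)

lemma valid_shift [simp]: "valid (shift d p) = valid p"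
  by (cases p) (simp add: valid_def shift_def)

lemma valid_lact: "valid p \<Longrightarrow> valid (lact l p)"
  by (cases l) (auto simp: valid_act)

lemma valid_fold: "valid p \<Longrightarrow> valid (fold lact w p)"
  by (induction w arbitrary: p) (auto simp: valid_lact)

lemma shift_shift [simp]: "shift c (shift d p) = shift (d + c) p"
  by (cases p) (simp add: shift_def)

lemma shift_0 [simp]: "shift 0 p = p"
  by (cases p) (simp add: shift_def)

lemma push_shift: "push x r (k + d) = shift d (push x r k)"
  by (cases "(x, r, k)" rule: push.cases) (auto simp: shift_def)

lemma act_shift_minus: "act x (shift (- 1) p) = shift (- 1) (act (other x) p)"
  by (cases p) (use push_shift[where d = "- 1"] in \<open>auto simp: shift_def act_def split: prod.splits\<close>)

lemma act_Delta: "valid p \<Longrightarrow> act x (act (other x) (act x p)) = shift 1 p"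
proof -
  assume v: "valid p"
  obtain r k where p: "p = (r, k)" by (cases p)
  show ?thesis
  proof (cases r)
    case Nil
    then show ?thesis by (cases x) (auto simp: p act_def shift_def)
  next
    case (Cons t r')
    obtain f l where t: "t = (f, l)" by (cases t)
    show ?thesis
    proof (cases r')
      case Nil
      then show ?thesis using Cons t
        by (cases x; cases f; cases l) (auto simp: p act_def shift_def)
    next
      case (Cons t' r'')
      obtain f' l' where t': "t' = (f', l')" by (cases t')
      have "l' = f" using v by (simp add: p \<open>r = t # r'\<close> Cons t t' valid_def)
      then show ?thesis using Cons \<open>r = t # r'\<close> t t'
        by (cases x; cases f; cases l; cases f') (auto simp: p act_def shift_def)
    qed
  qed
qed

lemma lact_cancel:
  assumes "valid p" shows "lact (x, \<not> e) (lact (x, e) p) = p"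
  using act_Delta[OF assms, of x] act_Delta[OF assms, of "other x"]
  by (cases e) (auto simp: act_shift_minus)

lemma fold_step: "braid_step u v \<Longrightarrow> valid p \<Longrightarrow> fold lact u p = fold lact v p"
proof (induction rule: braid_step.induct)
  case (cancel u x e v)
  then show ?case using lact_cancel[OF valid_fold[OF cancel], of x e u] by simp
next
  case (braid u v)
  then show ?case
    using act_Delta[OF valid_fold[OF braid], of GA u] act_Delta[OF valid_fold[OF braid], of GB u]
    by simp
qed

lemma fold_eq:
  assumes "braid_eq u v" and p: "valid p" shows "fold lact u p = fold lact v p"
  using assms(1) unfolding braid_eq_def
proof (induction rule: equivclp_induct)
  case (step y z)
  then show ?case using fold_step[OF _ p] by metis
qed simp

lift_definition code :: "braid3 \<Rightarrow> (gen \<times> gen) list \<times> int" is "\<lambda>w. fold lact w ([], 0)"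
  by (rule fold_eq) (simp_all add: valid_def)

definition tval :: "gen \<times> gen \<Rightarrow> braid3" where
  "tval = (\<lambda>(f, l). if f = l then gen3 f else gen3 f * gen3 l)"

definition cval :: "(gen \<times> gen) list \<times> int \<Rightarrow> braid3" where
  "cval = (\<lambda>(r, k). prod_list (map tval (rev r)) * Delta powi k)"

lemma powi_Suc: "(g :: braid3) powi (k + 1) = g powi k * g"
proof (cases "k \<ge> 0")
  case True
  then have "nat (k + 1) = Suc (nat k)" by simp
  then show ?thesis using True by (simp add: power_int_def power_commutes)
next
  case False
  define m where "m = nat (- k - 1)"
  have k: "nat (- k) = Suc m" "nat (- (k + 1)) = m" "k = - int m - 1"
    using False by (auto simp: m_def)
  have "g powi k * g = inverse g ^ m * (inverse g * g)"
    using False k(1) by (simp add: power_int_def power_Suc2 mult.assoc del: power_Suc braid3_left_inverse)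
  moreover have "g powi (k + 1) = inverse g ^ m"
    using k by (cases m) (auto simp: power_int_def)
  ultimately show ?thesis by simp
qed

lemma powi_minus: "(g :: braid3) powi (k - 1) = g powi k * inverse g"
  using powi_Suc[of g "k - 1"] by (simp add: mult.assoc)

lemma Delta_eq: "Delta = gen3 x * gen3 (other x) * gen3 x"
  using braid_relation by (cases x) (auto simp: Delta_def br_a_def br_b_def)

lemma Delta_gen: "Delta * gen3 x = gen3 (other x) * Delta"
  using Delta_eq[of x] Delta_eq[of "other x"] by (metis mult.assoc other_other)

lemma Delta_inv_gen: "inverse Delta * gen3 x = gen3 (other x) * inverse Delta"
proof -
  have "inverse Delta * gen3 x = inverse Delta * (gen3 x * Delta) * inverse Delta"
    by (simp add: mult.assoc)
  also have "gen3 x * Delta = Delta * gen3 (other x)"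
    by (simp add: Delta_gen)
  also have "inverse Delta * (Delta * gen3 (other x)) * inverse Delta
      = gen3 (other x) * inverse Delta"
    by (simp add: mult.assoc[symmetric])
  finally show ?thesis .
qed

lemma Delta_powi_gen:
  "Delta powi k * gen3 x = gen3 (if even k then x else other x) * Delta powi k"
proof (induction k arbitrary: x rule: int_induct[where k = 0])
  case base
  show ?case by simp
next
  case (step1 i)
  have "Delta powi (i + 1) * gen3 x = Delta powi i * gen3 (other x) * Delta"
    by (simp add: powi_Suc mult.assoc Delta_gen)
  then show ?case by (simp add: step1.IH powi_Suc mult.assoc)
next
  case (step2 i)
  have "Delta powi (i - 1) * gen3 x = Delta powi i * gen3 (other x) * inverse Delta"
    by (simp add: powi_minus mult.assoc Delta_inv_gen)
  then show ?case by (simp add: step2.IH powi_minus mult.assoc)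
qed

lemma cval_push: "cval (push x r k) = prod_list (map tval (rev r)) * gen3 x * Delta powi k"
proof (cases "(x, r, k)" rule: push.cases)
  case (1 x k)
  then show ?thesis by (simp add: cval_def tval_def)
next
  case (2 y f l r' k)
  have D: "gen3 f * (gen3 (other f) * (gen3 f * Delta powi k)) = Delta powi (k + 1)"
  proof -
    have "Delta powi (k + 1) = Delta * Delta powi k"
    proof (induction k rule: int_induct[where k = 0])
      case base
      show ?case by simp
    next
      case (step1 i)
      have "Delta powi (i + 1 + 1) = Delta powi (i + 1) * Delta" by (rule powi_Suc)
      also have "\<dots> = Delta * (Delta powi i * Delta)" by (simp add: step1.IH mult.assoc)
      finally show ?case by (simp add: powi_Suc)
    next
      case (step2 i)
      have "Delta powi (i - 1 + 1) = Delta powi (i + 1 - 1)" by simp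
      also have "\<dots> = Delta powi (i + 1) * inverse Delta" by (rule powi_minus)
      also have "\<dots> = Delta * (Delta powi i * inverse Delta)" by (simp only: step2.IH mult.assoc)
      finally show ?case by (simp add: powi_minus)
    qed
    then show ?thesis using Delta_eq[of f] by (metis mult.assoc)
  qed
  show ?thesis
    using 2 D by (auto simp: cval_def tval_def mult.assoc neq_other)
qed

lemma cval_act: "cval (act x p) = cval p * gen3 x"
  by (cases p) (simp add: act_def cval_push mult.assoc Delta_powi_gen, simp add: cval_def mult.assoc Delta_powi_gen)

lemma cval_shift: "cval (shift (- 1) p) = cval p * inverse Delta"
  using powi_minus by (cases p) (simp add: shift_def cval_def mult.assoc)

lemma gen_inverse: "inverse (gen3 x) = gen3 (other x) * gen3 x * inverse Delta"
proof -
  have "inverse (gen3 x) = inverse (gen3 x) * (Delta * inverse Delta)" by simp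
  also have "\<dots> = inverse (gen3 x) * (gen3 x * gen3 (other x) * gen3 x * inverse Delta)"
    using Delta_eq[of x] by simp
  also have "\<dots> = (inverse (gen3 x) * gen3 x) * (gen3 (other x) * gen3 x * inverse Delta)"
    by (simp only: mult.assoc)
  finally show ?thesis by simp
qed

lift_definition of_word :: "word3 \<Rightarrow> braid3" is "\<lambda>w. w" .

lemma of_word_append: "of_word (u @ v) = of_word u * of_word v"
  by transfer (simp add: equivp_reflp[OF braid_eq_equivp])

lemma of_word_Nil: "of_word [] = 1"
  by transfer (simp add: equivp_reflp[OF braid_eq_equivp])

lemma of_word_letter: "of_word [(x, e)] = (if e then gen3 x else inverse (gen3 x))"
  by (cases e) (auto, (transfer, simp add: inv_word_def equivp_reflp[OF braid_eq_equivp])+)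

lemma cval_lact: "cval (lact l p) = cval p * of_word [l]"
  by (cases l) (auto simp: cval_act cval_shift of_word_letter gen_inverse mult.assoc)

lemma cval_fold: "cval (fold lact w p) = cval p * of_word w"
proof (induction w arbitrary: p)
  case (Cons l w)
  then show ?case using of_word_append[of "[l]" w] by (simp add: cval_lact mult.assoc)
qed (simp add: of_word_Nil)

lemma code_of_word: "code (of_word w) = fold lact w ([], 0)"
  by transfer simp

lemma of_word_surj: "\<exists>w. g = of_word w"
  by transfer (use equivp_reflp[OF braid_eq_equivp] in blast)

lemma cval_code: "cval (code g) = g"
proof -
  obtain w where w: "g = of_word w" using of_word_surj by blast
  have "cval ([], 0) = 1" by (simp add: cval_def)
  then show ?thesis unfolding w by (simp add: code_of_word cval_fold)
qed

lemma valid_code: "valid (code g)"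
proof -
  obtain w where w: "g = of_word w" using of_word_surj by blast
  show ?thesis unfolding w code_of_word by (rule valid_fold) (simp add: valid_def)
qed

lemma code_mult_gen: "code (g * gen3 x) = act x (code g)"
proof -
  obtain w where w: "g = of_word w" using of_word_surj by blast
  have "g * gen3 x = of_word (w @ [(x, True)])" by (simp add: of_word_append of_word_letter w)
  then show ?thesis by (simp add: code_of_word w)
qed

lemma code_mult_Delta: "code (g * Delta) = shift 1 (code g)"
  using act_Delta[OF valid_code[of g], of GA]
  by (simp add: Delta_def br_a_def br_b_def mult.assoc[symmetric] code_mult_gen)

lemma code_mult_inv_Delta: "code (g * inverse Delta) = shift (- 1) (code g)"
  using arg_cong[OF code_mult_Delta[of "g * inverse Delta"], of "shift (- 1)"]
  by (simp add: mult.assoc)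

lemma code_mult_Delta_powi: "code (g * Delta powi k) = shift k (code g)"
proof (induction k rule: int_induct[where k = 0])
  case (step1 i)
  then show ?case by (simp add: powi_Suc mult.assoc[symmetric] code_mult_Delta)
next
  case (step2 i)
  then show ?case by (simp add: powi_minus mult.assoc[symmetric] code_mult_inv_Delta)
qed simp

lemma code_prod: "valid (r, 0) \<Longrightarrow> code (prod_list (map tval (rev r))) = (r, 0)"
proof (induction r)
  case Nil
  show ?case using code_of_word[of "[]"] by (simp add: of_word_Nil)
next
  case (Cons t r)
  obtain f l where t: "t = (f, l)" by (cases t)
  have "valid (r, 0)" using Cons.prems by (cases r) (auto simp: valid_def)
  then have IH: "code (prod_list (map tval (rev r))) = (r, 0)" by (rule Cons.IH)
  have "r = [] \<or> snd (hd r) = f"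
    using Cons.prems t by (cases r) (auto simp: valid_def)
  then have act_f: "act f (r, 0) = ((f, f) # r, 0)"
    by (cases r) (auto simp: act_def)
  let ?P = "prod_list (map tval (rev r))"
  have P: "prod_list (map tval (rev (t # r))) = ?P * tval (f, l)" by (simp add: t)
  show ?case
  proof (cases "f = l")
    case True
    then have "code (prod_list (map tval (rev (t # r)))) = act f (code ?P)"
      unfolding P code_mult_gen[symmetric] by (simp add: tval_def)
    then have "code (prod_list (map tval (rev (t # r)))) = ((f, f) # r, 0)"
      by (simp only: IH act_f)
    then show ?thesis using True by (simp only: t)
  next
    case False
    then have "code (prod_list (map tval (rev (t # r)))) = act l (act f (code ?P))"
      unfolding P code_mult_gen[symmetric] by (simp add: tval_def mult.assoc)
    then have "code (prod_list (map tval (rev (t # r)))) = act l ((f, f) # r, 0)"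
      by (simp only: IH act_f)
    then show ?thesis using False by (simp only: t) (simp add: act_def)
  qed
qed

lemma code_cval: "valid p \<Longrightarrow> code (cval p) = p"
  by (cases p) (use code_prod in \<open>auto simp: cval_def code_mult_Delta_powi shift_def valid_def\<close>)

lemma inj_tval: "inj tval"
proof (rule injI)
  fix s t assume "tval s = tval t"
  moreover have "code (tval u) = ([u], 0)" for u
    using code_prod[of "[u]"] by (simp add: valid_def)
  ultimately show "s = t" by (metis list.inject prod.inject)
qed

lemma tval_simps:
  "br_a = tval (GA, GA)" "br_b = tval (GB, GB)"
  "tval (GA, GA) * tval (GB, GB) = tval (GA, GB)" "tval (GB, GB) * tval (GA, GA) = tval (GB, GA)"
  by (auto simp: tval_def br_a_def br_b_def)

lemma T_set_distinct: "distinct [br_a, br_b, br_a * br_b, br_b * br_a]"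
  unfolding tval_simps by (simp add: inj_eq[OF inj_tval])

lemma T_set_eq: "T_set = range tval"
proof -
  have "x \<in> {(GA, GA), (GB, GB), (GA, GB), (GB, GA)}" for x :: "gen \<times> gen"
    by (cases x; cases "fst x"; cases "snd x") auto
  then have "(UNIV :: (gen \<times> gen) set) = {(GA, GA), (GB, GB), (GA, GB), (GB, GA)}" by blast
  then have "range tval = tval ` {(GA, GA), (GB, GB), (GA, GB), (GB, GA)}" by (rule arg_cong)
  then show ?thesis unfolding T_set_def tval_simps by (simp only: image_insert image_empty)
qed

lemma First_tval: "First (tval (f, l)) = gen3 f"
  unfolding First_def tval_simps inj_eq[OF inj_tval] by (cases f; cases l) (auto simp: tval_def)

lemma Last_tval: "Last (tval (f, l)) = gen3 l"
  unfolding Last_def tval_simps inj_eq[OF inj_tval] by (cases f; cases l) (auto simp: tval_def)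

lemma gen3_eq_iff: "gen3 x = gen3 y \<longleftrightarrow> x = y"
  using inj_eq[OF inj_tval, of "(x, x)" "(y, y)"] by (simp add: tval_def)

lemma T_normal_tval: "T_normal (map tval cs) \<longleftrightarrow> valid (rev cs, k)"
proof -
  have "Last (tval s) = First (tval t) \<longleftrightarrow> snd s = fst t" for s t
    by (cases s; cases t) (simp add: First_tval Last_tval gen3_eq_iff)
  then show ?thesis
    by (auto simp: T_normal_def valid_def T_set_eq successively_map successively_rev)
qed

theorem garside_nf_ex1: "\<exists>!p. is_garside_nf g p"
proof (rule ex1I[of _ "(map tval (rev (fst (code g))), snd (code g))"])
  show "is_garside_nf g (map tval (rev (fst (code g))), snd (code g))"
    using cval_code[of g] valid_code[of g] T_normal_tval[of "rev (fst (code g))" "snd (code g)"]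
    by (cases "code g") (simp add: is_garside_nf_def cval_def)
next
  fix p assume p: "is_garside_nf g p"
  obtain ts k where ts: "p = (ts, k)" by (cases p)
  from p have T: "T_normal ts" and g: "g = prod_list ts * Delta powi k"
    by (auto simp: is_garside_nf_def ts)
  from T have "ts \<in> lists (range tval)" by (auto simp: T_normal_def T_set_eq)
  then obtain cs where cs: "ts = map tval cs"
    by (metis (no_types) ex_map_conv in_lists_conv_set rangeE)
  have "valid (rev cs, k)" using T cs T_normal_tval by simp
  from code_cval[OF this] have "code g = (rev cs, k)" by (simp add: g cs cval_def)
  then show "p = (map tval (rev (fst (code g))), snd (code g))" by (simp add: ts cs)
qed

lemma garside_nf: "is_garside_nf g (garside_nf g)"
  unfolding garside_nf_def by (rule theI'[OF garside_nf_ex1])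


section \<open>Random walks\<close>

definition conv_pmf :: "'a::monoid_mult pmf \<Rightarrow> 'a pmf \<Rightarrow> 'a pmf" where
  "conv_pmf \<mu> \<nu> = map_pmf (\<lambda>(x, y). x * y) (pair_pmf \<mu> \<nu>)"

primrec conv_power :: "'a::monoid_mult pmf \<Rightarrow> nat \<Rightarrow> 'a pmf" where
  "conv_power \<nu> 0 = return_pmf 1"
| "conv_power \<nu> (Suc n) = conv_pmf (conv_power \<nu> n) \<nu>"

definition walk :: "(nat \<Rightarrow> 'w \<Rightarrow> 'a::monoid_mult) \<Rightarrow> nat \<Rightarrow> 'w \<Rightarrow> 'a" where
  "walk x n \<omega> = prod_list (map (\<lambda>i. x i \<omega>) [1..<n + 1])"

definition is_realization ::
    "'w measure \<Rightarrow> 'a::monoid_mult pmf \<Rightarrow> (nat \<Rightarrow> 'w \<Rightarrow> 'a) \<Rightarrow> bool" where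
  "is_realization M \<nu> X \<longleftrightarrow>
     prob_space M \<and>
     (\<exists>x. prob_space.indep_vars M (\<lambda>_. count_space UNIV) x {1..} \<and>
          (\<forall>i\<ge>1. distr M (count_space UNIV) (x i) = measure_pmf \<nu>) \<and>
          X = walk x)"

text \<open>Unspecified when \<open>Z n / n\<close> has no almost sure constant limit; on a probability space
  such a limit is unique.\<close>

definition drift :: "'w measure \<Rightarrow> (nat \<Rightarrow> 'w \<Rightarrow> real) \<Rightarrow> real" where
  "drift M Z = (THE c. AE \<omega> in M. (\<lambda>n. Z n \<omega> / real n) \<longlonglongrightarrow> c)"

end

theory Submission
  imports Defs
begin

text \<open>
  Let \<open>Q\<close> be \<open>|\<cdot>|\<^sub>T\<close> or the exponent of \<open>\<Delta>\<close>. Both are additive up to the amount of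
  cancellation: \<open>Q(gh) - Q(g) - Q(h)\<close> is bounded by twice the number of letters of \<open>h\<close> that cancel, plus one,
  and these letters are dictated by \<open>g\<close>. So long cancellation forces the walk through one
  prescribed normal form. Acting on the left on \<open>B\<^sub>3/\<langle>\<Delta>\<rangle>\<close>, a paradoxical decomposition
  gives a spectral gap, hence an exponentially decaying Green function, hence bounded second moments
  of the defects of \<open>Q\<close> along the walk.

  The defects being bounded in \<open>L\<^sup>2\<close>, the mean and the variance of \<open>Q(X\<^sub>n)\<close> are
  \<open>n\<gamma> + O(1)\<close> and \<open>n\<sigma>\<^sup>2 + O(\<surd>n)\<close>. The characteristic function \<open>\<phi>\<^sub>n\<close> of the centred variable
  satisfies \<open>|\<phi>\<^sub>m\<^sub>+\<^sub>n(s) - \<phi>\<^sub>m(s) \<phi>\<^sub>n(s)| \<le> C s\<^sup>2 \<surd>(m + n)\<close>, because the term linear in the centred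
  defect integrates to zero; repeated halving of \<open>n\<close> down to blocks of a fixed size \<open>m\<close> then compares
  \<open>\<phi>\<^sub>n\<close> with the Gaussian up to \<open>O(s\<^sup>2 n / \<surd>m)\<close>. Finally \<open>\<sigma> > 0\<close> because two elements with very
  different values of \<open>Q\<close> are charged by the same convolution power.
\<close>

section \<open>Cancellation in Garside normal forms\<close>

text \<open>The centre of B_3 is generated by \<Delta>^2 and the quotient is PSL(2,Z), which is not
  amenable; this is the source of the spectral gap. As \<langle>\<Delta>\<rangle> is not normal,
  only the left action on its cosets is available. Hence the Green function is expanded with the new
  factor on the left, although the walk grows on the right, where the cancellation occurs. The step
  law need not be symmetric, so the gap is stated as a lower bound for the averaged energy of a
  function and not through a self-adjoint operator. The defect bounds have to be uniform in the
  fixed factor, because joining two blocks integrates over it. A fixed left factor yields almost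
  additivity; a fixed right factor enters when an element is inserted between two blocks, which is
  how the variance is bounded below. The limit theorem concerns the laws of the X_n one at a time;
  the walk as a process enters through the law of large numbers, which identifies the drift.\<close>

definition flip :: "int \<Rightarrow> gen \<Rightarrow> gen" where
  "flip k x = (if even k then x else other x)"

lemma garside_nf_code: "garside_nf g = (map tval (rev (fst (code g))), snd (code g))"
proof -
  have "is_garside_nf g (map tval (rev (fst (code g))), snd (code g))"
    using cval_code[of g] valid_code[of g] T_normal_tval[of "rev (fst (code g))" "snd (code g)"]
    by (cases "code g") (simp add: is_garside_nf_def cval_def)
  then show ?thesis
    unfolding garside_nf_def by (rule the1_equality[OF garside_nf_ex1])
qed

lemma T_length_code: "T_length g = length (fst (code g))"
  by (simp add: T_length_def garside_nf_code)

lemma Delta_exp_code: "Delta_exp g = snd (code g)"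
  by (simp add: Delta_exp_def garside_nf_code)

text \<open>Only the top letter of the stack can react; the power \<Delta>^k in between renames the
  new letter by \<open>flip k\<close>. If the letters do not match, two short ones join to a long
  one, two long ones leave a short one and a \<Delta> (as in abab = a\<Delta>), and a short and a
  long one vanish into \<Delta>.\<close>

lemma code_mult_tval:
  assumes "code g = (r, k)"
  shows "code (g * tval (f, l)) =
    (case r of [] \<Rightarrow> ([(flip k f, flip k l)], k)
     | (p, q) # r' \<Rightarrow>
        if q = flip k f then ((flip k f, flip k l) # r, k)
        else if p = q \<and> f = l then ((p, flip k f) # r', k)
        else if p \<noteq> q \<and> f \<noteq> l then ((p, p) # r', k + 1)
        else (r', k + 1))"
proof -
  have v: "valid (r, k)" using valid_code[of g] assms by simp
  have c: "code (g * tval (f, l)) = (if f = l then act f (r, k) else act l (act f (r, k)))"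
    by (simp add: tval_def mult.assoc[symmetric] code_mult_gen assms)
  show ?thesis
  proof (cases r)
    case Nil
    then show ?thesis unfolding c
      by (cases f; cases l) (auto simp: act_def flip_def)
  next
    case (Cons t r')
    obtain p q where t: "t = (p, q)" by (cases t)
    show ?thesis
    proof (cases r')
      case Nil
      then show ?thesis unfolding c Cons t
        by (cases f; cases l; cases p; cases q) (auto simp: act_def flip_def)
    next
      case (Cons t' r'')
      obtain p' q' where t': "t' = (p', q')" by (cases t')
      have "q' = p" using v by (simp add: \<open>r = t # r'\<close> Cons t t' valid_def)
      then show ?thesis unfolding c \<open>r = t # r'\<close> Cons t t'
        by (cases f; cases l; cases p; cases q) (auto simp: act_def flip_def)
    qed
  qed
qed

lemma U_set_tval: "x \<in> U_set \<longleftrightarrow> (\<exists>f l k. x = tval (f, l) * Delta powi k)"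
  by (auto simp: U_set_def T_set_eq)

text \<open>One step disturbs at most the top entry. Applied to the inverse of a step, this shows
  that whatever lies below the top was there before the step.\<close>

lemma stack_mult_U_set:
  assumes "x \<in> U_set"
  shows "\<exists>ts. fst (code (g * x)) = ts @ tl (fst (code g))"
proof -
  obtain f l k where x: "x = tval (f, l) * Delta powi k" using assms U_set_tval by auto
  obtain r j where g: "code g = (r, j)" by (cases "code g")
  have "fst (code (g * x)) = fst (code (g * tval (f, l)))"
    by (simp add: x mult.assoc[symmetric] code_mult_Delta_powi shift_def split: prod.splits)
  moreover have "\<exists>ts. fst (code (g * tval (f, l))) = ts @ tl r"
  proof (cases r)
    case Nil
    then show ?thesis unfolding code_mult_tval[OF g] by (intro exI[of _ "[(flip j f, flip j l)]"]) simp
  next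
    case (Cons t r')
    obtain p q where t: "t = (p, q)" by (cases t)
    show ?thesis unfolding code_mult_tval[OF g] Cons t
      by (intro exI[of _ "if q = flip j f then [(flip j f, flip j l), (p, q)]
        else if p = q \<and> f = l then [(p, flip j f)] else if p \<noteq> q \<and> f \<noteq> l then [(p, p)] else []"]) simp
  qed
  ultimately show ?thesis by (simp add: g)
qed

text \<open>\<open>kill k t\<close> is the only letter that cancels a last letter \<open>t\<close> when the exponent of \<open>\<Delta>\<close> is \<open>k\<close>.\<close>

definition kill :: "int \<Rightarrow> gen \<times> gen \<Rightarrow> gen \<times> gen" where
  "kill k = (\<lambda>(p, q). (flip k (other q), flip k (if p = q then q else other q)))"

text \<open>The word that would cancel the whole stack, read from its top. Every complete
  cancellation produces one more \<Delta>, hence the \<open>k + 1\<close> for the next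
  entry.\<close>

fun kills :: "int \<Rightarrow> (gen \<times> gen) list \<Rightarrow> (gen \<times> gen) list" where
  "kills k [] = []"
| "kills k (t # r) = kill k t # kills (k + 1) r"

abbreviation normal :: "(gen \<times> gen) list \<Rightarrow> bool" where
  "normal \<equiv> successively (\<lambda>s t. snd s = fst t)"

text \<open>Matching letters concatenate to a normal form, and the matching propagates along a
  normal word, so nothing reacts once the first pair matches.\<close>

lemma code_mult_aligned:
  assumes "normal zs" "code g = (r, k)"
    "zs = [] \<or> r = [] \<or> snd (hd r) = flip k (fst (hd zs))"
  shows "length (fst (code (g * prod_list (map tval zs)))) = length r + length zs \<and>
         snd (code (g * prod_list (map tval zs))) = k"
  using assms
proof (induction zs arbitrary: g r)
  case Nil
  then show ?case by simp
next
  case (Cons z zs)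
  obtain f l where z: "z = (f, l)" by (cases z)
  have 1: "code (g * tval z) = ((flip k f, flip k l) # r, k)"
    unfolding z code_mult_tval[OF Cons.prems(2)] using Cons.prems(3)
    by (auto simp: z split: list.splits)
  have "zs = [] \<or> l = fst (hd zs)" "normal zs" using Cons.prems(1) by (cases zs; auto simp: z)+
  with Cons.IH[of "g * tval z", OF _ 1] show ?case
    by (auto simp: mult.assoc)
qed

text \<open>\<open>c\<close> counts complete cancellations: each removes one letter on either side
  and adds one \<Delta>. When they stop, at most one pair of letters of equal length merges, which
  costs one letter and adds at most one \<Delta>; the result matches the rest of \<open>zs\<close>.
  This single merger is the slack of 1 in the bounds.\<close>

lemma cancellation_aux:
  assumes "normal zs" "code g = (r, k)"
  shows "\<exists>c. c \<le> length r \<and> c \<le> length zs \<and> take c zs = take c (kills k r)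
     \<and> length (fst (code (g * prod_list (map tval zs)))) + 2 * c \<le> length r + length zs
     \<and> length r + length zs \<le> length (fst (code (g * prod_list (map tval zs)))) + 2 * c + 1
     \<and> k + int c \<le> snd (code (g * prod_list (map tval zs)))
     \<and> snd (code (g * prod_list (map tval zs))) \<le> k + int c + 1"
  using assms
proof (induction zs arbitrary: g r k)
  case Nil
  then show ?case by simp
next
  case (Cons z zs)
  obtain f l where z: "z = (f, l)" by (cases z)
  have nz: "normal zs" and al: "zs = [] \<or> l = fst (hd zs)"
    using Cons.prems(1) by (cases zs; auto simp: z)+
  let ?h = "g * tval z"
  have assoc: "g * prod_list (map tval (z # zs)) = ?h * prod_list (map tval zs)"
    by (simp add: mult.assoc)
  show ?case
  proof (cases "r = [] \<or> snd (hd r) = flip k f")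
    case True
    have "length (fst (code (g * prod_list (map tval (z # zs))))) = length r + length (z # zs) \<and>
         snd (code (g * prod_list (map tval (z # zs)))) = k"
      using True by (intro code_mult_aligned Cons.prems) (auto simp: z)
    then show ?thesis by (intro exI[of _ 0]) simp
  next
    case False
    then obtain p q r' where r: "r = (p, q) # r'" and q: "q \<noteq> flip k f"
      by (cases r) (auto split: prod.splits)
    note c = code_mult_tval[OF Cons.prems(2), of f l, folded z]
    show ?thesis
    proof (cases "(p = q) = (f = l)")
      case True
      \<comment> \<open>Two long letters leave \<open>(p, p)\<close> and a new \<Delta>; this says
        that the remaining letter still matches the next letter of \<open>zs\<close>, which starts
        with \<open>l\<close>.\<close>
      have pf: "p \<noteq> q \<Longrightarrow> f \<noteq> l \<Longrightarrow> p = flip (k + 1) l"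
        using q by (cases "even k"; cases f; cases l; cases p; cases q) (auto simp: flip_def)
      obtain y j where h: "code ?h = ((p, y) # r', j)" and y: "y = flip j l"
        and j: "j = k \<or> j = k + 1"
      proof (cases "f = l")
        case t: True
        then show ?thesis using that[of "flip k f" k] c True q by (simp add: r)
      next
        case t: False
        then show ?thesis using that[of p "k + 1"] c True q pf by (simp add: r)
      qed
      have "length (fst (code (?h * prod_list (map tval zs)))) = length r + length zs \<and>
         snd (code (?h * prod_list (map tval zs))) = j"
        using code_mult_aligned[OF nz h] al y by (auto simp: r)
      then show ?thesis using j unfolding assoc by (intro exI[of _ 0]) auto
    next
      case False
      then have h: "code ?h = (r', k + 1)" using c q r by auto
      have zk: "z = kill k (p, q)" using False q
        by (cases "even k"; cases f; cases l; cases p; cases q) (auto simp: kill_def z flip_def)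
      obtain c where "c \<le> length r' \<and> c \<le> length zs \<and> take c zs = take c (kills (k + 1) r')
         \<and> length (fst (code (?h * prod_list (map tval zs)))) + 2 * c \<le> length r' + length zs
         \<and> length r' + length zs \<le> length (fst (code (?h * prod_list (map tval zs)))) + 2 * c + 1
         \<and> k + 1 + int c \<le> snd (code (?h * prod_list (map tval zs)))
         \<and> snd (code (?h * prod_list (map tval zs))) \<le> k + 1 + int c + 1"
        using Cons.IH[OF nz h] by blast
      then show ?thesis unfolding assoc
        by (intro exI[of _ "Suc c"]) (auto simp: r zk)
    qed
  qed
qed

lemma cancellation:
  "\<exists>c. c \<le> length (fst (code h)) \<and>
     take c (rev (fst (code h))) = take c (kills (snd (code g)) (fst (code g))) \<and>
     T_length (g * h) + 2 * c \<le> T_length g + T_length h \<and>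
     T_length g + T_length h \<le> T_length (g * h) + 2 * c + 1 \<and>
     Delta_exp g + Delta_exp h + int c \<le> Delta_exp (g * h) \<and>
     Delta_exp (g * h) \<le> Delta_exp g + Delta_exp h + int c + 1"
proof -
  obtain r k where h: "code h = (r, k)" by (cases "code h")
  have hh: "h = prod_list (map tval (rev r)) * Delta powi k"
    using cval_code[of h] by (simp add: h cval_def)
  have n: "normal (rev r)" using valid_code[of h] by (simp add: h valid_def successively_rev)
  have "code (g * h) = shift k (code (g * prod_list (map tval (rev r))))"
    by (simp add: hh mult.assoc[symmetric] code_mult_Delta_powi)
  then have "fst (code (g * h)) = fst (code (g * prod_list (map tval (rev r))))"
    "snd (code (g * h)) = snd (code (g * prod_list (map tval (rev r)))) + k"
    by (simp_all add: shift_def split: prod.splits)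
  with cancellation_aux[OF n, of g "fst (code g)" "snd (code g)"] h
  show ?thesis by (auto simp: T_length_code Delta_exp_code)
qed

lemma code_tval: "code (tval t) = ([t], 0)"
  using code_prod[of "[t]"] by (simp add: valid_def)

lemma Delta_exp_step:
  assumes "x \<in> U_set"
  shows "Delta_exp (g * x) - Delta_exp g - Delta_exp x \<in> {0, 1}"
proof -
  obtain f l k where x: "x = tval (f, l) * Delta powi k" using assms U_set_tval by auto
  obtain r j where g: "code g = (r, j)" by (cases "code g")
  have "Delta_exp (h * x) = Delta_exp (h * tval (f, l)) + k" for h
    by (simp add: x Delta_exp_code mult.assoc[symmetric] code_mult_Delta_powi shift_def split: prod.splits)
  from this[of g] this[of 1] show ?thesis
    unfolding Delta_exp_code code_mult_tval[OF g] by (auto simp: g code_tval split: list.splits)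
qed

section \<open>Lengths of products and inverses\<close>

lemma T_length_U: "x \<in> U_set \<Longrightarrow> T_length x = 1"
  by (auto simp: U_set_tval T_length_code code_tval code_mult_Delta_powi shift_def)

lemma T_length_mult_le: "T_length (g * h) \<le> T_length g + T_length h"
  using cancellation[of h g] by auto

lemma braid3_inverse_unique: "g * h = 1 \<Longrightarrow> h = inverse (g :: braid3)"
  by (metis braid3_left_inverse mult.assoc mult.left_neutral mult.right_neutral)

lemma braid3_inverse_mult: "inverse (g * h) = inverse h * inverse (g :: braid3)"
proof -
  have "(g * h) * (inverse h * inverse g) = g * (h * inverse h) * inverse g"
    by (simp only: mult.assoc)
  then show ?thesis by (intro braid3_inverse_unique[symmetric]) simp
qed

lemma braid3_inverse_inverse [simp]: "inverse (inverse g) = (g :: braid3)"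
  by (rule braid3_inverse_unique[symmetric]) simp

lemma code_1: "code 1 = ([], 0)"
  using code_of_word[of "[]"] by (simp add: of_word_Nil)

lemma code_Delta_powi: "code (Delta powi k) = ([], k)"
  using code_mult_Delta_powi[of 1 k] by (simp add: code_1 shift_def)

lemma code_inj: "code g = code h \<Longrightarrow> g = h"
  by (metis cval_code)

lemma Delta_powi_add: "Delta powi (j + k) = Delta powi j * Delta powi k"
  by (rule code_inj) (simp add: code_mult_Delta_powi code_Delta_powi shift_def)

lemma inverse_Delta_powi: "inverse (Delta powi k) = Delta powi (- k)"
  by (rule braid3_inverse_unique[symmetric]) (simp flip: Delta_powi_add)

lemma T_length_Delta_powi: "T_length (Delta powi k) = 0"
  by (simp add: T_length_code code_Delta_powi)

lemma Delta_powi_tval: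
  "Delta powi k * tval (f, l) = tval (flip k f, flip k l) * Delta powi k"
proof -
  have 1: "Delta powi k * gen3 x = gen3 (flip k x) * Delta powi k" for x
    by (simp add: Delta_powi_gen flip_def)
  have "Delta powi k * (gen3 x * gen3 y) = Delta powi k * gen3 x * gen3 y" for x y
    by (simp only: mult.assoc)
  also have "\<dots> x y = gen3 (flip k x) * gen3 (flip k y) * Delta powi k" for x y
    by (simp only: 1 mult.assoc)
  finally have "Delta powi k * (gen3 x * gen3 y) = gen3 (flip k x) * gen3 (flip k y) * Delta powi k" for x y .
  moreover have "flip k f = flip k l \<longleftrightarrow> f = l" by (cases f; cases l) (auto simp: flip_def)
  ultimately show ?thesis using 1 by (simp add: tval_def)
qed

text \<open>Each letter of T has a complement with product \<Delta>: a times ba, or ab times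
  a.\<close>

lemma inverse_tval: "inverse (tval (f, l)) = tval (other l, f) * Delta powi (- 1)"
proof -
  have "tval (f, l) * tval (other l, f) = Delta"
  proof (cases "f = l")
    case True
    then show ?thesis using Delta_eq[of f] by (simp add: tval_def mult.assoc)
  next
    case False
    then have "l = other f" by (cases f; cases l) auto
    then show ?thesis using Delta_eq[of f] by (simp add: tval_def mult.assoc)
  qed
  then have "tval (f, l) * (tval (other l, f) * inverse Delta) = 1"
    by (simp add: mult.assoc[symmetric])
  then show ?thesis
    using braid3_inverse_unique[of "tval (f, l)"] by (simp add: power_int_def)
qed

text \<open>Complements of letters are letters, and moving powers of \<Delta> to the right only
  renames them. So one-step estimates can be run backwards, and the inverted walk is of the same
  kind.\<close>

lemma inverse_U_set:
  assumes "x \<in> U_set" shows "inverse x \<in> U_set"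
proof -
  obtain f l k where x: "x = tval (f, l) * Delta powi k" using assms U_set_tval by auto
  have "inverse x = Delta powi (- k) * tval (other l, f) * Delta powi (- 1)"
    by (simp add: x braid3_inverse_mult inverse_Delta_powi inverse_tval mult.assoc)
  also have "\<dots> = tval (flip (- k) (other l), flip (- k) f) * Delta powi (- k + - 1)"
    by (simp only: Delta_powi_tval mult.assoc Delta_powi_add)
  finally show ?thesis using U_set_tval by blast
qed

lemma T_length_inverse_le: "T_length (inverse g) \<le> T_length g"
proof -
  obtain r k where h: "code g = (r, k)" by (cases "code g")
  have g: "g = prod_list (map tval (rev r)) * Delta powi k"
    using cval_code[of g] by (simp add: h cval_def)
  have "T_length (inverse (prod_list (map tval cs))) \<le> length cs" for cs
  proof (induction cs)
    case Nil
    have "inverse (1 :: braid3) = 1" by (rule braid3_inverse_unique[symmetric]) simp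
    then show ?case by (simp add: T_length_code code_1)
  next
    case (Cons t cs)
    have "tval t = tval (fst t, snd t) * Delta powi 0" by simp
    then have "tval t \<in> U_set" unfolding U_set_tval by blast
    then have "T_length (inverse (tval t)) = 1" by (intro T_length_U inverse_U_set)
    then show ?case
      using Cons.IH T_length_mult_le[of "inverse (prod_list (map tval cs))" "inverse (tval t)"]
      by (simp add: braid3_inverse_mult)
  qed
  from this[of "rev r"]
    T_length_mult_le[of "Delta powi (- k)" "inverse (prod_list (map tval (rev r)))"]
  have "T_length (inverse g) \<le> length r"
    by (simp add: g braid3_inverse_mult inverse_Delta_powi T_length_Delta_powi)
  then show ?thesis by (simp add: T_length_code h)
qed

lemma T_length_inverse: "T_length (inverse g) = T_length g"
  using T_length_inverse_le[of g] T_length_inverse_le[of "inverse g"] by simp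

lemma T_length_mult_U_left:
  assumes "x \<in> U_set" shows "T_length g \<le> Suc (T_length (x * g))"
proof -
  have "g = inverse x * (x * g)" by (simp add: mult.assoc[symmetric])
  then show ?thesis
    using T_length_mult_le[of "inverse x" "x * g"] T_length_U[OF inverse_U_set[OF assms]] by simp
qed

lemma T_length_mult_U_right:
  assumes "x \<in> U_set"
  shows "T_length (g * x) \<le> Suc (T_length g)" "T_length g \<le> Suc (T_length (g * x))"
proof -
  show "T_length (g * x) \<le> Suc (T_length g)"
    using T_length_mult_le[of g x] T_length_U[OF assms] by simp
  have "g = (g * x) * inverse x" by (simp add: mult.assoc)
  then show "T_length g \<le> Suc (T_length (g * x))"
    using T_length_mult_le[of "g * x" "inverse x"] T_length_U[OF inverse_U_set[OF assms]] by simp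
qed

text \<open>The abelianization of B_3, well defined because the braid relation is homogeneous. A
  generator changes it by one, so it bounds the word length from below.\<close>

lift_definition expsum :: "braid3 \<Rightarrow> int" is "\<lambda>w. \<Sum>(x, e)\<leftarrow>w. if e then 1 else - 1"
proof -
  fix u v :: word3
  assume "braid_eq u v"
  then show "(\<Sum>(x, e)\<leftarrow>u. if e then 1 else - 1) = (\<Sum>(x, e)\<leftarrow>v. if e then 1 else - 1 :: int)"
    unfolding braid_eq_def
  proof (induction rule: equivclp_induct)
    case (step y z)
    have "braid_step u v \<Longrightarrow>
      (\<Sum>(x, e)\<leftarrow>u. if e then 1 else - 1) = (\<Sum>(x, e)\<leftarrow>v. if e then 1 else - 1 :: int)" for u v
      by (induction rule: braid_step.induct) auto
    then show ?case using step by metis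
  qed simp
qed

lemma expsum_1 [simp]: "expsum 1 = 0"
  by transfer simp

lemma expsum_mult: "expsum (g * h) = expsum g + expsum h"
  by transfer simp

lemma expsum_gen3: "expsum (gen3 x) = 1"
  by transfer simp

lemma expsum_inverse: "expsum (inverse g) = - expsum g"
  using expsum_mult[of g "inverse g"] by simp

lemma expsum_Delta: "expsum Delta = 3"
  by (simp add: Delta_eq[of GA] expsum_mult expsum_gen3)

lemma expsum_Delta_powi: "expsum (Delta powi k) = 3 * k"
  by (induction k rule: int_induct[where k = 0])
     (simp_all add: powi_Suc powi_minus expsum_mult expsum_inverse expsum_Delta)

lemma abs_expsum_le_word_length: "\<bar>expsum g\<bar> \<le> int (word_length g)"
proof -
  have "\<exists>w. set w \<subseteq> S_gens \<and> prod_list w = of_word u" for u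
  proof (induction u)
    case Nil
    show ?case by (intro exI[of _ "[]"]) (simp add: of_word_Nil)
  next
    case (Cons l u)
    then obtain w where w: "set w \<subseteq> S_gens" "prod_list w = of_word u" by blast
    have "of_word [l] \<in> S_gens"
      by (cases l; cases "fst l") (auto simp: of_word_letter S_gens_def br_a_def br_b_def)
    then show ?case using w of_word_append[of "[l]" u]
      by (intro exI[of _ "of_word [l] # w"]) simp
  qed
  then have "\<exists>n w. set w \<subseteq> S_gens \<and> prod_list w = g \<and> length w = n"
    using of_word_surj[of g] by metis
  from LeastI_ex[OF this] obtain w where
    w: "set w \<subseteq> S_gens" "prod_list w = g" "length w = word_length g"
    unfolding word_length_def by blast
  have "set w \<subseteq> S_gens \<Longrightarrow> \<bar>expsum (prod_list w)\<bar> \<le> int (length w)" for w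
    by (induction w) (auto simp: expsum_mult S_gens_def br_a_def br_b_def expsum_gen3 expsum_inverse)
  from this[OF w(1)] w show ?thesis by simp
qed

text \<open>\<Delta> has exponent sum 3 and a letter of T has 1 or 2, hence the slack 2.\<close>

lemma abs_Delta_exp_le_word_length:
  assumes "x \<in> U_set" shows "3 * \<bar>Delta_exp x\<bar> \<le> int (word_length x) + 2"
proof -
  obtain f l k where x: "x = tval (f, l) * Delta powi k" using assms U_set_tval by auto
  have "Delta_exp x = k" by (simp add: x Delta_exp_code code_tval code_mult_Delta_powi shift_def)
  moreover have "expsum (tval (f, l)) \<in> {1, 2}"
    by (simp add: tval_def expsum_mult expsum_gen3)
  ultimately show ?thesis using abs_expsum_le_word_length[of x]
    by (auto simp: x expsum_mult expsum_Delta_powi)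
qed

instance gen :: countable by countable_datatype

text \<open>Countability makes products of random elements measurable for the discrete
  sigma-algebra.\<close>

instance braid3 :: countable
proof
  have "inj (to_nat \<circ> code)"
    by (intro inj_compose injI) (auto intro: code_inj)
  then show "\<exists>f :: braid3 \<Rightarrow> nat. inj f" by (rule exI[of _ "to_nat \<circ> code"])
qed

section \<open>Convolution powers\<close>

lemma conv_pmf_assoc: "conv_pmf (conv_pmf \<mu> \<nu>) \<rho> = conv_pmf \<mu> (conv_pmf \<nu> \<rho>)"
  by (simp add: conv_pmf_def pair_pmf_def map_bind_pmf bind_map_pmf bind_assoc_pmf bind_return_pmf
      map_pmf_def mult.assoc)

lemma conv_pmf_return_left [simp]: "conv_pmf (return_pmf 1) \<mu> = \<mu>"
  by (simp add: conv_pmf_def pair_return_pmf1 map_pmf_comp)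

lemma conv_pmf_return_right [simp]: "conv_pmf \<mu> (return_pmf 1) = \<mu>"
  by (simp add: conv_pmf_def pair_return_pmf2 map_pmf_comp)

lemma conv_power_add: "conv_power \<nu> (m + n) = conv_pmf (conv_power \<nu> m) (conv_power \<nu> n)"
  by (induction n) (simp_all add: conv_pmf_assoc)

lemma conv_power_Suc_left: "conv_power \<nu> (Suc n) = conv_pmf \<nu> (conv_power \<nu> n)"
  using conv_power_add[of \<nu> 1 n] by simp

lemma set_conv_pmf: "set_pmf (conv_pmf \<mu> \<nu>) = {x * y |x y. x \<in> set_pmf \<mu> \<and> y \<in> set_pmf \<nu>}"
  by (auto simp: conv_pmf_def)

lemma set_conv_power_mult:
  "x \<in> set_pmf (conv_power \<nu> m) \<Longrightarrow> x ^ n \<in> set_pmf (conv_power \<nu> (m * n))"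
  by (induction n)
     (auto simp: conv_power_add set_conv_pmf power_Suc2 add.commute[of m] simp del: power_Suc)

lemma nn_integral_conv_pmf:
  "(\<integral>\<^sup>+ z. f z \<partial>conv_pmf \<mu> \<nu>) = (\<integral>\<^sup>+ x. \<integral>\<^sup>+ y. f (x * y) \<partial>\<nu> \<partial>\<mu>)"
  by (simp add: conv_pmf_def nn_integral_pair_pmf')

section \<open>Spectral gap on stacks and the Green function\<close>

text \<open>A stack is a reversed Garside normal form without its power of \<open>\<Delta>\<close>; it stands for a coset of
  \<open>\<langle>\<Delta>\<rangle>\<close>, and \<open>sact\<close> below is the left action of the group on these cosets.\<close>

definition stacks :: "(gen \<times> gen) list set" where
  "stacks = {r. valid (r, 0)}"

definition stk :: "braid3 \<Rightarrow> (gen \<times> gen) list" where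
  "stk g = fst (code g)"

definition sact :: "braid3 \<Rightarrow> (gen \<times> gen) list \<Rightarrow> (gen \<times> gen) list" where
  "sact h r = stk (h * cval (r, 0))"

lemma stk_in_stacks [simp]: "stk g \<in> stacks"
  using valid_code[of g] by (simp add: stacks_def stk_def valid_def)

lemma stk_mult_Delta_powi [simp]: "stk (g * Delta powi k) = stk g"
  by (simp add: stk_def code_mult_Delta_powi shift_def split: prod.splits)

lemma stk_cval: "r \<in> stacks \<Longrightarrow> stk (cval (r, 0)) = r"
  by (simp add: stacks_def stk_def code_cval)

lemma cval_stk: "g = cval (stk g, 0) * Delta powi (snd (code g))"
  using cval_code[of g] by (cases "code g") (simp add: stk_def cval_def)

lemma sact_stk: "sact h (stk g) = stk (h * g)"
proof -
  have "stk (h * g) = stk (h * cval (stk g, 0) * Delta powi (snd (code g)))"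
    using cval_stk[of g] by (simp only: mult.assoc)
  then show ?thesis by (simp add: sact_def)
qed

lemma sact_in_stacks [simp]: "sact h r \<in> stacks"
  by (simp add: sact_def)

lemma sact_sact [simp]: "sact g (sact h r) = sact (g * h) r"
  using sact_stk[of g "h * cval (r, 0)"] by (simp add: sact_def mult.assoc)

lemma sact_1 [simp]: "r \<in> stacks \<Longrightarrow> sact 1 r = r"
  by (simp add: sact_def stk_cval)

lemma bij_sact: "bij_betw (sact h) stacks stacks"
  by (rule bij_betwI[where g = "sact (inverse h)"]) auto

lemma T_length_stk: "T_length g = length (stk g)"
  by (simp add: T_length_code stk_def)

lemma length_sact:
  assumes "x \<in> U_set" "r \<in> stacks"
  shows "length r \<le> Suc (length (sact x r))"
  using T_length_mult_U_left[OF assms(1), of "cval (r, 0)"] assms(2)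
  by (simp add: T_length_stk stk_cval sact_def)

text \<open>The last entry of a stack is the first letter of the normal form, so a matching letter
  multiplied on the left is appended at the end.\<close>

lemma sact_tval:
  assumes "r \<in> stacks" "r = [] \<or> fst (last r) = l"
  shows "sact (tval (f, l)) r = r @ [(f, l)]"
proof -
  have "successively (\<lambda>t s. snd s = fst t) (r @ [(f, l)])"
    using assms by (auto simp: stacks_def valid_def successively_append_iff)
  then have "r @ [(f, l)] \<in> stacks" by (simp add: stacks_def valid_def)
  moreover have "cval (r @ [(f, l)], 0) = tval (f, l) * cval (r, 0)"
    by (simp add: cval_def)
  ultimately show ?thesis by (metis sact_def stk_cval)
qed

text \<open>\<Delta> passes through the normal form, exchanging a and b, and is absorbed by the
  coset.\<close>

lemma sact_Delta:
  assumes "r \<in> stacks"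
  shows "sact Delta r = map (\<lambda>(f, l). (other f, other l)) r"
proof -
  have 1: "Delta * tval (f, l) = tval (other f, other l) * Delta" for f l
    using Delta_powi_tval[of 1 f l] by (simp add: flip_def)
  have 2: "Delta * prod_list (map tval cs)
    = prod_list (map tval (map (\<lambda>(f, l). (other f, other l)) cs)) * Delta" for cs
  proof (induction cs)
    case (Cons t cs)
    obtain f l where t: "t = (f, l)" by (cases t)
    have "Delta * prod_list (map tval (t # cs)) = Delta * tval (f, l) * prod_list (map tval cs)"
      by (simp add: t mult.assoc)
    also have "\<dots> = tval (other f, other l) * (Delta * prod_list (map tval cs))"
      by (simp only: 1 mult.assoc)
    finally show ?case by (simp only: Cons.IH) (simp add: t mult.assoc)
  qed simp
  let ?r = "map (\<lambda>(f, l). (other f, other l)) r"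
  have "Delta * cval (r, 0) = cval (?r, 0) * Delta powi 1"
    using 2[of "rev r"] by (simp add: cval_def rev_map)
  then have "sact Delta r = stk (cval (?r, 0))" unfolding sact_def by (simp only: stk_mult_Delta_powi)
  moreover have "successively (\<lambda>t s. snd s = fst t) ?r"
    using assms by (auto simp: stacks_def valid_def successively_map case_prod_beta
        intro: successively_mono)
  then have "?r \<in> stacks" by (simp add: stacks_def valid_def)
  ultimately show ?thesis by (simp add: stk_cval)
qed

text \<open>The squared l^2 distance between \<open>f\<close> and its translate. Values in
  \<open>ennreal\<close> avoid summability conditions on \<open>f\<close>.\<close>

definition energy :: "((gen \<times> gen) list \<Rightarrow> real) \<Rightarrow> braid3 \<Rightarrow> ennreal" where
  "energy f h = (\<integral>\<^sup>+ w. ennreal ((f w - f (sact h w))\<^sup>2) \<partial>count_space stacks)"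

definition mass :: "((gen \<times> gen) list \<Rightarrow> real) \<Rightarrow> (gen \<times> gen) list set \<Rightarrow> ennreal" where
  "mass f S = (\<integral>\<^sup>+ w. ennreal ((f w)\<^sup>2) * indicator S w \<partial>count_space stacks)"

lemma nn_integral_sact:
  "(\<integral>\<^sup>+ w. f (sact h w) \<partial>count_space stacks) = (\<integral>\<^sup>+ w. f w \<partial>count_space stacks)"
  by (rule nn_integral_bij_count_space[OF bij_sact])

lemma energy_1: "energy f 1 = 0"
  unfolding energy_def by (subst nn_integral_cong[where v = "\<lambda>_. 0"]) auto

text \<open>The triangle inequality through the translate by \<open>h\<close>, squared; translations
  preserve counting measure on the stacks.\<close>

lemma energy_mult: "energy f (g * h) \<le> 2 * energy f g + 2 * energy f h"
proof -
  have sq: "(a - c)\<^sup>2 \<le> 2 * (b - c)\<^sup>2 + 2 * (a - b)\<^sup>2" for a b c :: real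
    using sum_squares_ge_zero[of "a + c - 2 * b" 0] by (simp add: power2_eq_square algebra_simps)
  have "energy f (g * h) \<le> (\<integral>\<^sup>+ w. 2 * ennreal ((f (sact h w) - f (sact g (sact h w)))\<^sup>2)
      + 2 * ennreal ((f w - f (sact h w))\<^sup>2) \<partial>count_space stacks)"
    unfolding energy_def
  proof (intro nn_integral_mono)
    fix w
    have "ennreal ((f w - f (sact (g * h) w))\<^sup>2)
      \<le> ennreal (2 * (f (sact h w) - f (sact g (sact h w)))\<^sup>2 + 2 * (f w - f (sact h w))\<^sup>2)"
      using sq by (intro ennreal_leI) simp
    then show "ennreal ((f w - f (sact (g * h) w))\<^sup>2)
      \<le> 2 * ennreal ((f (sact h w) - f (sact g (sact h w)))\<^sup>2) + 2 * ennreal ((f w - f (sact h w))\<^sup>2)"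
      by (simp add: ennreal_plus ennreal_mult)
  qed
  also have "\<dots> = 2 * (\<integral>\<^sup>+ w. ennreal ((f (sact h w) - f (sact g (sact h w)))\<^sup>2) \<partial>count_space stacks)
      + 2 * energy f h"
    unfolding energy_def by (simp add: nn_integral_add nn_integral_cmult)
  also have "(\<integral>\<^sup>+ w. ennreal ((f (sact h w) - f (sact g (sact h w)))\<^sup>2) \<partial>count_space stacks) = energy f g"
    unfolding energy_def by (rule nn_integral_sact)
  finally show ?thesis .
qed

text \<open>This is \<open>(b + d)\<^sup>2 \<le> (1 + \<epsilon>) b\<^sup>2 + (1 + 1/\<epsilon>)
  d\<^sup>2\<close> with \<epsilon> = 1/2. A factor c in front of the mass closes the paradoxical
  argument as long as c (c - 1) < 1, which 3/2 satisfies.\<close>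

lemma mass_sact_le:
  assumes "\<And>w. w \<in> stacks \<Longrightarrow> w \<in> S \<Longrightarrow> sact h w \<in> S'"
  shows "mass f S \<le> ennreal (3/2) * mass f S' + 3 * energy f h"
proof -
  have sq: "a\<^sup>2 \<le> 3/2 * b\<^sup>2 + 3 * (a - b)\<^sup>2" for a b :: real
    using sum_squares_ge_zero[of "2 * a - 3 * b" 0] by (simp add: power2_eq_square algebra_simps)
  have "mass f S \<le> (\<integral>\<^sup>+ w. ennreal (3/2) * (ennreal ((f (sact h w))\<^sup>2) * indicator S' (sact h w))
      + 3 * ennreal ((f w - f (sact h w))\<^sup>2) \<partial>count_space stacks)"
    unfolding mass_def
  proof (intro nn_integral_mono)
    fix w assume "w \<in> space (count_space stacks)"
    then have w: "w \<in> stacks" by simp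
    have "ennreal ((f w)\<^sup>2) \<le> ennreal (3/2 * (f (sact h w))\<^sup>2 + 3 * (f w - f (sact h w))\<^sup>2)"
      by (intro ennreal_leI sq)
    also have "\<dots> = ennreal (3/2 * (f (sact h w))\<^sup>2) + ennreal (3 * (f w - f (sact h w))\<^sup>2)"
      by (rule ennreal_plus) auto
    also have "\<dots> = ennreal (3/2) * ennreal ((f (sact h w))\<^sup>2) + ennreal 3 * ennreal ((f w - f (sact h w))\<^sup>2)"
      by (subst (1 2) ennreal_mult) auto
    finally have "ennreal ((f w)\<^sup>2) \<le> ennreal (3/2) * ennreal ((f (sact h w))\<^sup>2)
      + 3 * ennreal ((f w - f (sact h w))\<^sup>2)" by simp
    then show "ennreal ((f w)\<^sup>2) * indicator S w
      \<le> ennreal (3/2) * (ennreal ((f (sact h w))\<^sup>2) * indicator S' (sact h w))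
        + 3 * ennreal ((f w - f (sact h w))\<^sup>2)"
      using assms[OF w] by (auto split: split_indicator)
  qed
  also have "\<dots> = ennreal (3/2) * (\<integral>\<^sup>+ w. ennreal ((f (sact h w))\<^sup>2) * indicator S' (sact h w) \<partial>count_space stacks)
      + 3 * energy f h"
    unfolding energy_def by (simp add: nn_integral_add nn_integral_cmult)
  also have "(\<integral>\<^sup>+ w. ennreal ((f (sact h w))\<^sup>2) * indicator S' (sact h w) \<partial>count_space stacks) = mass f S'"
    unfolding mass_def by (rule nn_integral_sact[of "\<lambda>w. ennreal ((f w)\<^sup>2) * indicator S' w"])
  finally show ?thesis .
qed

lemma mass_Un:
  assumes "S \<inter> S' = {}" "S \<union> S' \<subseteq> R"
  shows "mass f S + mass f S' \<le> mass f R"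
proof -
  have "mass f S + mass f S' = (\<integral>\<^sup>+ w. ennreal ((f w)\<^sup>2) * indicator S w
      + ennreal ((f w)\<^sup>2) * indicator S' w \<partial>count_space stacks)"
    unfolding mass_def by (simp add: nn_integral_add)
  also have "\<dots> \<le> mass f R" unfolding mass_def
    using assms by (intro nn_integral_mono) (auto split: split_indicator)
  finally show ?thesis .
qed

text \<open>The paradoxical decomposition: let \<open>A\<close> be the normal forms starting with the letter \<open>a\<close>. Then
  \<open>a A\<close> and \<open>ab (-A)\<close> are disjoint subsets of \<open>A\<close>, while \<open>\<Delta> A\<close> avoids \<open>A\<close>.\<close>

lemma mass_le_energy:
  assumes fin: "mass f UNIV < \<infinity>"
  shows "mass f UNIV \<le> 30 * (energy f br_a + energy f (br_a * br_b) + energy f Delta)"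
proof -
  define A where "A = {r :: (gen \<times> gen) list. r \<noteq> [] \<and> fst (last r) = GA}"
  define A1 where "A1 = {r :: (gen \<times> gen) list. r \<noteq> [] \<and> last r = (GA, GA)}"
  define A2 where "A2 = {r :: (gen \<times> gen) list. r \<noteq> [] \<and> last r = (GA, GB)}"
  have ab: "br_a * br_b = tval (GA, GB)" by (simp add: tval_simps)
  have 1: "mass f A \<le> ennreal (3/2) * mass f A1 + 3 * energy f br_a"
    unfolding tval_simps by (rule mass_sact_le) (auto simp: A_def A1_def sact_tval)
  have 2: "mass f (- A) \<le> ennreal (3/2) * mass f A2 + 3 * energy f (br_a * br_b)"
    unfolding ab
  proof (rule mass_sact_le)
    fix w assume w: "w \<in> stacks" "w \<in> - A"
    then have "w = [] \<or> fst (last w) = GB" by (auto simp: A_def intro: gen.exhaust)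
    then show "sact (tval (GA, GB)) w \<in> A2" using w by (simp add: sact_tval A2_def)
  qed
  have 3: "mass f A \<le> ennreal (3/2) * mass f (- A) + 3 * energy f Delta"
    by (rule mass_sact_le) (auto simp: A_def sact_Delta last_map split: prod.splits)
  have 4: "mass f A1 + mass f A2 \<le> mass f A"
    by (rule mass_Un) (auto simp: A_def A1_def A2_def)
  have 5: "mass f UNIV \<le> mass f A + mass f (- A)"
    unfolding mass_def by (subst nn_integral_add[symmetric]) (auto intro!: nn_integral_mono split: split_indicator)
  have le: "mass f S < \<infinity>" for S
  proof -
    have "mass f S \<le> mass f UNIV" unfolding mass_def by (intro nn_integral_mono) (auto split: split_indicator)
    then show ?thesis using fin by (rule le_less_trans)
  qed
  \<comment> \<open>A multiple of the mass of \<open>A\<close> will be absorbed into itself, so the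
    inequalities are moved to finite real numbers.\<close>
  define m where "m S = enn2real (mass f S)" for S
  have m: "m S \<ge> 0" "mass f S = ennreal (m S)" for S
    using le[of S] by (simp_all add: m_def)
  show ?thesis
  proof (cases "energy f br_a + energy f (br_a * br_b) + energy f Delta = top")
    case False
    then obtain x y z where e: "energy f br_a = ennreal x" "energy f (br_a * br_b) = ennreal y"
      "energy f Delta = ennreal z" "x \<ge> 0" "y \<ge> 0" "z \<ge> 0"
      by (cases "energy f br_a"; cases "energy f (br_a * br_b)"; cases "energy f Delta") auto
    note conv = m(2) e(1-3) ennreal_numeral[symmetric]
    note fold_ennreal = ennreal_mult[symmetric] ennreal_plus[symmetric]
    have "m A \<le> 3/2 * m A1 + 3 * x"
      using 1 m(1) e(4-6) unfolding conv
      by (simp add: fold_ennreal del: ennreal_plus ennreal_numeral)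
    moreover have "m (- A) \<le> 3/2 * m A2 + 3 * y"
      using 2 m(1) e(4-6) unfolding conv
      by (simp add: fold_ennreal del: ennreal_plus ennreal_numeral)
    moreover have "m A \<le> 3/2 * m (- A) + 3 * z"
      using 3 m(1) e(4-6) unfolding conv
      by (simp add: fold_ennreal del: ennreal_plus ennreal_numeral)
    moreover have "m A1 + m A2 \<le> m A" "m UNIV \<le> m A + m (- A)"
      using 4 5 m(1) unfolding conv
      by (simp_all add: fold_ennreal del: ennreal_plus ennreal_numeral)
    \<comment> \<open>The first, second and fourth inequality give b \<le> a/2 + 3x + 3y. With the
      third, a \<le> (3/4) a + (9/2) (x + y) + 3z, which yields the coefficients 18, 18 and 12, and
      finally 30 for a + b.\<close>
    moreover have "u \<le> 30 * (x + y + z)"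
      if "a \<le> 3/2 * a1 + 3 * x" "b \<le> 3/2 * a2 + 3 * y" "a \<le> 3/2 * b + 3 * z"
        "a1 + a2 \<le> a" "u \<le> a + b" for a a1 a2 b u :: real
    proof -
      have "b \<le> a / 2 + 3 * x + 3 * y" using that by simp
      then have "a \<le> 18 * x + 18 * y + 12 * z" using that(3) by simp
      then show ?thesis using \<open>b \<le> a / 2 + 3 * x + 3 * y\<close> that(5) e(4-6) by simp
    qed
    ultimately have "m UNIV \<le> 30 * (x + y + z)" by blast
    then show ?thesis using e(4-6) unfolding conv
      by (simp add: fold_ennreal ennreal_leI del: ennreal_plus ennreal_numeral)
  next
    case True
    show ?thesis unfolding True by (simp add: ennreal_mult_top)
  qed
qed

section \<open>Spectral gap and Green function of the step law\<close>

locale braid_walk =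
  fixes \<nu> :: "braid3 pmf"
  assumes supp: "set_pmf \<nu> \<subseteq> U_set"
    and generates: "(\<Union>n. set_pmf (conv_power \<nu> n)) = UNIV"
begin

lemma T_length_conv_power_le: "g \<in> set_pmf (conv_power \<nu> n) \<Longrightarrow> T_length g \<le> n"
proof (induction n arbitrary: g)
  case (Suc n)
  then obtain h x where "g = h * x" "h \<in> set_pmf (conv_power \<nu> n)" "x \<in> set_pmf \<nu>"
    by (auto simp: set_conv_pmf)
  with Suc.IH[of h] T_length_mult_U_right(1)[of x h] supp show ?case by auto
qed (simp add: T_length_code code_1)

text \<open>The Dirichlet form of the step law: for finite mass, twice the mass minus twice the
  inner product of \<open>f\<close> with the average of its translates.\<close>

definition avg_energy :: "((gen \<times> gen) list \<Rightarrow> real) \<Rightarrow> ennreal" where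
  "avg_energy f = (\<integral>\<^sup>+ h. energy f h \<partial>\<nu>)"

text \<open>A reachable \<open>g\<close> is a product of steps of positive probability. One such
  step \<open>x\<close> has energy at most \<open>avg_energy f / pmf \<nu> x\<close>, and each
  further factor doubles the constants; \<open>K\<close> depends on \<open>g\<close> but not on
  \<open>f\<close>.\<close>

lemma energy_le_avg:
  assumes "g \<in> set_pmf (conv_power \<nu> n)"
  shows "\<exists>K\<ge>0::real. \<forall>f. energy f g \<le> ennreal K * avg_energy f"
  using assms
proof (induction n arbitrary: g)
  case 0
  then show ?case by (auto simp: energy_1)
next
  case (Suc n)
  then obtain h x where g: "g = h * x" "h \<in> set_pmf (conv_power \<nu> n)" "x \<in> set_pmf \<nu>"
    by (auto simp: set_conv_pmf)
  obtain K where K: "K \<ge> 0" "\<And>f. energy f h \<le> ennreal K * avg_energy f"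
    using Suc.IH[OF g(2)] by blast
  have p: "pmf \<nu> x > 0" using g(3) by (simp add: pmf_positive)
  have x: "energy f x \<le> ennreal (1 / pmf \<nu> x) * avg_energy f" for f
  proof -
    have "ennreal (pmf \<nu> x) * energy f x \<le> (\<integral>\<^sup>+ h. ennreal (pmf \<nu> h) * energy f h \<partial>count_space UNIV)"
      by (rule nn_integral_ge_point) simp
    also have "\<dots> = avg_energy f" by (simp add: avg_energy_def nn_integral_measure_pmf)
    finally have "ennreal (1 / pmf \<nu> x) * (ennreal (pmf \<nu> x) * energy f x)
      \<le> ennreal (1 / pmf \<nu> x) * avg_energy f" by (rule mult_left_mono) simp
    moreover have "ennreal (1 / pmf \<nu> x) * ennreal (pmf \<nu> x) = 1"
      using p by (simp add: ennreal_mult[symmetric])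
    ultimately show ?thesis by (simp add: mult.assoc[symmetric])
  qed
  define y where "y = 1 / pmf \<nu> x"
  have y: "y \<ge> 0" by (simp add: y_def)
  have "energy f g \<le> ennreal (2 * K + 2 * y) * avg_energy f" for f
  proof -
    have "energy f g \<le> 2 * energy f h + 2 * energy f x"
      unfolding g(1) by (rule energy_mult)
    also have "\<dots> \<le> 2 * (ennreal K * avg_energy f) + 2 * (ennreal y * avg_energy f)"
      unfolding y_def by (intro add_mono mult_left_mono K x) auto
    also have "\<dots> = ennreal (2 * K + 2 * y) * avg_energy f"
      using K(1) y by (simp add: ennreal_mult distrib_right mult.assoc)
    finally show ?thesis .
  qed
  moreover have "2 * K + 2 * y \<ge> 0" using K(1) y by simp
  ultimately show ?case by blast
qed

text \<open>A Poincare inequality: a, ab and \<Delta> are reachable, so their energies are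
  controlled. The \<open>+ 1\<close> in the constant gives \<open>K \<ge> 1\<close>, which later
  places \<theta> = 1 - 1/(4K) inside (0, 1).\<close>

lemma mass_le_avg_energy:
  "\<exists>K\<ge>1::real. \<forall>f. mass f UNIV < \<infinity> \<longrightarrow> mass f UNIV \<le> ennreal K * avg_energy f"
proof -
  have "\<exists>K\<ge>0::real. \<forall>f. energy f g \<le> ennreal K * avg_energy f" for g
    using generates energy_le_avg by blast
  then obtain K where K: "K g \<ge> 0" "energy f g \<le> ennreal (K g) * avg_energy f" for g f
    by metis
  define C where "C = 30 * (K br_a + K (br_a * br_b) + K Delta) + 1"
  have "mass f UNIV \<le> ennreal C * avg_energy f" if "mass f UNIV < \<infinity>" for f
  proof -
    have "mass f UNIV \<le> 30 * (energy f br_a + energy f (br_a * br_b) + energy f Delta)"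
      by (rule mass_le_energy[OF that])
    also have "\<dots> \<le> 30 * (ennreal (K br_a) * avg_energy f + ennreal (K (br_a * br_b)) * avg_energy f
        + ennreal (K Delta) * avg_energy f)"
      by (intro add_mono mult_left_mono K) auto
    also have "\<dots> = ennreal (30 * (K br_a + K (br_a * br_b) + K Delta)) * avg_energy f"
      using K(1) by (simp add: ennreal_plus ennreal_mult distrib_right mult.assoc)
    also have "\<dots> \<le> ennreal C * avg_energy f"
      unfolding C_def by (intro mult_right_mono ennreal_leI) auto
    finally show ?thesis .
  qed
  moreover have "C \<ge> 1" using K(1) by (simp add: C_def)
  ultimately show ?thesis by blast
qed

definition hit :: "nat \<Rightarrow> (gen \<times> gen) list \<Rightarrow> real" where
  "hit n w = measure (conv_power \<nu> n) {g. stk g = w}"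

lemma hit_nonneg [simp]: "hit n w \<ge> 0"
  by (simp add: hit_def)

lemma hit_0: "hit 0 w = (if w = [] then 1 else 0)"
  by (auto simp: hit_def stk_def code_1 indicator_def)

lemma hit_eq_0: "n < length w \<Longrightarrow> hit n w = 0"
  unfolding hit_def measure_pmf_zero_iff using T_length_conv_power_le by (fastforce simp: T_length_stk)

text \<open>The factors are independent with the same law, so the additional one may be put on the
  left, where it acts on cosets.\<close>

lemma hit_Suc: "w \<in> stacks \<Longrightarrow> ennreal (hit (Suc n) w) = (\<integral>\<^sup>+ h. ennreal (hit n (sact (inverse h) w)) \<partial>\<nu>)"
proof -
  assume w: "w \<in> stacks"
  have eq: "stk (h * g) = w \<longleftrightarrow> stk g = sact (inverse h) w" for h g
  proof
    assume "stk (h * g) = w"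
    then show "stk g = sact (inverse h) w"
      by (auto simp: sact_stk mult.assoc[symmetric])
  next
    assume g: "stk g = sact (inverse h) w"
    have "stk (h * g) = sact h (sact (inverse h) w)" by (simp add: g[symmetric] sact_stk)
    then show "stk (h * g) = w" using w by simp
  qed
  have "ennreal (hit (Suc n) w) = (\<integral>\<^sup>+ g. indicator {g. stk g = w} g \<partial>conv_power \<nu> (Suc n))"
    unfolding hit_def by (simp add: measure_pmf.emeasure_eq_measure)
  also have "\<dots> = (\<integral>\<^sup>+ h. \<integral>\<^sup>+ g. indicator {g. stk g = sact (inverse h) w} g \<partial>conv_power \<nu> n \<partial>\<nu>)"
    unfolding conv_power_Suc_left nn_integral_conv_pmf
    by (intro nn_integral_cong) (simp add: indicator_def eq)
  also have "\<dots> = (\<integral>\<^sup>+ h. ennreal (hit n (sact (inverse h) w)) \<partial>\<nu>)"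
    unfolding hit_def by (simp add: measure_pmf.emeasure_eq_measure)
  finally show ?thesis .
qed

lemma sum_hit_le:
  "\<exists>C>0. \<exists>\<theta>>0. \<theta> < 1 \<and> (\<forall>N. \<forall>w\<in>stacks. (\<Sum>n<N. hit n w) \<le> C * \<theta> ^ length w)"
proof -
  obtain K :: real where K: "K \<ge> 1" "\<And>f. mass f UNIV < \<infinity> \<Longrightarrow> mass f UNIV \<le> ennreal K * avg_energy f"
    using mass_le_avg_energy by blast
  \<comment> \<open>With \<open>m\<close> the mass of the weighted Green function, the weight costs
    \<open>2 (1 - \<theta>) m = m / (2 K)\<close>, half of the gap \<open>m / K\<close>.\<close>
  define \<theta> where "\<theta> = 1 - 1 / (4 * K)"
  have \<theta>: "0 < \<theta>" "\<theta> < 1" using K(1) by (auto simp: \<theta>_def field_simps)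
  have "(\<Sum>n<N. hit n w0) \<le> 4 * K * \<theta> ^ length w0" if w0: "w0 \<in> stacks" and N: "N \<ge> 1" for N w0
  proof -
    \<comment> \<open>The Green function \<open>G\<close> truncated at time \<open>N\<close> satisfies \<open>A G \<ge> G - 1\<^bsub>[]\<^esub>\<close> for the averaging
      operator \<open>A\<close>. A step changes the length by at most one, so the weight costs a factor \<open>\<theta>\<close> only,
      and the spectral gap bounds the norm of \<open>f\<close> uniformly in \<open>N\<close>.\<close>
    define G where "G w = (\<Sum>n<N. hit n w)" for w
    define f where "f w = G w / \<theta> ^ length w" for w
    have G0: "G w \<ge> 0" for w by (simp add: G_def sum_nonneg)
    then have f0: "f w \<ge> 0" for w using \<theta> by (simp add: f_def)
    let ?d = "\<lambda>w. f w - (if w = [] then 1 else 0)"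
    define F where "F = {w \<in> stacks. length w \<le> N}"
    have "finite {w :: (gen \<times> gen) list. set w \<subseteq> UNIV \<and> length w \<le> N}"
    proof (rule finite_lists_length_le)
      have "(UNIV :: gen set) = {GA, GB}" using gen.exhaust by auto
      then have "finite (UNIV :: gen set)" by (metis finite.emptyI finite_insert)
      then show "finite (UNIV :: (gen \<times> gen) set)" by (simp add: finite_prod)
    qed
    then have F: "finite F" unfolding F_def by (rule rev_finite_subset) auto
    have fF: "f w = 0" if "w \<in> stacks" "w \<notin> F" for w
      using that by (auto simp: f_def G_def F_def hit_eq_0)
    define m where "m = (\<Sum>w\<in>F. (f w)\<^sup>2)"
    have mass: "mass f UNIV = ennreal m"
      unfolding mass_def m_def using F fF
      by (subst nn_integral_count_space'[where A = F]) (auto simp: F_def sum_ennreal)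
    define ip where "ip h = (\<Sum>w\<in>F. ennreal (f w * f (sact (inverse h) w)))" for h
    \<comment> \<open>Polarization, written without subtraction because energies live in
      \<open>ennreal\<close>. It uses that \<open>f\<close> is nonnegative and that translation is a
      bijection of the stacks.\<close>
    have ip: "energy f h + 2 * ip h = ennreal (2 * m)" for h
    proof -
      have "ip h = (\<integral>\<^sup>+ w. ennreal (f w * f (sact (inverse h) w)) \<partial>count_space stacks)"
        unfolding ip_def using F fF
        by (subst nn_integral_count_space'[where A = F]) (auto simp: F_def)
      also have "\<dots> = (\<integral>\<^sup>+ w. ennreal (f (sact h w) * f (sact (inverse h) (sact h w))) \<partial>count_space stacks)"
        by (rule nn_integral_sact[symmetric, of _ h])
      also have "\<dots> = (\<integral>\<^sup>+ w. ennreal (f (sact h w) * f w) \<partial>count_space stacks)"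
        by (intro nn_integral_cong) simp
      finally have ip': "ip h = (\<integral>\<^sup>+ w. ennreal (f (sact h w) * f w) \<partial>count_space stacks)" .
      have "energy f h + 2 * ip h = (\<integral>\<^sup>+ w. ennreal ((f w - f (sact h w))\<^sup>2)
          + 2 * ennreal (f (sact h w) * f w) \<partial>count_space stacks)"
        unfolding ip' energy_def by (simp add: nn_integral_add nn_integral_cmult)
      also have "\<dots> = (\<integral>\<^sup>+ w. ennreal ((f w)\<^sup>2) + ennreal ((f (sact h w))\<^sup>2) \<partial>count_space stacks)"
      proof (intro nn_integral_cong)
        fix w
        have "ennreal ((f w - f (sact h w))\<^sup>2) + 2 * ennreal (f (sact h w) * f w)
          = ennreal ((f w - f (sact h w))\<^sup>2 + 2 * (f (sact h w) * f w))"
          using f0 by (simp add: ennreal_plus ennreal_mult)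
        also have "(f w - f (sact h w))\<^sup>2 + 2 * (f (sact h w) * f w) = (f w)\<^sup>2 + (f (sact h w))\<^sup>2"
          by (simp add: power2_eq_square algebra_simps)
        finally show "ennreal ((f w - f (sact h w))\<^sup>2) + 2 * ennreal (f (sact h w) * f w)
          = ennreal ((f w)\<^sup>2) + ennreal ((f (sact h w))\<^sup>2)" by (simp add: ennreal_plus)
      qed
      also have "\<dots> = mass f UNIV + (\<integral>\<^sup>+ w. ennreal ((f (sact h w))\<^sup>2) \<partial>count_space stacks)"
        by (simp add: nn_integral_add mass_def)
      also have "(\<integral>\<^sup>+ w. ennreal ((f (sact h w))\<^sup>2) \<partial>count_space stacks) = mass f UNIV"
        using nn_integral_sact[of "\<lambda>w. ennreal ((f w)\<^sup>2)"] by (simp add: mass_def)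
      finally show ?thesis unfolding mass by (simp add: m_def sum_nonneg flip: ennreal_plus)
    qed
    have m0: "m \<ge> 0" by (simp add: m_def sum_nonneg)
    have "avg_energy f + 2 * (\<integral>\<^sup>+ h. ip h \<partial>\<nu>) = (\<integral>\<^sup>+ h. energy f h + 2 * ip h \<partial>\<nu>)"
      unfolding avg_energy_def by (simp add: nn_integral_add nn_integral_cmult)
    also have "\<dots> = ennreal (2 * m)" by (simp add: ip)
    finally have av: "avg_energy f + 2 * (\<integral>\<^sup>+ h. ip h \<partial>\<nu>) = ennreal (2 * m)" .
    let ?A = "\<lambda>w. \<integral>\<^sup>+ h. ennreal (f (sact (inverse h) w)) \<partial>\<nu>"
    have ipint: "ennreal (\<Sum>w\<in>F. f w * (\<theta> * ?d w)) \<le> (\<integral>\<^sup>+ h. ip h \<partial>\<nu>)"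
    proof -
      \<comment> \<open>Time 0 contributes 1 at the empty stack, so \<open>?d\<close> is nonnegative
        and survives the passage to \<open>ennreal\<close>. This uses \<open>N \<ge> 1\<close>; the
        case \<open>N = 0\<close> is settled at the end.\<close>
      have G1: "G [] \<ge> 1"
        using N member_le_sum[of 0 "{..<N}" "\<lambda>n. hit n []"] by (simp add: G_def hit_0)
      have "ennreal (\<theta> * ?d w) \<le> ?A w"
        if w: "w \<in> F" for w
      proof -
        have ws: "w \<in> stacks" using w by (simp add: F_def)
        have "?d w \<le> (\<Sum>n<N. hit (Suc n) w) / \<theta> ^ length w"
        proof -
          \<comment> \<open>Adding time \<open>N\<close> and splitting off time 0 leaves the sum
            shifted by one step, to which \<open>hit_Suc\<close> applies.\<close>
          have "G w \<le> (\<Sum>n<Suc N. hit n w)" by (simp add: G_def)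
          also have "\<dots> = hit 0 w + (\<Sum>n<N. hit (Suc n) w)" by (rule sum.lessThan_Suc_shift)
          finally show ?thesis using \<theta> unfolding f_def
            by (auto simp: hit_0 field_simps)
        qed
        then have "\<theta> * ?d w \<le> \<theta> / \<theta> ^ length w * (\<Sum>n<N. hit (Suc n) w)"
          using \<theta> mult_left_mono[of _ _ \<theta>] by (simp add: divide_inverse mult.commute mult.left_commute)
        then have "ennreal (\<theta> * ?d w)
          \<le> ennreal (\<theta> / \<theta> ^ length w) * (\<Sum>n<N. ennreal (hit (Suc n) w))"
          using \<theta> by (simp add: ennreal_leI sum_nonneg flip: ennreal_mult)
        also have "\<dots> = ennreal (\<theta> / \<theta> ^ length w) * (\<integral>\<^sup>+ h. ennreal (G (sact (inverse h) w)) \<partial>\<nu>)"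
          unfolding hit_Suc[OF ws] G_def by (simp add: nn_integral_sum flip: sum_ennreal)
        also have "\<dots> = (\<integral>\<^sup>+ h. ennreal (\<theta> / \<theta> ^ length w * G (sact (inverse h) w)) \<partial>\<nu>)"
          by (subst nn_integral_cmult[symmetric], simp, rule nn_integral_cong, rule ennreal_mult[symmetric])
            (use \<theta> G0 in auto)
        also have "\<dots> \<le> ?A w"
        proof (intro nn_integral_mono_AE AE_pmfI ennreal_leI)
          fix h assume "h \<in> set_pmf \<nu>"
          then have "inverse h \<in> U_set" using supp inverse_U_set by blast
          then have "length w \<le> Suc (length (sact (inverse h) w))" using length_sact ws by blast
          then have "\<theta> ^ Suc (length (sact (inverse h) w)) \<le> \<theta> ^ length w"
            using \<theta> by (intro power_decreasing) auto
          then have "\<theta> / \<theta> ^ length w \<le> 1 / \<theta> ^ length (sact (inverse h) w)"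
            using \<theta> by (simp add: field_simps)
          from mult_right_mono[OF this G0]
          show "\<theta> / \<theta> ^ length w * G (sact (inverse h) w) \<le> f (sact (inverse h) w)"
            by (simp add: f_def)
        qed
        finally show ?thesis .
      qed note A = this
      have nn: "\<theta> * ?d w \<ge> 0" for w
        using \<theta> f0[of w] G1 by (auto simp: f_def)
      have "ennreal (\<Sum>w\<in>F. f w * (\<theta> * ?d w))
        = (\<Sum>w\<in>F. ennreal (f w) * ennreal (\<theta> * ?d w))"
        using f0 nn by (subst sum_ennreal[symmetric]) (auto simp: ennreal_mult intro: mult_nonneg_nonneg)
      also have "\<dots> \<le> (\<Sum>w\<in>F. ennreal (f w) * ?A w)"
        by (intro sum_mono mult_left_mono A) auto
      also have "\<dots> = (\<integral>\<^sup>+ h. ip h \<partial>\<nu>)"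
        unfolding ip_def using f0 by (simp add: nn_integral_sum nn_integral_cmult ennreal_mult)
      finally show ?thesis .
    qed
    have "avg_energy f \<le> ennreal (2 * m)" unfolding av[symmetric] by simp
    then obtain e where e: "avg_energy f = ennreal e" "e \<ge> 0"
      by (cases "avg_energy f") (auto simp: top_unique)
    have "(\<integral>\<^sup>+ h. ip h \<partial>\<nu>) \<noteq> top" using av by (auto simp: ennreal_mult_top)
    then obtain i where i: "(\<integral>\<^sup>+ h. ip h \<partial>\<nu>) = ennreal i" "i \<ge> 0"
      by (cases "\<integral>\<^sup>+ h. ip h \<partial>\<nu>") auto
    have ei: "e + 2 * i = 2 * m"
    proof -
      have "ennreal (e + 2 * i) = ennreal (2 * m)"
        using av e i by (simp add: ennreal_plus ennreal_mult)
      then show ?thesis using e i m0 by (subst (asm) ennreal_inj) auto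
    qed
    have "m \<le> K * e"
      using K(2)[of f] K(1) m0 e unfolding mass by (simp add: ennreal_mult[symmetric])
    then have "m / K \<le> e" using K(1) by (simp add: field_simps)
    have "(\<Sum>w\<in>F. f w * (\<theta> * ?d w)) \<le> i"
      using ipint i by simp
    also have "(\<Sum>w\<in>F. f w * (\<theta> * ?d w)) = \<theta> * m - \<theta> * f []"
    proof -
      have "[] \<in> F" by (simp add: F_def stacks_def valid_def)
      have "(\<Sum>w\<in>F. f w * (\<theta> * ?d w))
        = (\<Sum>w\<in>F. \<theta> * (f w)\<^sup>2 - (if w = [] then \<theta> * f w else 0))"
        by (intro sum.cong) (auto simp: power2_eq_square algebra_simps)
      also have "\<dots> = \<theta> * m - \<theta> * f []"
        using F \<open>[] \<in> F\<close> by (simp add: sum_subtractf m_def sum_distrib_left)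
      finally show ?thesis .
    qed
    finally have 1: "\<theta> * m - \<theta> * f [] \<le> i" .
    have "\<theta> * f [] \<le> f []" using \<theta> f0[of "[]"] by (simp add: mult_left_le_one_le)
    moreover have "\<theta> * m = m - m / (4 * K)" by (simp add: \<theta>_def algebra_simps)
    \<comment> \<open>From \<open>m / K \<le> e = 2 m - 2 i\<close> and
      \<open>i \<ge> \<theta> m - f []\<close> one gets
      \<open>m / K \<le> m / (2 K) + 2 f []\<close>. As \<open>f []\<close> is at most the square
      root of \<open>m\<close>, this bounds \<open>m\<close> independently of
      \<open>N\<close>.\<close>
    ultimately have 2: "m / (4 * K) \<le> f []"
      using 1 ei \<open>m / K \<le> e\<close> by (simp add: field_simps)
    have le: "(f w)\<^sup>2 \<le> m" if "w \<in> stacks" for w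
    proof (cases "w \<in> F")
      case True
      then show ?thesis unfolding m_def using F by (intro member_le_sum) auto
    next
      case False
      then show ?thesis using that fF m0 by simp
    qed
    have "[] \<in> stacks" by (simp add: stacks_def valid_def)
    then have "f [] \<le> sqrt m" using le real_le_rsqrt by blast
    then have "4 * K * f [] \<le> 4 * K * sqrt m" using K(1) by simp
    moreover have "m \<le> 4 * K * f []" using 2 K(1) by (simp add: field_simps)
    ultimately have "sqrt m * sqrt m \<le> 4 * K * sqrt m" using m0 by simp
    then have "sqrt m \<le> 4 * K"
      using m0 K(1) mult_right_le_imp_le[of "sqrt m" "sqrt m" "4 * K"] by (cases "m = 0") (auto simp del: real_sqrt_mult_self)
    then have "f w0 \<le> 4 * K" using le[OF w0] real_le_rsqrt by fastforce
    then show ?thesis using \<theta> by (simp add: f_def G_def field_simps)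
  qed
  moreover have "(\<Sum>n<0. hit n w0) \<le> 4 * K * \<theta> ^ length w0" for w0
    using K(1) \<theta> by simp
  ultimately have "\<forall>N. \<forall>w\<in>stacks. (\<Sum>n<N. hit n w) \<le> (4 * K) * \<theta> ^ length w"
    by (metis less_one not_less)
  then show ?thesis using \<theta> K(1) by (intro exI[of _ "4 * K"] conjI exI[of _ \<theta>]) auto
qed

end

section \<open>Moments of the cancellation\<close>

lemma measure_conv_pmf: "measure (conv_pmf \<mu> \<nu>) S = measure (pair_pmf \<mu> \<nu>) {(x, y). x * y \<in> S}"
  by (simp add: conv_pmf_def vimage_def split_def)

text \<open>Inversion reverses the order of the factors; exchanging independent factors restores
  it.\<close>

lemma map_pmf_inverse_conv_power:
  "conv_power (map_pmf inverse \<nu>) n = map_pmf inverse (conv_power (\<nu> :: braid3 pmf) n)"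
proof (induction n)
  case 0
  have "inverse (1 :: braid3) = 1" by (rule braid3_inverse_unique[symmetric]) simp
  then show ?case by simp
next
  case (Suc n)
  have "conv_power (map_pmf inverse \<nu>) (Suc n)
    = conv_pmf (map_pmf inverse \<nu>) (map_pmf inverse (conv_power \<nu> n))"
    unfolding conv_power_Suc_left Suc.IH ..
  also have "\<dots> = map_pmf (\<lambda>(x, y). inverse x * inverse y) (pair_pmf \<nu> (conv_power \<nu> n))"
    by (simp add: conv_pmf_def map_pair[symmetric] map_pmf_comp split_def)
  also have "\<dots> = map_pmf inverse (conv_power \<nu> (Suc n))"
    by (subst pair_commute_pmf) (simp add: conv_pmf_def map_pmf_comp split_def braid3_inverse_mult)
  finally show ?case .
qed

text \<open>The constant is the sum of \<open>(2 r + 1)\<^sup>2 C \<theta>^r\<close> over all r. It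
  depends on the tail bound alone, which makes the moment bounds uniform. A defect with
  \<open>f x\<close> cancelled letters is at most \<open>2 f x + 1\<close>.\<close>

lemma nn_integral_square_geometric_tail:
  fixes C \<theta> :: real
  assumes "C \<ge> 0" "0 < \<theta>" "\<theta> < 1"
  shows "\<exists>B\<ge>0. \<forall>(\<mu> :: 'a pmf) f. (\<forall>r. measure \<mu> {x. r \<le> f x} \<le> C * \<theta> ^ r) \<longrightarrow>
    (\<integral>\<^sup>+ x. ennreal ((2 * real (f x) + 1)\<^sup>2) \<partial>\<mu>) \<le> ennreal B"
proof -
  let ?a = "\<lambda>r. (2 * real r + 1)\<^sup>2 * (C * \<theta> ^ r)"
  have lim: "(\<lambda>r. ((2 * real r + 3) / (2 * real r + 1))\<^sup>2 * \<theta>) \<longlonglongrightarrow> 1\<^sup>2 * \<theta>"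
  proof (intro tendsto_mult tendsto_power tendsto_const)
    have "(\<lambda>r. 1 + 1 / (real r + 1/2)) \<longlonglongrightarrow> 1 + 0"
      by (intro tendsto_add tendsto_const tendsto_divide_0[OF tendsto_const]
          filterlim_at_top_imp_at_infinity filterlim_tendsto_add_at_top[OF tendsto_const, where c = "1/2", simplified add.commute]
          filterlim_real_sequentially)
    moreover have "1 + 1 / (real r + 1/2) = (2 * real r + 3) / (2 * real r + 1)" for r
      by (simp add: field_simps)
    ultimately show "(\<lambda>r. (2 * real r + 3) / (2 * real r + 1)) \<longlonglongrightarrow> 1" by simp
  qed
  have "eventually (\<lambda>r. ((2 * real r + 3) / (2 * real r + 1))\<^sup>2 * \<theta> < (1 + \<theta>) / 2) sequentially"
    using assms by (intro order_tendstoD(2)[OF lim]) simp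
  then obtain N where N: "\<And>r. r \<ge> N \<Longrightarrow> ((2 * real r + 3) / (2 * real r + 1))\<^sup>2 * \<theta> < (1 + \<theta>) / 2"
    unfolding eventually_sequentially by blast
  have "summable ?a"
  proof (rule summable_ratio_test)
    show "(1 + \<theta>) / 2 < 1" using assms by simp
    fix r assume r: "r \<ge> N"
    have p: "2 * real r + 1 > 0" by simp
    have "?a (Suc r) = ((2 * real r + 3) / (2 * real r + 1))\<^sup>2 * \<theta> * ?a r"
      using p by (simp add: power_divide add.commute algebra_simps)
    also have "\<dots> \<le> (1 + \<theta>) / 2 * ?a r"
      using N[OF r] assms by (intro mult_right_mono) auto
    finally show "norm (?a (Suc r)) \<le> (1 + \<theta>) / 2 * norm (?a r)" using assms by simp
  qed
  have "(\<integral>\<^sup>+ x. ennreal ((2 * real (f x) + 1)\<^sup>2) \<partial>\<mu>) \<le> ennreal (suminf ?a)"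
    if tail: "\<forall>r. measure \<mu> {x. r \<le> f x} \<le> C * \<theta> ^ r" for \<mu> :: "'a pmf" and f
  proof -
    have "(\<integral>\<^sup>+ x. ennreal ((2 * real (f x) + 1)\<^sup>2) \<partial>\<mu>)
      = (\<integral>\<^sup>+ n. ennreal ((2 * real n + 1)\<^sup>2) \<partial>map_pmf f \<mu>)" by simp
    also have "\<dots> = (\<Sum>n. ennreal (pmf (map_pmf f \<mu>) n) * ennreal ((2 * real n + 1)\<^sup>2))"
      by (simp only: nn_integral_measure_pmf nn_integral_count_space_nat)
    also have "\<dots> \<le> (\<Sum>n. ennreal (?a n))"
    proof (intro suminf_le)
      fix n
      have "pmf (map_pmf f \<mu>) n \<le> measure \<mu> {x. n \<le> f x}"
        unfolding pmf_map by (intro measure_pmf.finite_measure_mono) auto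
      then have "pmf (map_pmf f \<mu>) n \<le> C * \<theta> ^ n" using tail by (meson order_trans)
      then have "ennreal (pmf (map_pmf f \<mu>) n * (2 * real n + 1)\<^sup>2) \<le> ennreal (?a n)"
        by (intro ennreal_leI) (metis mult.commute mult_left_mono zero_le_power2)
      then show "ennreal (pmf (map_pmf f \<mu>) n) * ennreal ((2 * real n + 1)\<^sup>2) \<le> ennreal (?a n)"
        by (simp add: ennreal_mult)
    qed auto
    also have "\<dots> = ennreal (suminf ?a)"
      using assms \<open>summable ?a\<close> by (intro suminf_ennreal2) auto
    finally show ?thesis .
  qed
  moreover have "suminf ?a \<ge> 0" using assms \<open>summable ?a\<close> by (intro suminf_nonneg) auto
  ultimately show ?thesis by blast
qed

abbreviation T_defect :: "braid3 \<Rightarrow> braid3 \<Rightarrow> real" where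
  "T_defect g h \<equiv> real (T_length (g * h)) - real (T_length g) - real (T_length h)"

abbreviation Delta_defect :: "braid3 \<Rightarrow> braid3 \<Rightarrow> real" where
  "Delta_defect g h \<equiv> real_of_int (Delta_exp (g * h)) - Delta_exp g - Delta_exp h"

context braid_walk begin

text \<open>If \<open>w\<close> lies at the bottom of the stack after a step but not before it, the
  stack has just become exactly \<open>w\<close>, since a step disturbs only the top. So the event
  is covered by the visits to \<open>w\<close> up to time \<open>m\<close>.\<close>

lemma measure_suffix_le:
  "measure (conv_power \<nu> m) {g. \<exists>u. stk g = u @ w} \<le> (\<Sum>n<Suc m. hit n w)"
proof (induction m)
  case 0
  then show ?case by (auto simp: hit_0 stk_def code_1 indicator_def)
next
  case (Suc m)
  let ?P = "pair_pmf (conv_power \<nu> m) \<nu>"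
  have "measure (conv_power \<nu> (Suc m)) {g. \<exists>u. stk g = u @ w}
    = measure ?P {(g, x). \<exists>u. stk (g * x) = u @ w}"
    by (simp add: measure_conv_pmf)
  also have "\<dots> \<le> measure ?P ({(g, x). stk (g * x) = w} \<union> {(g, x). \<exists>u. stk g = u @ w})"
  proof (rule measure_pmf.finite_measure_mono_AE, rule AE_pmfI, clarify)
    fix g x u assume gx: "(g, x) \<in> set_pmf ?P"
      and u: "stk (g * x) = u @ w" and n: "\<not> (\<exists>u. stk g = u @ w)"
    have "inverse x \<in> U_set" using gx supp inverse_U_set by auto
    from stack_mult_U_set[OF this, of "g * x"]
    obtain ts where "stk g = ts @ tl (stk (g * x))" by (auto simp: stk_def mult.assoc)
    then show "stk (g * x) = w" using u n by (cases u) auto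
  qed simp
  also have "\<dots> \<le> measure ?P {(g, x). stk (g * x) = w} + measure ?P {(g, x). \<exists>u. stk g = u @ w}"
    by (rule measure_Un_le) auto
  also have "measure ?P {(g, x). stk (g * x) = w} = hit (Suc m) w"
    by (simp add: hit_def measure_conv_pmf)
  also have "measure ?P {(g, x). \<exists>u. stk g = u @ w}
    = measure (map_pmf fst ?P) {g. \<exists>u. stk g = u @ w}"
    by (simp add: vimage_def split_def)
  also have "\<dots> = measure (conv_power \<nu> m) {g. \<exists>u. stk g = u @ w}"
    by (simp only: map_fst_pair_pmf)
  also note Suc.IH
  finally show ?case by (simp add: add.commute)
qed

text \<open>Cancelling at least \<open>r\<close> letters of \<open>h\<close> forces its normal form
  to start with \<open>r\<close> letters determined by \<open>g\<close>. This puts a fixed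
  \<open>w\<close> of length \<open>r\<close> at the bottom of the stack of \<open>h\<close>, an
  event whose probability is at most the Green function at \<open>w\<close>.\<close>

lemma defect_left:
  "\<exists>B\<ge>0. \<forall>g m.
    (\<integral>\<^sup>+ h. ennreal ((T_defect g h)\<^sup>2) \<partial>conv_power \<nu> m) \<le> ennreal B \<and>
    (\<integral>\<^sup>+ h. ennreal ((Delta_defect g h)\<^sup>2) \<partial>conv_power \<nu> m) \<le> ennreal B"
proof -
  obtain C \<theta> where C: "C > 0" "0 < \<theta>" "\<theta> < 1"
    and sum: "\<And>N w. w \<in> stacks \<Longrightarrow> (\<Sum>n<N. hit n w) \<le> C * \<theta> ^ length w"
    using sum_hit_le by blast
  obtain B where B: "B \<ge> 0" "\<And>(\<mu> :: braid3 pmf) f. (\<And>r. measure \<mu> {x. r \<le> f x} \<le> C * \<theta> ^ r) \<Longrightarrow>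
    (\<integral>\<^sup>+ x. ennreal ((2 * real (f x) + 1)\<^sup>2) \<partial>\<mu>) \<le> ennreal B"
    using nn_integral_square_geometric_tail[of C \<theta>] C by (metis less_imp_le)
  have "\<exists>f. \<forall>g h. f g h \<le> length (stk h) \<and>
     take (f g h) (rev (stk h)) = take (f g h) (kills (snd (code g)) (stk g)) \<and>
     T_length (g * h) + 2 * f g h \<le> T_length g + T_length h \<and>
     T_length g + T_length h \<le> T_length (g * h) + 2 * f g h + 1 \<and>
     Delta_exp g + Delta_exp h + int (f g h) \<le> Delta_exp (g * h) \<and>
     Delta_exp (g * h) \<le> Delta_exp g + Delta_exp h + int (f g h) + 1"
    using cancellation unfolding stk_def by (intro choice allI) blast
  then obtain c where c: "\<And>g h. c g h \<le> length (stk h)"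
     "\<And>g h. take (c g h) (rev (stk h)) = take (c g h) (kills (snd (code g)) (stk g))"
     "\<And>g h. T_length (g * h) + 2 * c g h \<le> T_length g + T_length h"
     "\<And>g h. T_length g + T_length h \<le> T_length (g * h) + 2 * c g h + 1"
     "\<And>g h. Delta_exp g + Delta_exp h + int (c g h) \<le> Delta_exp (g * h)"
     "\<And>g h. Delta_exp (g * h) \<le> Delta_exp g + Delta_exp h + int (c g h) + 1"
    by blast
  have tail: "measure (conv_power \<nu> m) {h. r \<le> c g h} \<le> C * \<theta> ^ r" for g m r
  proof -
    define w where "w = rev (take r (kills (snd (code g)) (stk g)))"
    have suf: "(\<exists>u. stk h = u @ w) \<and> length w = r" if "r \<le> c g h" for h
    proof -
      have "take r (take (c g h) (rev (stk h))) = take r (take (c g h) (kills (snd (code g)) (stk g)))"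
        by (simp only: c(2))
      then have "take r (rev (stk h)) = rev w" using that by (simp add: w_def min_absorb1)
      then have r: "rev (take r (rev (stk h))) = w" by simp
      have "stk h = rev (drop r (rev (stk h))) @ rev (take r (rev (stk h)))"
        by (metis append_take_drop_id rev_append rev_rev_ident)
      moreover have "length (rev (take r (rev (stk h)))) = r" using that c(1)[of g h] by simp
      ultimately show ?thesis unfolding r by blast
    qed
    have "measure (conv_power \<nu> m) {h. r \<le> c g h} \<le> measure (conv_power \<nu> m) {h. \<exists>u. stk h = u @ w}"
      using suf by (intro measure_pmf.finite_measure_mono) auto
    also have "\<dots> \<le> (\<Sum>n<Suc m. hit n w)" by (rule measure_suffix_le)
    finally have le: "measure (conv_power \<nu> m) {h. r \<le> c g h} \<le> (\<Sum>n<Suc m. hit n w)" .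
    \<comment> \<open>The decay at \<open>w\<close> needs a stack of length exactly
      \<open>r\<close>. If no \<open>h\<close> cancels \<open>r\<close> letters the event is empty,
      and a \<open>w\<close> outside \<open>stacks\<close> is never visited.\<close>
    show ?thesis
    proof (cases "w \<in> stacks \<and> (\<exists>h. r \<le> c g h)")
      case True
      then have "length w = r" using suf by blast
      then show ?thesis using le sum[of w "Suc m"] True by auto
    next
      case False
      then consider "w \<notin> stacks" | "{h. r \<le> c g h} = {}" by blast
      then show ?thesis
      proof cases
        case 1
        then have "hit n w = 0" for n unfolding hit_def by (auto simp: measure_pmf_zero_iff)
        then show ?thesis using le C by (simp add: less_imp_le order_trans)
      qed (use C in simp)
    qed
  qed
  have "(\<integral>\<^sup>+ h. ennreal ((d h)\<^sup>2) \<partial>conv_power \<nu> m) \<le> ennreal B"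
    if "\<And>h. \<bar>d h\<bar> \<le> 2 * real (c g h) + 1" for d g m
  proof -
    have "(\<integral>\<^sup>+ h. ennreal ((d h)\<^sup>2) \<partial>conv_power \<nu> m)
      \<le> (\<integral>\<^sup>+ h. ennreal ((2 * real (c g h) + 1)\<^sup>2) \<partial>conv_power \<nu> m)"
      using that by (intro nn_integral_mono ennreal_leI) (simp add: abs_le_square_iff[symmetric])
    also have "\<dots> \<le> ennreal B" by (rule B(2)) (rule tail)
    finally show ?thesis .
  qed note * = this
  show ?thesis
  proof (intro exI[of _ B] conjI allI B(1) *)
    fix g h
    show "\<bar>T_defect g h\<bar> \<le> 2 * real (c g h) + 1"
      using c(3,4)[of g h] by linarith
    show "\<bar>Delta_defect g h\<bar> \<le> 2 * real (c g h) + 1"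
      using c(5,6)[of g h] by linarith
  qed
qed

lemma inverse_walk: "braid_walk (map_pmf inverse \<nu>)"
proof
  show "set_pmf (map_pmf inverse \<nu>) \<subseteq> U_set" using supp inverse_U_set by auto
  have "(\<Union>n. set_pmf (conv_power (map_pmf inverse \<nu>) n)) = inverse ` (\<Union>n. set_pmf (conv_power \<nu> n))"
    by (auto simp: map_pmf_inverse_conv_power)
  also have "\<dots> = UNIV" unfolding generates by (rule surjI[of _ inverse]) simp
  finally show "(\<Union>n. set_pmf (conv_power (map_pmf inverse \<nu>) n)) = UNIV" .
qed

text \<open>Inversion exchanges the factors and preserves the T-length, so that bound comes from the
  inverted walk. The exponent of \<Delta> is not simply negated by inversion; its defect is compared
  pointwise with the T-defect, as both count the same cancelled letters.\<close>

lemma defect_right: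
  "\<exists>B\<ge>0. \<forall>g m.
    (\<integral>\<^sup>+ h. ennreal ((T_defect h g)\<^sup>2) \<partial>conv_power \<nu> m) \<le> ennreal B \<and>
    (\<integral>\<^sup>+ h. ennreal ((Delta_defect h g)\<^sup>2) \<partial>conv_power \<nu> m) \<le> ennreal B"
proof -
  interpret inv: braid_walk "map_pmf inverse \<nu>" by (rule inverse_walk)
  obtain B where B: "B \<ge> 0" "\<And>g m.
    (\<integral>\<^sup>+ h. ennreal ((T_defect g h)\<^sup>2)
      \<partial>conv_power (map_pmf inverse \<nu>) m) \<le> ennreal B"
    using inv.defect_left by blast
  have T: "(\<integral>\<^sup>+ h. ennreal ((T_defect h g)\<^sup>2) \<partial>conv_power \<nu> m) \<le> ennreal B" for g m
  proof -
    have "T_defect (inverse g) (inverse h) = T_defect h g" for h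
      using T_length_inverse[of "h * g"] by (simp add: braid3_inverse_mult T_length_inverse)
    then show ?thesis using B(2)[of m "inverse g"] by (simp add: map_pmf_inverse_conv_power)
  qed
  have K: "(\<integral>\<^sup>+ h. ennreal ((Delta_defect h g)\<^sup>2) \<partial>conv_power \<nu> m)
    \<le> ennreal (2 * B + 2)" for g m
  proof -
    have "(\<integral>\<^sup>+ h. ennreal ((Delta_defect h g)\<^sup>2) \<partial>conv_power \<nu> m)
      \<le> (\<integral>\<^sup>+ h. 2 * ennreal ((T_defect h g)\<^sup>2) + 2 \<partial>conv_power \<nu> m)"
    proof (intro nn_integral_mono)
      fix h
      obtain c where c: "T_length (h * g) + 2 * c \<le> T_length h + T_length g"
        "Delta_exp h + Delta_exp g + int c \<le> Delta_exp (h * g)"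
        "Delta_exp (h * g) \<le> Delta_exp h + Delta_exp g + int c + 1"
        using cancellation[of g h] by blast
      \<comment> \<open>\<open>Delta_defect\<close> lies between \<open>c\<close> and
        \<open>c + 1\<close>, while \<open>T_defect\<close> is at most \<open>- 2 c\<close>.\<close>
      have "\<bar>Delta_defect h g\<bar> \<le> \<bar>T_defect h g\<bar> + 1"
        using c by linarith
      then have "(Delta_defect h g)\<^sup>2 \<le> (\<bar>T_defect h g\<bar> + 1)\<^sup>2"
        by (simp add: abs_le_square_iff[symmetric])
      also have "\<dots> \<le> 2 * (T_defect h g)\<^sup>2 + 2"
        using sum_squares_ge_zero[of "\<bar>T_defect h g\<bar> - 1" 0] by (simp add: power2_eq_square algebra_simps)
      finally have "ennreal ((Delta_defect h g)\<^sup>2)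
        \<le> ennreal (2 * (T_defect h g)\<^sup>2 + 2)" by (rule ennreal_leI)
      then show "ennreal ((Delta_defect h g)\<^sup>2)
        \<le> 2 * ennreal ((T_defect h g)\<^sup>2) + 2" by (simp add: ennreal_mult)
    qed
    also have "\<dots> = 2 * (\<integral>\<^sup>+ h. ennreal ((T_defect h g)\<^sup>2) \<partial>conv_power \<nu> m) + 2"
      by (simp add: nn_integral_add nn_integral_cmult)
    also have "\<dots> \<le> 2 * ennreal B + 2"
      by (intro add_mono mult_left_mono T) auto
    also have "\<dots> = ennreal (2 * B + 2)" using B(1) by (simp add: ennreal_mult)
    finally show ?thesis .
  qed
  have "ennreal B \<le> ennreal (2 * B + 2)" using B(1) by (intro ennreal_leI) simp
  then show ?thesis using T K B(1)
    by (intro exI[of _ "2 * B + 2"]) (auto intro: order_trans)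
qed

end

section \<open>Almost additive functions along a random walk\<close>

lemma sigma_sets_range_vimage: "sigma_sets UNIV (range (vimage f)) = range (vimage f)"
proof (intro equalityI subsetI)
  fix x assume "x \<in> sigma_sets UNIV (range (vimage f))"
  then show "x \<in> range (vimage f)"
  proof (induction rule: sigma_sets.induct)
    case Empty
    then show ?case by (auto intro!: image_eqI[of _ _ "{}"])
  next
    case (Compl a)
    then obtain A where "a = f -` A" by blast
    then show ?case by (auto intro!: image_eqI[of _ _ "- A"])
  next
    case (Union a)
    then have "\<forall>i. \<exists>A. a i = f -` A" by blast
    then obtain A where "\<And>i. a i = f -` A i" by metis
    then show ?case by (auto intro!: image_eqI[of _ _ "\<Union>i. A i"])
  qed auto
qed (rule sigma_sets.Basic)

text \<open>Events generated by a function of one coordinate are preimages under that projection,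
  and the product formula holds for arbitrary such preimages.\<close>

lemma indep_var_pair_pmf:
  fixes f :: "'a \<Rightarrow> 'c :: topological_space" and g :: "'b \<Rightarrow> 'c"
  shows "prob_space.indep_var (pair_pmf p q) borel (\<lambda>z. f (fst z)) borel (\<lambda>z. g (snd z))"
proof -
  let ?P = "pair_pmf p q"
  have prod: "measure ?P ((fst -` S) \<inter> (snd -` T)) = measure ?P (fst -` S) * measure ?P (snd -` T)" for S T
  proof -
    have "emeasure ?P ((fst -` S) \<inter> (snd -` T)) = (\<integral>\<^sup>+ z. indicator S (fst z) * indicator T (snd z) \<partial>?P)"
      by (subst nn_integral_indicator[symmetric]) (auto intro!: nn_integral_cong simp: indicator_def simp del: nn_integral_indicator)
    also have "\<dots> = emeasure p S * emeasure q T"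
      by (simp add: nn_integral_pair_pmf' nn_integral_cmult nn_integral_multc)
    also have "emeasure p S = emeasure ?P (fst -` S)"
      by (subst map_fst_pair_pmf[of p q, symmetric]) simp
    also have "emeasure q T = emeasure ?P (snd -` T)"
      by (subst map_snd_pair_pmf[of p q, symmetric]) simp
    finally show ?thesis
      by (simp add: measure_pmf.emeasure_eq_measure flip: ennreal_mult)
  qed
  have sub: "sigma_sets (space ?P) {(\<lambda>z. h (pr z)) -` A \<inter> space ?P |A. A \<in> sets borel} \<subseteq> range (vimage pr)"
    for h :: "'d \<Rightarrow> 'c" and pr :: "'a \<times> 'b \<Rightarrow> 'd"
  proof -
    have "{(\<lambda>z. h (pr z)) -` A \<inter> space ?P |A. A \<in> sets borel} \<subseteq> range (vimage pr)"
      by (auto intro!: image_eqI[of _ _ "h -` _"])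
    then have "sigma_sets UNIV {(\<lambda>z. h (pr z)) -` A \<inter> space ?P |A. A \<in> sets borel}
      \<subseteq> sigma_sets UNIV (range (vimage pr))" by (rule sigma_sets_subseteq)
    then show ?thesis by (simp add: sigma_sets_range_vimage)
  qed
  show ?thesis
    unfolding prob_space.indep_var_eq[OF prob_space_measure_pmf]
  proof (intro conjI prob_space.indep_setI[OF prob_space_measure_pmf])
    fix a b
    assume "a \<in> sigma_sets (space ?P) {(\<lambda>z. f (fst z)) -` A \<inter> space ?P |A. A \<in> sets borel}"
      "b \<in> sigma_sets (space ?P) {(\<lambda>z. g (snd z)) -` A \<inter> space ?P |A. A \<in> sets borel}"
    then have "a \<in> range (vimage fst)" "b \<in> range (vimage snd)"
      using sub[of f fst] sub[of g snd] by blast+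
    then show "measure ?P (a \<inter> b) = measure ?P a * measure ?P b" using prod by auto
  qed auto
qed

lemma integrable_pair_pmf_fst: "integrable (measure_pmf p) f \<Longrightarrow> integrable (pair_pmf p q) (\<lambda>z. f (fst z))"
  for f :: "'a \<Rightarrow> 'c :: {banach, second_countable_topology}"
  using integrable_map_pmf_eq[of fst "pair_pmf p q" f] by (simp add: map_fst_pair_pmf)

lemma integrable_pair_pmf_snd: "integrable (measure_pmf q) f \<Longrightarrow> integrable (pair_pmf p q) (\<lambda>z. f (snd z))"
  for f :: "'a \<Rightarrow> 'c :: {banach, second_countable_topology}"
  using integrable_map_pmf_eq[of snd "pair_pmf p q" f] by (simp add: map_snd_pair_pmf)

lemma integral_pair_pmf_mult:
  fixes f :: "'a \<Rightarrow> 'c :: {real_normed_field, banach, second_countable_topology}"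
  assumes "integrable (measure_pmf p) f" "integrable (measure_pmf q) g"
  shows "integrable (pair_pmf p q) (\<lambda>z. f (fst z) * g (snd z))"
    and "(\<integral>z. f (fst z) * g (snd z) \<partial>pair_pmf p q) = (\<integral>x. f x \<partial>p) * (\<integral>y. g y \<partial>q)"
proof -
  note i1 = integrable_pair_pmf_fst[OF assms(1), of q] and i2 = integrable_pair_pmf_snd[OF assms(2), of p]
  note ind = indep_var_pair_pmf[of p q f g]
  show "integrable (pair_pmf p q) (\<lambda>z. f (fst z) * g (snd z))"
    by (rule prob_space.indep_var_integrable[OF prob_space_measure_pmf ind i1 i2])
  show "(\<integral>z. f (fst z) * g (snd z) \<partial>pair_pmf p q) = (\<integral>x. f x \<partial>p) * (\<integral>y. g y \<partial>q)"
    using prob_space.indep_var_lebesgue_integral[OF prob_space_measure_pmf ind i1 i2] by simp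
qed

text \<open>By doubling, f(2^k n) / 2^k is Cauchy with steps at most (3/4)^(k+1) r(n), which add up
  to 3 r(n); its limit \<open>w\<close> is exactly additive in n, hence linear. A factor below 2 in
  the growth of r is essential, and 3/2 admits both constants and multiples of sqrt n.\<close>

lemma near_additive_limit:
  fixes f r :: "nat \<Rightarrow> real"
  assumes add: "\<And>m n. m \<ge> 1 \<Longrightarrow> n \<ge> 1 \<Longrightarrow> \<bar>f (m + n) - f m - f n\<bar> \<le> r (m + n)"
    and r: "\<And>n. r (2 * n) \<le> 3/2 * r n"
  shows "\<exists>\<gamma>. \<forall>n\<ge>1. \<bar>f n - real n * \<gamma>\<bar> \<le> 3 * r n"
proof -
  define g where "g n k = f (2 ^ k * n) / 2 ^ k" for n k
  have rk: "r (2 ^ k * n) \<le> (3/2) ^ k * r n" for k n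
  proof (induction k)
    case (Suc k)
    have "r (2 ^ Suc k * n) \<le> 3/2 * r (2 ^ k * n)" using r[of "2 ^ k * n"] by (simp add: mult.assoc)
    also have "\<dots> \<le> 3/2 * ((3/2) ^ k * r n)" using Suc.IH by simp
    finally show ?case by simp
  qed simp
  have step: "\<bar>g n (Suc k) - g n k\<bar> \<le> (3/4) ^ Suc k * r n" if "n \<ge> 1" for n k
  proof -
    have "\<bar>f (2 ^ k * n + 2 ^ k * n) - f (2 ^ k * n) - f (2 ^ k * n)\<bar> \<le> r (2 ^ k * n + 2 ^ k * n)"
      using that by (intro add) auto
    also have "2 ^ k * n + 2 ^ k * n = 2 ^ Suc k * n" by simp
    finally have "\<bar>f (2 ^ Suc k * n) - 2 * f (2 ^ k * n)\<bar> \<le> r (2 ^ Suc k * n)" by simp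
    also have "\<dots> \<le> (3/2) ^ Suc k * r n" by (rule rk)
    finally have "\<bar>f (2 ^ Suc k * n) - 2 * f (2 ^ k * n)\<bar> / 2 ^ Suc k \<le> (3/2) ^ Suc k * r n / 2 ^ Suc k"
      by (rule divide_right_mono) simp
    also have "(3/2) ^ Suc k * r n / 2 ^ Suc k = ((3/2) / 2) ^ Suc k * r n"
      by (subst power_divide) simp
    also have "\<bar>f (2 ^ Suc k * n) - 2 * f (2 ^ k * n)\<bar> / 2 ^ Suc k = \<bar>g n (Suc k) - g n k\<bar>"
    proof -
      have "g n (Suc k) - g n k = (f (2 ^ Suc k * n) - 2 * f (2 ^ k * n)) / 2 ^ Suc k"
        by (simp add: g_def diff_divide_distrib)
      then show ?thesis by (simp only: abs_divide abs_power2 power_abs abs_numeral)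
    qed
    finally show ?thesis by simp
  qed
  have rnn: "r n \<ge> 0" if "n \<ge> 1" for n
    using order_trans[OF abs_ge_zero step[OF that, of 0]] by simp
  have geo: "summable (\<lambda>k. (3/4) ^ Suc k * r n)" "(\<Sum>k. (3/4) ^ Suc k * r n) = 3 * r n" for n
    using sums_mult2[OF sums_mult[OF geometric_sums[of "3/4 :: real"], of "3/4"], of "r n"]
    by (simp_all add: sums_iff mult.assoc)
  have diff_sum: "summable (\<lambda>k. g n (Suc k) - g n k)" if "n \<ge> 1" for n
    by (rule summable_comparison_test'[OF geo(1)[of n], of 0]) (use step[OF that] in auto)
  define w where "w n = g n 0 + (\<Sum>k. g n (Suc k) - g n k)" for n
  have lim: "g n \<longlonglongrightarrow> w n" if "n \<ge> 1" for n
  proof -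
    have "(\<lambda>K. g n 0 + (\<Sum>k<K. g n (Suc k) - g n k)) \<longlonglongrightarrow> w n"
      unfolding w_def by (intro tendsto_add tendsto_const summable_LIMSEQ diff_sum that)
    then show ?thesis by (simp add: sum_lessThan_telescope)
  qed
  have fw: "\<bar>f n - w n\<bar> \<le> 3 * r n" if "n \<ge> 1" for n
  proof -
    have "summable (\<lambda>k. \<bar>g n (Suc k) - g n k\<bar>)"
      by (rule summable_comparison_test'[OF geo(1)[of n], of 0]) (use step[OF that] in auto)
    then have "\<bar>\<Sum>k. g n (Suc k) - g n k\<bar> \<le> (\<Sum>k. \<bar>g n (Suc k) - g n k\<bar>)" by (rule summable_rabs)
    also have "\<dots> \<le> (\<Sum>k. (3/4) ^ Suc k * r n)"
      by (intro suminf_le step that geo \<open>summable (\<lambda>k. \<bar>g n (Suc k) - g n k\<bar>)\<close>)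
    also note geo(2)
    finally show ?thesis by (simp add: w_def g_def)
  qed
  have wadd: "w (m + n) = w m + w n" if mn: "m \<ge> 1" "n \<ge> 1" for m n
  proof -
    have "(\<lambda>k. g (m + n) k - (g m k + g n k)) \<longlonglongrightarrow> w (m + n) - (w m + w n)"
      using mn by (intro tendsto_diff tendsto_add lim) auto
    moreover have "(\<lambda>k. g (m + n) k - (g m k + g n k)) \<longlonglongrightarrow> 0"
    proof (rule Lim_null_comparison)
      have "(\<lambda>k. (3/4) ^ k * r (m + n)) \<longlonglongrightarrow> 0 * r (m + n)"
        by (intro tendsto_mult tendsto_const LIMSEQ_realpow_zero) auto
      then show "(\<lambda>k. (3/4) ^ k * r (m + n)) \<longlonglongrightarrow> 0" by simp
      show "\<forall>\<^sub>F k in sequentially. norm (g (m + n) k - (g m k + g n k)) \<le> (3/4) ^ k * r (m + n)"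
      proof (rule always_eventually, rule allI)
        fix k
        have "\<bar>f (2 ^ k * m + 2 ^ k * n) - f (2 ^ k * m) - f (2 ^ k * n)\<bar> \<le> r (2 ^ k * m + 2 ^ k * n)"
          using mn by (intro add) auto
        also have "2 ^ k * m + 2 ^ k * n = 2 ^ k * (m + n)" by (simp add: distrib_left)
        also have "r (2 ^ k * (m + n)) \<le> (3/2) ^ k * r (m + n)" by (rule rk)
        finally have "\<bar>f (2 ^ k * (m + n)) - f (2 ^ k * m) - f (2 ^ k * n)\<bar> / 2 ^ k \<le> (3/2) ^ k * r (m + n) / 2 ^ k"
          by (rule divide_right_mono) simp
        also have "(3/2) ^ k * r (m + n) / 2 ^ k = ((3/2) / 2) ^ k * r (m + n)"
          by (subst power_divide) simp
        also have "\<bar>f (2 ^ k * (m + n)) - f (2 ^ k * m) - f (2 ^ k * n)\<bar> / 2 ^ k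
          = norm (g (m + n) k - (g m k + g n k))"
        proof -
          have "g (m + n) k - (g m k + g n k) = (f (2 ^ k * (m + n)) - f (2 ^ k * m) - f (2 ^ k * n)) / 2 ^ k"
            by (simp add: g_def diff_divide_distrib)
          then show ?thesis by (simp only: real_norm_def abs_divide power_abs abs_numeral)
        qed
        finally show "norm (g (m + n) k - (g m k + g n k)) \<le> (3/4) ^ k * r (m + n)" by simp
      qed
    qed
    ultimately have "w (m + n) - (w m + w n) = 0" by (rule LIMSEQ_unique)
    then show ?thesis by simp
  qed
  have "w n = real n * w 1" if "n \<ge> 1" for n
    using that
  proof (induction n rule: dec_induct)
    case (step n)
    then show ?case using wadd[of n 1] by (simp add: algebra_simps)
  qed simp
  then have "\<forall>n\<ge>1. \<bar>f n - real n * w 1\<bar> \<le> 3 * r n" using fw by metis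
  then show ?thesis by blast
qed

text \<open>Halving, with parts equal up to one, ends at block lengths in [m, 2m).\<close>

lemma balanced_induct:
  fixes m n :: nat
  assumes "m \<ge> 1" "n \<ge> m" and base: "\<And>n. m \<le> n \<Longrightarrow> n < 2 * m \<Longrightarrow> P n"
    and step: "\<And>a b. a \<ge> m \<Longrightarrow> b = a \<or> b = Suc a \<Longrightarrow> P a \<Longrightarrow> P b \<Longrightarrow> P (a + b)"
  shows "P n"
  using assms(2)
proof (induction n rule: less_induct)
  case (less n)
  show ?case
  proof (cases "n < 2 * m")
    case False
    let ?a = "n div 2" and ?b = "n - n div 2"
    have "?a \<ge> m" "?b = ?a \<or> ?b = Suc ?a" "?a < n" "?b < n" "?a + ?b = n"
      using False assms(1) by presburger+
    moreover from this have "?b \<ge> m" by linarith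
    ultimately show ?thesis using step[of ?a ?b] less.IH by metis
  qed (use base less.prems in auto)
qed

text \<open>For balanced parts the sum of the roots is close to sqrt 2 times the root of the sum,
  and 5/4 < sqrt 2. The excess over 1 lets a bound with a negative multiple of sqrt n absorb an
  error of order sqrt n at every halving.\<close>

lemma sqrt_balanced:
  assumes "a \<ge> 1" "b = a \<or> b = Suc a"
  shows "5 * sqrt (real (a + b)) \<le> 4 * (sqrt (real a) + sqrt (real b))"
proof (rule power2_le_imp_le)
  have "sqrt (real a) * sqrt (real b) \<ge> sqrt (real a) * sqrt (real a)"
    using assms by (intro mult_left_mono) auto
  then have ab: "sqrt (real a) * sqrt (real b) \<ge> real a" by simp
  have "(5 * sqrt (real (a + b)))\<^sup>2 = 25 * (real a + real b)" by (simp add: power_mult_distrib)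
  also have "\<dots> \<le> 16 * (real a + real b + 2 * real a)"
    using assms by auto
  also have "\<dots> \<le> 16 * (real a + real b + 2 * (sqrt (real a) * sqrt (real b)))" using ab by simp
  also have "\<dots> = (4 * (sqrt (real a) + sqrt (real b)))\<^sup>2"
    by (simp add: power_mult_distrib power2_sum)
  finally show "(5 * sqrt (real (a + b)))\<^sup>2 \<le> (4 * (sqrt (real a) + sqrt (real b)))\<^sup>2" .
qed simp

section \<open>Square-integrable functions on discrete laws\<close>

lemma integrable_square_add:
  fixes f g :: "'a \<Rightarrow> real"
  assumes "integrable (measure_pmf M) (\<lambda>x. (f x)\<^sup>2)" "integrable (measure_pmf M) (\<lambda>x. (g x)\<^sup>2)"
  shows "integrable (measure_pmf M) (\<lambda>x. (f x + g x)\<^sup>2)"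
proof (rule Bochner_Integration.integrable_bound)
  show "integrable (measure_pmf M) (\<lambda>x. 2 * (f x)\<^sup>2 + 2 * (g x)\<^sup>2)"
    using assms by simp
  show "AE x in M. norm ((f x + g x)\<^sup>2) \<le> norm (2 * (f x)\<^sup>2 + 2 * (g x)\<^sup>2)"
  proof (rule AE_I2)
    fix x
    have "(f x + g x)\<^sup>2 \<le> 2 * (f x)\<^sup>2 + 2 * (g x)\<^sup>2"
      using sum_squares_ge_zero[of "f x - g x" 0] by (simp add: power2_eq_square algebra_simps)
    then show "norm ((f x + g x)\<^sup>2) \<le> norm (2 * (f x)\<^sup>2 + 2 * (g x)\<^sup>2)" by simp
  qed
qed simp

lemma integrable_square_mult:
  fixes f g :: "'a \<Rightarrow> real"
  assumes "integrable (measure_pmf M) (\<lambda>x. (f x)\<^sup>2)" "integrable (measure_pmf M) (\<lambda>x. (g x)\<^sup>2)"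
  shows "integrable (measure_pmf M) (\<lambda>x. f x * g x)"
proof -
  have "integrable (measure_pmf M) (\<lambda>x. (f x + g x)\<^sup>2 - (f x)\<^sup>2 - (g x)\<^sup>2)"
    using assms integrable_square_add by (intro Bochner_Integration.integrable_diff) auto
  also have "(\<lambda>x. (f x + g x)\<^sup>2 - (f x)\<^sup>2 - (g x)\<^sup>2) = (\<lambda>x. 2 * (f x * g x))"
    by (simp add: power2_sum mult.assoc)
  finally show ?thesis by simp
qed

lemma integrable_square_imp:
  fixes f :: "'a \<Rightarrow> real"
  assumes "integrable (measure_pmf M) (\<lambda>x. (f x)\<^sup>2)" shows "integrable (measure_pmf M) f"
  using integrable_square_mult[OF assms, of "\<lambda>_. 1"] by simp

lemma integrable_square_diff_const:
  fixes f :: "'a \<Rightarrow> real"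
  assumes "integrable (measure_pmf M) (\<lambda>x. (f x)\<^sup>2)"
  shows "integrable (measure_pmf M) (\<lambda>x. (f x - c)\<^sup>2)"
  using integrable_square_add[OF assms, of "\<lambda>_. - c"] by simp

text \<open>The weight will be of order sqrt n, to balance a variance of order n against a bounded
  second moment.\<close>

lemma two_mult_le_weighted:
  fixes x y c :: real assumes "c > 0" shows "2 * \<bar>x * y\<bar> \<le> c * x\<^sup>2 + y\<^sup>2 / c"
proof -
  have "0 \<le> (c * \<bar>x\<bar> - \<bar>y\<bar>)\<^sup>2 / c" using assms by simp
  also have "(c * a - b)\<^sup>2 / c = c * a\<^sup>2 - 2 * (a * b) + b\<^sup>2 / c" for a b
    using assms by (simp add: field_simps power2_eq_square)
  finally show ?thesis by (simp add: abs_mult)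
qed

lemma square_nn_integral_bound:
  fixes f :: "'a \<Rightarrow> real"
  assumes "(\<integral>\<^sup>+ x. ennreal ((f x)\<^sup>2) \<partial>measure_pmf M) \<le> ennreal B" "B \<ge> 0"
  shows "integrable (measure_pmf M) (\<lambda>x. (f x)\<^sup>2)" "(\<integral>x. (f x)\<^sup>2 \<partial>M) \<le> B"
    and "\<bar>\<integral>x. f x \<partial>M\<bar> \<le> (B + 1) / 2"
proof -
  show i: "integrable (measure_pmf M) (\<lambda>x. (f x)\<^sup>2)"
    using assms by (intro integrableI_nonneg) (auto intro: le_less_trans)
  have "ennreal (\<integral>x. (f x)\<^sup>2 \<partial>M) \<le> ennreal B"
    using assms(1) nn_integral_eq_integral[OF i] by simp
  then show le: "(\<integral>x. (f x)\<^sup>2 \<partial>M) \<le> B" using assms(2) by simp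
  have "\<bar>\<integral>x. f x \<partial>M\<bar> \<le> (\<integral>x. \<bar>f x\<bar> \<partial>M)" by (rule integral_abs_bound)
  also have "\<dots> \<le> (\<integral>x. ((f x)\<^sup>2 + 1) / 2 \<partial>M)"
  proof (rule integral_mono)
    fix x
    show "\<bar>f x\<bar> \<le> ((f x)\<^sup>2 + 1) / 2"
      using two_mult_le_weighted[of 1 "f x" 1] by simp
  qed (use i integrable_square_imp[OF i] in auto)
  also have "\<dots> \<le> (B + 1) / 2" using i le by simp
  finally show "\<bar>\<integral>x. f x \<partial>M\<bar> \<le> (B + 1) / 2" .
qed

lemma nn_integral_pair_pmf_le:
  assumes "\<And>g. (\<integral>\<^sup>+ h. f (g, h) \<partial>measure_pmf q) \<le> c"
  shows "(\<integral>\<^sup>+ z. f z \<partial>pair_pmf p q) \<le> c"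
proof -
  have "(\<integral>\<^sup>+ z. f z \<partial>pair_pmf p q) \<le> (\<integral>\<^sup>+ g. c \<partial>p)"
    unfolding nn_integral_pair_pmf' by (intro nn_integral_mono assms)
  then show ?thesis by simp
qed

text \<open>\<open>left\<close> and \<open>right\<close> tell the position of the fixed factor.
  \<open>left\<close> controls the product of two independent blocks; both together control a fixed
  element inserted between two blocks.\<close>

locale quasi_additive =
  fixes \<nu> :: "'a :: monoid_mult pmf" and Q :: "'a \<Rightarrow> real" and B :: real
  assumes square: "integrable \<nu> (\<lambda>x. (Q x)\<^sup>2)"
    and B_nonneg: "B \<ge> 0"
    and left: "\<And>g m. (\<integral>\<^sup>+ h. ennreal ((Q (g * h) - Q g - Q h)\<^sup>2) \<partial>conv_power \<nu> m) \<le> ennreal B"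
    and right: "\<And>g m. (\<integral>\<^sup>+ h. ennreal ((Q (h * g) - Q h - Q g)\<^sup>2) \<partial>conv_power \<nu> m) \<le> ennreal B"
begin

abbreviation "mu n \<equiv> measure_pmf (conv_power \<nu> n)"
abbreviation "pr m n \<equiv> measure_pmf (pair_pmf (conv_power \<nu> m) (conv_power \<nu> n))"

definition "dfct z = Q (fst z * snd z) - Q (fst z) - Q (snd z)"

lemma nn_integral_defect: "(\<integral>\<^sup>+ z. ennreal ((dfct z)\<^sup>2) \<partial>pr m n) \<le> ennreal B"
  by (rule nn_integral_pair_pmf_le) (simp add: dfct_def left)

lemmas integrable_defect = square_nn_integral_bound(1)[OF nn_integral_defect B_nonneg]
  and expectation_defect = square_nn_integral_bound(2)[OF nn_integral_defect B_nonneg]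

lemma conv_power_pair: "conv_power \<nu> (m + n) = map_pmf (\<lambda>z. fst z * snd z) (pair_pmf (conv_power \<nu> m) (conv_power \<nu> n))"
  by (simp add: conv_power_add conv_pmf_def split_def)

lemma integrable_square: "integrable (mu n) (\<lambda>x. (Q x)\<^sup>2)"
proof (induction n)
  case 0
  show ?case by (simp add: integrable_measure_pmf_finite)
next
  case (Suc n)
  have "integrable (pr n 1) (\<lambda>z. (Q (fst z) + Q (snd z) + dfct z)\<^sup>2)"
    using integrable_pair_pmf_fst[OF Suc.IH, of "conv_power \<nu> 1"]
      integrable_pair_pmf_snd[OF square, of "conv_power \<nu> n"]
    by (intro integrable_square_add integrable_defect) simp_all
  then have "integrable (pr n 1) (\<lambda>z. (Q (fst z * snd z))\<^sup>2)" by (simp add: dfct_def)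
  then show ?case using conv_power_pair[of n 1]
    by (simp add: integrable_map_pmf_eq)
qed

lemma integrable_Q: "integrable (mu n) Q"
  by (rule integrable_square_imp[OF integrable_square])

definition "mean n = (\<integral>x. Q x \<partial>mu n)"
definition "var n = (\<integral>x. (Q x - mean n)\<^sup>2 \<partial>mu n)"
definition "chf n s = (\<integral>x. iexp (s * (Q x - mean n)) \<partial>mu n)"

text \<open>The centred value of \<open>Q\<close> on a product splits into \<open>ctr\<close>, a sum
  of two independent centred variables, and the centred defect \<open>rem\<close>.\<close>

definition "ctr m n z = Q (fst z) - mean m + (Q (snd z) - mean n)"
definition "rem m n z = dfct z - (mean (m + n) - mean m - mean n)"

lemma var_nonneg: "var n \<ge> 0"
  by (simp add: var_def)

lemma integral_conv_pair:
  fixes f :: "'a \<Rightarrow> 'c :: {banach, second_countable_topology}"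
  shows "(\<integral>x. f x \<partial>mu (m + n)) = (\<integral>z. f (fst z * snd z) \<partial>pr m n)"
  by (simp add: conv_power_pair integral_map_pmf)

lemma ctr_plus_rem: "Q (fst z * snd z) - mean (m + n) = ctr m n z + rem m n z"
  by (simp add: ctr_def rem_def dfct_def)

lemma integrable_dfct: "integrable (pr m n) dfct"
  by (rule integrable_square_imp[OF integrable_defect])

lemma mean_dfct: "(\<integral>z. dfct z \<partial>pr m n) = mean (m + n) - mean m - mean n"
proof -
  have 1: "integrable (pr m n) (\<lambda>z. Q (fst z))" "integrable (pr m n) (\<lambda>z. Q (snd z))"
    by (intro integrable_pair_pmf_fst integrable_pair_pmf_snd integrable_Q)+
  have "mean (m + n) = (\<integral>z. Q (fst z) + Q (snd z) + dfct z \<partial>pr m n)"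
    unfolding mean_def integral_conv_pair by (simp add: dfct_def)
  also have "\<dots> = mean m + mean n + (\<integral>z. dfct z \<partial>pr m n)"
    using 1 integrable_dfct[of m n] by (simp add: mean_def)
  finally show ?thesis by simp
qed

lemma mean_rem: "(\<integral>z. rem m n z \<partial>pr m n) = 0"
  using integrable_dfct[of m n] by (simp add: rem_def mean_dfct)

lemma integrable_rem_square: "integrable (pr m n) (\<lambda>z. (rem m n z)\<^sup>2)"
  unfolding rem_def by (rule integrable_square_diff_const[OF integrable_defect])

lemma expectation_rem_square: "(\<integral>z. (rem m n z)\<^sup>2 \<partial>pr m n) \<le> B"
proof -
  let ?c = "mean (m + n) - mean m - mean n"
  have "(\<integral>z. (rem m n z)\<^sup>2 \<partial>pr m n) = (\<integral>z. (dfct z)\<^sup>2 - 2 * ?c * dfct z + ?c\<^sup>2 \<partial>pr m n)"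
    by (intro Bochner_Integration.integral_cong) (simp_all add: rem_def power2_diff)
  also have "\<dots> = (\<integral>z. (dfct z)\<^sup>2 \<partial>pr m n) - ?c\<^sup>2"
    using integrable_dfct[of m n] integrable_defect[of m n]
    by (simp add: mean_dfct power2_eq_square)
  also have "\<dots> \<le> (\<integral>z. (dfct z)\<^sup>2 \<partial>pr m n)" by simp
  finally show ?thesis using expectation_defect[of m n] by simp
qed

lemma abs_mean_defect: "\<bar>mean (m + n) - mean m - mean n\<bar> \<le> (B + 1) / 2"
  unfolding mean_dfct[symmetric] by (rule square_nn_integral_bound(3)[OF nn_integral_defect B_nonneg])

lemma integrable_ctr_square: "integrable (pr m n) (\<lambda>z. (ctr m n z)\<^sup>2)"
  unfolding ctr_def
  by (intro integrable_square_add integrable_square_diff_const)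
     (auto intro: integrable_pair_pmf_fst[OF integrable_square] integrable_pair_pmf_snd[OF integrable_square])

lemma expectation_ctr_square: "(\<integral>z. (ctr m n z)\<^sup>2 \<partial>pr m n) = var m + var n"
proof -
  have i: "integrable (mu k) (\<lambda>x. Q x - mean k)" "integrable (mu k) (\<lambda>x. (Q x - mean k)\<^sup>2)" for k
    using integrable_Q integrable_square_diff_const[OF integrable_square] by auto
  have z: "(\<integral>x. Q x - mean k \<partial>mu k) = 0" for k
    using integrable_Q by (simp add: mean_def)
  define f g where "f = (\<lambda>z :: 'a \<times> 'a. Q (fst z) - mean m)" and "g = (\<lambda>z :: 'a \<times> 'a. Q (snd z) - mean n)"
  have int: "integrable (pr m n) (\<lambda>z. (f z)\<^sup>2)" "integrable (pr m n) (\<lambda>z. (g z)\<^sup>2)"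
    "integrable (pr m n) (\<lambda>z. f z * g z)"
    unfolding f_def g_def
    by (fact integrable_pair_pmf_fst[OF i(2)] integrable_pair_pmf_snd[OF i(2)] integral_pair_pmf_mult(1)[OF i(1) i(1)])+
  have "(\<integral>z. (ctr m n z)\<^sup>2 \<partial>pr m n) = (\<integral>z. (f z)\<^sup>2 + 2 * (f z * g z) + (g z)\<^sup>2 \<partial>pr m n)"
    by (intro Bochner_Integration.integral_cong) (simp_all add: ctr_def f_def g_def power2_sum)
  also have "\<dots> = (\<integral>z. (f z)\<^sup>2 \<partial>pr m n) + 2 * (\<integral>z. f z * g z \<partial>pr m n) + (\<integral>z. (g z)\<^sup>2 \<partial>pr m n)"
    using int by simp
  also have "(\<integral>z. f z * g z \<partial>pr m n) = 0"
    using integral_pair_pmf_mult(2)[OF i(1) i(1)] by (simp add: z f_def g_def)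
  finally show ?thesis
    by (simp add: var_def f_def g_def expectation_pair_pmf_fst[where f = "\<lambda>x. (Q x - mean m)\<^sup>2"]
      expectation_pair_pmf_snd[where f = "\<lambda>x. (Q x - mean n)\<^sup>2"])
qed

lemma expectation_abs_ctr_rem:
  assumes "c > 0"
  shows "2 * (\<integral>z. \<bar>ctr m n z * rem m n z\<bar> \<partial>pr m n) \<le> (var m + var n) / c + c * B"
    and "integrable (pr m n) (\<lambda>z. ctr m n z * rem m n z)"
proof -
  show i: "integrable (pr m n) (\<lambda>z. ctr m n z * rem m n z)"
    by (intro integrable_square_mult integrable_ctr_square integrable_rem_square)
  have "(\<integral>z. 2 * \<bar>ctr m n z * rem m n z\<bar> \<partial>pr m n) \<le> (\<integral>z. c * (rem m n z)\<^sup>2 + (ctr m n z)\<^sup>2 / c \<partial>pr m n)"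
    using i integrable_ctr_square[of m n] integrable_rem_square[of m n]
      two_mult_le_weighted[OF assms, of "rem m n _" "ctr m n _"]
    by (intro integral_mono) (auto simp: mult.commute)
  also have "\<dots> = c * (\<integral>z. (rem m n z)\<^sup>2 \<partial>pr m n) + (var m + var n) / c"
    using integrable_ctr_square[of m n] integrable_rem_square[of m n]
    by (simp add: expectation_ctr_square)
  also have "\<dots> \<le> c * B + (var m + var n) / c"
    using assms expectation_rem_square[of m n] by simp
  finally show "2 * (\<integral>z. \<bar>ctr m n z * rem m n z\<bar> \<partial>pr m n) \<le> (var m + var n) / c + c * B"
    by simp
qed

text \<open>\<open>ctr\<close> and \<open>rem\<close> are dependent, so the cross term of the square
  stays and is paid for with the weight \<open>c\<close>.\<close>

lemma var_add:
  assumes "c > 0"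
  shows "\<bar>var (m + n) - var m - var n\<bar> \<le> (var m + var n) / c + c * B + B"
proof -
  note ir = integrable_ctr_square[of m n] integrable_rem_square[of m n] expectation_abs_ctr_rem(2)[OF assms, of m n]
  have "var (m + n) = (\<integral>z. (ctr m n z)\<^sup>2 + 2 * (ctr m n z * rem m n z) + (rem m n z)\<^sup>2 \<partial>pr m n)"
    unfolding var_def integral_conv_pair ctr_plus_rem
    by (intro Bochner_Integration.integral_cong) (simp_all add: power2_sum)
  also have "\<dots> = var m + var n + 2 * (\<integral>z. ctr m n z * rem m n z \<partial>pr m n) + (\<integral>z. (rem m n z)\<^sup>2 \<partial>pr m n)"
    using ir by (simp add: expectation_ctr_square)
  finally have eq: "var (m + n) - var m - var n
    = 2 * (\<integral>z. ctr m n z * rem m n z \<partial>pr m n) + (\<integral>z. (rem m n z)\<^sup>2 \<partial>pr m n)" by simp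
  have "\<bar>\<integral>z. ctr m n z * rem m n z \<partial>pr m n\<bar> \<le> (\<integral>z. \<bar>ctr m n z * rem m n z\<bar> \<partial>pr m n)"
    by (rule integral_abs_bound)
  moreover have "(\<integral>z. (rem m n z)\<^sup>2 \<partial>pr m n) \<ge> 0" by simp
  ultimately show ?thesis unfolding eq
    using expectation_abs_ctr_rem(1)[OF assms, of m n] expectation_rem_square[of m n] by linarith
qed

text \<open>Each split adds an error of order sqrt n, so the induction is run on the stronger claim
  \<open>var n \<le> A n - b sqrt n\<close>, in which \<open>sqrt_balanced\<close> gains
  \<open>b s / 4\<close>, where \<open>s\<close> is the root of the total length.\<close>

lemma var_linear: "\<exists>A>0. \<forall>n\<ge>1. var n \<le> A * real n"
proof -
  \<comment> \<open>With weight \<open>8 s\<close> a split costs at most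
    \<open>(A / 8 + 9 B) s\<close>, and the gain \<open>b s / 4\<close> has to cover this:
    \<open>b = A / 2 + 36 B\<close>. The base case \<open>A - b \<ge> var 1\<close> then dictates
    \<open>A\<close>.\<close>
  define A where "A = 2 * var 1 + 256 * B + 64 * B + 1"
  define b where "b = A / 2 + 32 * B + 4 * B"
  have A: "A > 0" using var_nonneg[of 1] B_nonneg by (simp add: A_def)
  have b: "b \<ge> 0" using A B_nonneg by (simp add: b_def)
  have "var n \<le> A * real n - b * sqrt (real n)" if "n \<ge> 1" for n
  proof (rule balanced_induct[of 1 n])
    fix k :: nat assume "1 \<le> k" "k < 2 * 1"
    then have "k = 1" by simp
    moreover have "A - b = var 1 + 124 * B + 1 / 2" by (simp add: A_def b_def field_simps)
    ultimately show "var k \<le> A * real k - b * sqrt (real k)"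
      using B_nonneg by simp
  next
    fix p q :: nat
    assume p: "p \<ge> 1" and q: "q = p \<or> q = Suc p" and P: "var p \<le> A * real p - b * sqrt (real p)"
      and Q: "var q \<le> A * real q - b * sqrt (real q)"
    define s where "s = sqrt (real (p + q))"
    have s: "s \<ge> 1" "s * s = real (p + q)" using p by (auto simp: s_def)
    have sb: "5 * s \<le> 4 * (sqrt (real p) + sqrt (real q))" unfolding s_def using sqrt_balanced[OF p q] by simp
    have "var (p + q) \<le> var p + var q + ((var p + var q) / (8 * s) + 8 * s * B + B)"
      using var_add[of "8 * s" p q] s(1) by simp
    also have "(var p + var q) / (8 * s) \<le> (A * real p + A * real q) / (8 * s)"
      using P Q s(1) mult_nonneg_nonneg[OF b, of "sqrt (real p)"] mult_nonneg_nonneg[OF b, of "sqrt (real q)"]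
      by (intro divide_right_mono) simp_all
    also have "(A * real p + A * real q) / (8 * s) = A * s / 8"
    proof -
      have "A * real p + A * real q = A * (s * s)" unfolding s(2) by (simp add: algebra_simps)
      then show ?thesis using s(1) by simp
    qed
    finally have "var (p + q) \<le> var p + var q + A * s / 8 + 8 * s * B + B" by simp
    moreover have "B \<le> B * s" using B_nonneg s(1) by (simp add: mult_le_cancel_left1)
    ultimately have "var (p + q) \<le> A * (s * s) - b * (sqrt (real p) + sqrt (real q)) + (A / 8 + 8 * B + B) * s"
      using P Q unfolding s(2) by (simp add: algebra_simps)
    also have "\<dots> \<le> A * (s * s) - b * (5 / 4 * s) + (A / 8 + 8 * B + B) * s"
      using mult_left_mono[OF sb b] by (simp add: algebra_simps)
    also have "\<dots> = A * (s * s) - b * s" by (simp add: b_def algebra_simps)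
    finally show "var (p + q) \<le> A * real (p + q) - b * sqrt (real (p + q))"
      by (simp add: s(2) s_def)
  qed (use that in auto)
  then have "var n \<le> A * real n" if "n \<ge> 1" for n
    using that b by (smt (verit) mult_nonneg_nonneg of_nat_0_le_iff real_sqrt_ge_zero)
  then show ?thesis using A by blast
qed

lemma mean_limit: "\<exists>\<gamma>. \<forall>n\<ge>1. \<bar>mean n - real n * \<gamma>\<bar> \<le> 3 * ((B + 1) / 2)"
  using near_additive_limit[of mean "\<lambda>_. (B + 1) / 2"] abs_mean_defect B_nonneg by simp

lemma var_add_sqrt: "\<exists>C\<ge>0. \<forall>m\<ge>1. \<forall>n\<ge>1. \<bar>var (m + n) - var m - var n\<bar> \<le> C * sqrt (real (m + n))"
proof -
  obtain A where A: "A > 0" "\<And>n. n \<ge> 1 \<Longrightarrow> var n \<le> A * real n" using var_linear by blast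
  have "\<bar>var (m + n) - var m - var n\<bar> \<le> (A + 2 * B) * sqrt (real (m + n))" if mn: "m \<ge> 1" "n \<ge> 1" for m n
  proof -
    define s where "s = sqrt (real (m + n))"
    have s: "s \<ge> 1" "s * s = real (m + n)" using mn by (auto simp: s_def)
    have "var m + var n \<le> A * (s * s)" using A(2)[OF mn(1)] A(2)[OF mn(2)] by (simp add: s(2) algebra_simps)
    then have "(var m + var n) / s \<le> A * s" using s(1) by (simp add: divide_le_eq mult.assoc)
    moreover have "B \<le> B * s" using B_nonneg s(1) by (simp add: mult_le_cancel_left1)
    ultimately have "\<bar>var (m + n) - var m - var n\<bar> \<le> (A + 2 * B) * s"
      using var_add[of s m n] s(1) by (simp add: algebra_simps)
    then show ?thesis by (simp add: s_def)
  qed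
  then show ?thesis using A(1) B_nonneg by (intro exI[of _ "A + 2 * B"]) auto
qed

text \<open>The error is of order sqrt n and sqrt 2 \<le> 3/2, so \<open>near_additive_limit\<close>
  applies.\<close>

lemma var_limit: "\<exists>\<sigma>2\<ge>0. \<exists>C\<ge>0. \<forall>n\<ge>1. \<bar>var n - real n * \<sigma>2\<bar> \<le> C * sqrt (real n)"
proof -
  obtain C where C: "C \<ge> 0" "\<And>m n. m \<ge> 1 \<Longrightarrow> n \<ge> 1 \<Longrightarrow> \<bar>var (m + n) - var m - var n\<bar> \<le> C * sqrt (real (m + n))"
    using var_add_sqrt by blast
  have "\<exists>\<sigma>2. \<forall>n\<ge>1. \<bar>var n - real n * \<sigma>2\<bar> \<le> 3 * (C * sqrt (real n))"
  proof (rule near_additive_limit)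
    fix n
    have "sqrt 2 \<le> 3 / 2" by (rule real_le_lsqrt) (auto simp: power2_eq_square)
    then have "C * (sqrt 2 * sqrt (real n)) \<le> C * (3 / 2 * sqrt (real n))" using C(1) by (intro mult_left_mono mult_right_mono) auto
    then show "C * sqrt (real (2 * n)) \<le> 3 / 2 * (C * sqrt (real n))" by (simp add: real_sqrt_mult)
  qed (use C(2) in auto)
  then obtain \<sigma>2 where \<sigma>2: "\<And>n. n \<ge> 1 \<Longrightarrow> \<bar>var n - real n * \<sigma>2\<bar> \<le> 3 * (C * sqrt (real n))" by blast
  have "\<sigma>2 \<ge> 0"
  proof (rule LIMSEQ_le_const)
    show "(\<lambda>n. \<sigma>2 + 3 * C / sqrt (real n)) \<longlonglongrightarrow> \<sigma>2"
      using tendsto_add[OF tendsto_const tendsto_divide_0[OF tendsto_const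
        filterlim_compose[OF filterlim_at_top_imp_at_infinity[OF sqrt_at_top] filterlim_real_sequentially]], of \<sigma>2 "3 * C"]
      by simp
    show "\<exists>N. \<forall>n\<ge>N. 0 \<le> \<sigma>2 + 3 * C / sqrt (real n)"
    proof (intro exI[of _ 1] allI impI)
      fix n :: nat assume n: "n \<ge> 1"
      have "0 \<le> real n * \<sigma>2 + 3 * C * sqrt (real n)" using \<sigma>2[OF n] var_nonneg[of n] by simp
      also have "\<dots> = real n * (\<sigma>2 + 3 * C / sqrt (real n))" using n by (simp add: field_simps)
      finally show "0 \<le> \<sigma>2 + 3 * C / sqrt (real n)" using n by (simp add: zero_le_mult_iff)
    qed
  qed
  moreover have "\<exists>C\<ge>0. \<forall>n\<ge>1. \<bar>var n - real n * \<sigma>2\<bar> \<le> C * sqrt (real n)"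
    using \<sigma>2 C(1) by (intro exI[of _ "3 * C"]) (auto simp: mult.assoc)
  ultimately show ?thesis by blast
qed

end

section \<open>Characteristic functions and the central limit theorem\<close>

text \<open>The true first-order term is \<open>\<i> y iexp x\<close>. Replacing it by
  \<open>\<i> y\<close> costs \<open>\<bar>x y\<bar>\<close>, but the integral of
  \<open>\<i> y\<close> vanishes for centred \<open>y\<close>, whatever its dependence on
  \<open>x\<close>.\<close>

lemma cmod_iexp_add_le: "cmod (iexp (x + y) - iexp x - \<i> * y) \<le> y\<^sup>2 / 2 + \<bar>x * y\<bar>"
proof -
  have "iexp (x + y) - iexp x - \<i> * y = iexp x * (iexp y - (1 + \<i> * y)) + (iexp x - 1) * (\<i> * y)"
    by (simp add: distrib_left exp_add algebra_simps)
  then have "cmod (iexp (x + y) - iexp x - \<i> * y)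
    \<le> cmod (iexp x * (iexp y - (1 + \<i> * y))) + cmod ((iexp x - 1) * (\<i> * y))"
    by (metis norm_triangle_ineq)
  also have "\<dots> = cmod (iexp y - (1 + \<i> * y)) + cmod (iexp x - 1) * \<bar>y\<bar>"
    by (simp add: norm_mult)
  also have "cmod (iexp y - (1 + \<i> * y)) \<le> y\<^sup>2 / 2"
    using iexp_approx1[of y 1] by (simp add: power2_eq_square)
  also have "cmod (iexp x - 1) \<le> \<bar>x\<bar>"
    using iexp_approx1[of x 0] by simp
  finally show ?thesis by (simp add: abs_mult mult_right_mono)
qed

lemma abs_exp_minus_le:
  fixes x :: real assumes "x \<ge> 0" shows "\<bar>exp (- x) - (1 - x)\<bar> \<le> x\<^sup>2"
proof -
  have "exp (- x) \<le> 1 / (1 + x)"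
    using assms exp_ge_add_one_self[of x] by (simp add: exp_minus field_simps)
  also have "\<dots> \<le> 1 - x + x\<^sup>2"
  proof -
    have "(1 - x + x\<^sup>2) * (1 + x) = 1 + x ^ 3" by (simp add: algebra_simps power2_eq_square power3_eq_cube)
    then show ?thesis using assms by (simp add: divide_le_eq)
  qed
  finally show ?thesis using exp_ge_add_one_self[of "- x"] by simp
qed

context quasi_additive begin

lemma integrable_iexp_pmf: "integrable (measure_pmf M) (\<lambda>x. iexp (f x))"
  by (intro measure_pmf.integrable_const_bound[of _ 1]) auto

lemma norm_chf: "norm (chf n s) \<le> 1"
proof -
  have "norm (chf n s) \<le> (\<integral>x. norm (iexp (s * (Q x - mean n))) \<partial>mu n)"
    unfolding chf_def by (rule integral_norm_bound)
  then show ?thesis by simp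
qed

lemma chf_add:
  assumes "c > 0"
  shows "norm (chf (m + n) s - chf m s * chf n s) \<le> s\<^sup>2 * ((var m + var n) / (2 * c) + c * B / 2 + B / 2)"
proof -
  let ?t = "\<lambda>z. iexp (s * (ctr m n z + rem m n z)) - iexp (s * ctr m n z) - \<i> * complex_of_real (s * rem m n z)"
  have i1: "integrable (pr m n) (\<lambda>z. iexp (s * (ctr m n z + rem m n z)))"
    "integrable (pr m n) (\<lambda>z. iexp (s * ctr m n z))" by (rule integrable_iexp_pmf)+
  have "integrable (pr m n) (rem m n)" by (rule integrable_square_imp[OF integrable_rem_square])
  then have i2: "integrable (pr m n) (\<lambda>z. \<i> * complex_of_real (s * rem m n z))"
    by simp
  have e1: "chf (m + n) s = (\<integral>z. iexp (s * (ctr m n z + rem m n z)) \<partial>pr m n)"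
    unfolding chf_def integral_conv_pair ctr_plus_rem ..
  have e2: "chf m s * chf n s = (\<integral>z. iexp (s * ctr m n z) \<partial>pr m n)"
    unfolding chf_def ctr_def
    by (subst integral_pair_pmf_mult(2)[OF integrable_iexp_pmf integrable_iexp_pmf, symmetric])
       (simp add: distrib_left exp_add)
  have e3: "(\<integral>z. \<i> * complex_of_real (s * rem m n z) \<partial>pr m n) = 0"
    using mean_rem[of m n] by simp
  have eq: "chf (m + n) s - chf m s * chf n s
    = (\<integral>z. ?t z \<partial>pr m n)"
    by (subst Bochner_Integration.integral_diff[OF Bochner_Integration.integrable_diff[OF i1] i2],
        subst Bochner_Integration.integral_diff[OF i1]) (simp only: e1 e2 e3 diff_zero)
  have "norm (chf (m + n) s - chf m s * chf n s) \<le> (\<integral>z. norm (?t z) \<partial>pr m n)"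
    unfolding eq by (rule integral_norm_bound)
  also have "\<dots> \<le> (\<integral>z. s\<^sup>2 * ((rem m n z)\<^sup>2 / 2 + \<bar>ctr m n z * rem m n z\<bar>) \<partial>pr m n)"
  proof (rule integral_mono)
    show "integrable (pr m n) (\<lambda>z. norm (?t z))"
      using i1 i2 by (intro integrable_norm Bochner_Integration.integrable_diff)
    show "integrable (pr m n) (\<lambda>z. s\<^sup>2 * ((rem m n z)\<^sup>2 / 2 + \<bar>ctr m n z * rem m n z\<bar>))"
      using integrable_rem_square[of m n] expectation_abs_ctr_rem(2)[OF assms, of m n] by simp
    fix z
    have "norm (?t z)
      \<le> (s * rem m n z)\<^sup>2 / 2 + \<bar>(s * ctr m n z) * (s * rem m n z)\<bar>"
      unfolding distrib_left[of s] by (rule cmod_iexp_add_le)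
    also have "\<dots> = s\<^sup>2 * ((rem m n z)\<^sup>2 / 2 + \<bar>ctr m n z * rem m n z\<bar>)"
      by (simp add: power_mult_distrib abs_mult algebra_simps power2_eq_square)
    finally show "norm (?t z)
      \<le> s\<^sup>2 * ((rem m n z)\<^sup>2 / 2 + \<bar>ctr m n z * rem m n z\<bar>)" .
  qed
  also have "\<dots> = s\<^sup>2 * ((\<integral>z. (rem m n z)\<^sup>2 \<partial>pr m n) / 2 + (\<integral>z. \<bar>ctr m n z * rem m n z\<bar> \<partial>pr m n))"
    using integrable_rem_square[of m n] expectation_abs_ctr_rem(2)[OF assms, of m n] by simp
  also have "\<dots> \<le> s\<^sup>2 * ((var m + var n) / (2 * c) + c * B / 2 + B / 2)"
  proof -
    have "(\<integral>z. \<bar>ctr m n z * rem m n z\<bar> \<partial>pr m n) \<le> ((var m + var n) / c + c * B) / 2"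
      using expectation_abs_ctr_rem(1)[OF assms, of m n] by simp
    moreover have "((var m + var n) / c + c * B) / 2 = (var m + var n) / (2 * c) + c * B / 2"
      by (simp add: add_divide_distrib)
    ultimately show ?thesis using expectation_rem_square[of m n] by (intro mult_left_mono) auto
  qed
  finally show ?thesis .
qed

lemma chf_add_sqrt:
  "\<exists>C\<ge>0. \<forall>m\<ge>1. \<forall>n\<ge>1. \<forall>s. norm (chf (m + n) s - chf m s * chf n s) \<le> s\<^sup>2 * (C * sqrt (real (m + n)))"
proof -
  obtain A where A: "A > 0" "\<And>n. n \<ge> 1 \<Longrightarrow> var n \<le> A * real n" using var_linear by blast
  have "norm (chf (m + n) s - chf m s * chf n s) \<le> s\<^sup>2 * ((A + B) * sqrt (real (m + n)))"
    if mn: "m \<ge> 1" "n \<ge> 1" for m n s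
  proof -
    define r where "r = sqrt (real (m + n))"
    have r: "r \<ge> 1" "r * r = real (m + n)" using mn by (auto simp: r_def)
    have "var m + var n \<le> A * (r * r)" using A(2)[OF mn(1)] A(2)[OF mn(2)] by (simp add: r(2) algebra_simps)
    then have "(var m + var n) / (2 * r) \<le> A * r / 2" using r(1) by (simp add: divide_le_eq mult.assoc)
    moreover have "B \<le> B * r" using B_nonneg r(1) by (simp add: mult_le_cancel_left1)
    moreover have "A * r / 2 \<le> A * r" using A(1) r(1) by simp
    moreover have "r * B / 2 = B * r / 2" by simp
    ultimately have "(var m + var n) / (2 * r) + r * B / 2 + B / 2 \<le> (A + B) * r"
      unfolding distrib_right by linarith
    then have "s\<^sup>2 * ((var m + var n) / (2 * r) + r * B / 2 + B / 2) \<le> s\<^sup>2 * ((A + B) * r)"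
      by (intro mult_left_mono) auto
    then show ?thesis using chf_add[of r m n s] r(1) unfolding r_def by linarith
  qed
  then show ?thesis using A(1) B_nonneg by (intro exI[of _ "A + B"]) auto
qed

text \<open>With second moments alone, the Taylor remainder is made small by dominated convergence
  of \<open>min (6 X\<^sup>2) (\<bar>s\<bar> \<bar>X\<bar>^3)\<close>. The radius depends on
  \<open>n\<close>, which is harmless for the finitely many lengths in [m, 2m).\<close>

lemma chf_small:
  "\<exists>\<delta>>0. \<forall>s. \<bar>s\<bar> < \<delta> \<longrightarrow> norm (chf n s - (1 - s\<^sup>2 * var n / 2)) \<le> s\<^sup>2"
proof -
  define X where "X x = Q x - mean n" for x
  have X2: "integrable (mu n) (\<lambda>x. (X x)\<^sup>2)"
    unfolding X_def by (rule integrable_square_diff_const[OF integrable_square])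
  have X1: "integrable (mu n) X" by (rule integrable_square_imp[OF X2])
  have EX: "(\<integral>x. X x \<partial>mu n) = 0"
    using integrable_Q by (simp add: X_def mean_def)
  let ?h = "\<lambda>s x. min (6 * (X x)\<^sup>2) (\<bar>s\<bar> * \<bar>X x\<bar> ^ 3)"
  have bound: "norm (chf n s - (1 - s\<^sup>2 * var n / 2)) \<le> s\<^sup>2 / 6 * (\<integral>x. ?h s x \<partial>mu n)" for s
  proof -
    have "chf n s = char (distr (mu n) borel X) s"
      by (simp add: chf_def char_def integral_distr X_def)
    then show ?thesis
      using prob_space.char_approx3'[OF prob_space_measure_pmf, of X "conv_power \<nu> n" "var n" "distr (mu n) borel X" s] X1 X2 EX
      by (simp add: var_def X_def)
  qed
  have ih: "integrable (mu n) (?h s)" for s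
    using X2 by (rule Bochner_Integration.integrable_bound[OF integrable_mult_right[of 6]]) auto
  have "(\<lambda>k. \<integral>x. ?h (1 / real (Suc k)) x \<partial>mu n) \<longlonglongrightarrow> (\<integral>x. 0 \<partial>mu n)"
  proof (rule integral_dominated_convergence[where w = "\<lambda>x. 6 * (X x)\<^sup>2"])
    show "AE x in mu n. (\<lambda>k. ?h (1 / real (Suc k)) x) \<longlonglongrightarrow> 0"
    proof (rule AE_I2)
      fix x
      have "(\<lambda>k. min (6 * (X x)\<^sup>2) (\<bar>1 / real (Suc k)\<bar> * \<bar>X x\<bar> ^ 3)) \<longlonglongrightarrow> min (6 * (X x)\<^sup>2) (\<bar>0\<bar> * \<bar>X x\<bar> ^ 3)"
        by (intro tendsto_min tendsto_const tendsto_mult tendsto_rabs LIMSEQ_Suc[OF lim_1_over_n])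
      then show "(\<lambda>k. ?h (1 / real (Suc k)) x) \<longlonglongrightarrow> 0" by (simp add: min_absorb2)
    qed
  qed (use X2 in auto)
  then have lim: "(\<lambda>k. \<integral>x. ?h (1 / real (Suc k)) x \<partial>mu n) \<longlonglongrightarrow> (0 :: real)" by simp
  have "\<forall>\<^sub>F k in sequentially. (\<integral>x. ?h (1 / real (Suc k)) x \<partial>mu n) < (6 :: real)"
    by (rule order_tendstoD(2)[OF lim]) simp
  then obtain k where k: "(\<integral>x. ?h (1 / real (Suc k)) x \<partial>mu n) < 6"
    using eventually_happens'[OF sequentially_bot] by blast
  have "norm (chf n s - (1 - s\<^sup>2 * var n / 2)) \<le> s\<^sup>2" if "\<bar>s\<bar> < 1 / real (Suc k)" for s
  proof -
    \<comment> \<open>The integrand is monotone in \<open>\<bar>s\<bar>\<close>, so one sample point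
      of the sequence serves all smaller \<open>s\<close>.\<close>
    have "(\<integral>x. ?h s x \<partial>mu n) \<le> (\<integral>x. ?h (1 / real (Suc k)) x \<partial>mu n)"
      using that by (intro integral_mono ih min.mono mult_right_mono) auto
    then have "s\<^sup>2 / 6 * (\<integral>x. ?h s x \<partial>mu n) \<le> s\<^sup>2 / 6 * 6" using k by (intro mult_left_mono) auto
    then show ?thesis using bound[of s] by simp
  qed
  then show ?thesis by (intro exI[of _ "1 / real (Suc k)"]) auto
qed

text \<open>\<open>K\<close> does not depend on \<open>m\<close>, but the radius does. For s of
  order 1 / sqrt n the error is of order 1 / sqrt m for all large n, so \<open>m\<close> can be
  fixed before n tends to infinity.\<close>

lemma chf_gauss:
  assumes \<sigma>2: "\<sigma>2 \<ge> 0" and var: "\<And>n. n \<ge> 1 \<Longrightarrow> \<bar>var n - real n * \<sigma>2\<bar> \<le> C1 * sqrt (real n)"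
  shows "\<exists>K\<ge>0. \<forall>m\<ge>1. \<exists>\<delta>>0. \<forall>s. \<bar>s\<bar> < \<delta> \<longrightarrow> (\<forall>n\<ge>m.
    norm (chf n s - complex_of_real (exp (- (\<sigma>2 * real n * s\<^sup>2 / 2)))) \<le> s\<^sup>2 * (K * real n / sqrt (real m)))"
proof -
  obtain C where C: "C \<ge> 0" "\<And>m n s. m \<ge> 1 \<Longrightarrow> n \<ge> 1 \<Longrightarrow>
      norm (chf (m + n) s - chf m s * chf n s) \<le> s\<^sup>2 * (C * sqrt (real (m + n)))"
    using chf_add_sqrt by blast
  have C1: "C1 \<ge> 0" using var[of 1] by simp
  \<comment> \<open>2 for the two Taylor errors on a block, \<open>C1\<close> for the error of its
    variance, and \<open>4 C\<close> to afford the negative term of \<open>?E\<close>.\<close>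
  define K where "K = 2 + C1 + 4 * C"
  define G where "G n s = complex_of_real (exp (- (\<sigma>2 * real n * s\<^sup>2 / 2)))" for n s
  have normG: "norm (G n s) \<le> 1" for n s using \<sigma>2 by (simp add: G_def)
  have Gadd: "G (a + b) s = G a s * G b s" for a b s
    by (simp add: G_def exp_add[symmetric] algebra_simps add_divide_distrib flip: of_real_mult)
  have "\<exists>\<delta>>0. \<forall>s. \<bar>s\<bar> < \<delta> \<longrightarrow> (\<forall>n\<ge>m. norm (chf n s - G n s) \<le> s\<^sup>2 * (K * real n / sqrt (real m)))"
    if m: "m \<ge> 1" for m
  proof -
    define \<alpha> where "\<alpha> = K / sqrt (real m)"
    \<comment> \<open>The negative term closes the induction: by \<open>sqrt_balanced\<close> the
      two parts contribute at least \<open>5 C sqrt (a + b)\<close>, enough for the error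
      \<open>C sqrt (a + b)\<close> of the split and for the new negative term.\<close>
    let ?E = "\<lambda>n s. s\<^sup>2 * (\<alpha> * real n - 4 * C * sqrt (real n))"
    obtain d where d: "\<And>n. d n > 0" "\<And>n s. \<bar>s\<bar> < d n \<Longrightarrow> norm (chf n s - (1 - s\<^sup>2 * var n / 2)) \<le> s\<^sup>2"
      using chf_small by metis
    \<comment> \<open>Besides the radii of the blocks, the first entry ensures
      \<open>\<sigma>2 n \<bar>s\<bar> \<le> 1\<close> for n < 2m, so the quadratic error of the
      exponential is at most \<open>s\<^sup>2\<close>. Its \<open>+ 1\<close> covers
      \<open>\<sigma>2 = 0\<close>.\<close>
    define \<delta> where "\<delta> = Min (insert (1 / (\<sigma>2 * (2 * real m) + 1)) (d ` {m..<2*m}))"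
    have \<delta>: "\<delta> > 0" unfolding \<delta>_def using d(1) \<sigma>2 by (subst Min_gr_iff) (auto intro!: add_nonneg_pos)
    have "norm (chf n s - G n s) \<le> ?E n s"
      if s: "\<bar>s\<bar> < \<delta>" and n: "n \<ge> m" for s n
    proof (rule balanced_induct[OF m n])
      fix n assume n: "m \<le> n" "n < 2 * m"
      have sd: "\<bar>s\<bar> < d n" "\<bar>s\<bar> < 1 / (\<sigma>2 * (2 * real m) + 1)"
        using s n unfolding \<delta>_def by (auto simp: Min_gr_iff)
      define x where "x = \<sigma>2 * real n * s\<^sup>2 / 2"
      have x0: "x \<ge> 0" using \<sigma>2 by (simp add: x_def)
      have "\<bar>s\<bar> * (\<sigma>2 * (2 * real m) + 1) \<le> 1"
        using sd(2) \<sigma>2 by (simp add: pos_less_divide_eq add_nonneg_pos less_imp_le)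
      moreover have "\<sigma>2 * real n \<le> \<sigma>2 * (2 * real m) + 1"
        using n \<sigma>2 mult_left_mono[of "real n" "2 * real m" \<sigma>2] by simp
      ultimately have sx: "\<bar>s\<bar> * (\<sigma>2 * real n) \<le> 1"
        by (meson abs_ge_zero mult_left_mono order_trans)
      have "x\<^sup>2 \<le> s\<^sup>2"
      proof (rule power_mono[of x "\<bar>s\<bar>" 2, simplified])
        have "x = \<bar>s\<bar> * (\<bar>s\<bar> * (\<sigma>2 * real n)) / 2"
          by (simp add: x_def power2_eq_square flip: abs_mult)
        also have "\<dots> \<le> \<bar>s\<bar> * 1 / 2" using sx by (intro divide_right_mono mult_left_mono) auto
        finally show "x \<le> \<bar>s\<bar>" by simp
      qed (rule x0)
      then have "\<bar>exp (- x) - (1 - x)\<bar> \<le> s\<^sup>2" using abs_exp_minus_le[OF x0] by simp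
      then have 1: "norm (complex_of_real (1 - x) - G n s) \<le> s\<^sup>2"
        unfolding G_def x_def[symmetric] of_real_diff[symmetric] norm_of_real by (simp add: abs_minus_commute)
      let ?u = "complex_of_real (1 - s\<^sup>2 * var n / 2)" and ?v = "complex_of_real (1 - x)"
      have "norm (?u - ?v) = s\<^sup>2 / 2 * \<bar>var n - real n * \<sigma>2\<bar>"
      proof -
        have "(1 - s\<^sup>2 * var n / 2) - (1 - x) = s\<^sup>2 / 2 * (real n * \<sigma>2 - var n)"
          by (simp add: x_def algebra_simps)
        then show ?thesis unfolding of_real_diff[symmetric] norm_of_real
          by (simp only: abs_mult) (simp add: abs_minus_commute)
      qed
      also have "\<dots> \<le> s\<^sup>2 / 2 * (C1 * sqrt (real n))"
        using var[of n] n m by (intro mult_left_mono) auto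
      also have "\<dots> \<le> s\<^sup>2 * (C1 * sqrt (real n))" using C1 by simp
      finally have 2: "norm (?u - ?v) \<le> s\<^sup>2 * (C1 * sqrt (real n))" .
      have 3: "norm (chf n s - ?u) \<le> s\<^sup>2" using d(2)[OF sd(1)] by simp
      have "norm (chf n s - G n s) \<le> s\<^sup>2 + s\<^sup>2 * (C1 * sqrt (real n)) + s\<^sup>2"
      proof -
        have tri: "norm (u - z) \<le> norm (u - v) + norm (v - w) + norm (w - z)" for u v w z :: complex
          using norm_triangle_ineq[of "u - v" "v - w"] norm_triangle_ineq[of "u - w" "w - z"] by simp
        show ?thesis
          by (rule order_trans[OF tri add_mono[OF add_mono[OF 3 2] 1]])
      qed
      also have "\<dots> = s\<^sup>2 * (2 + C1 * sqrt (real n))" by (simp add: algebra_simps)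
      also have "\<dots> \<le> ?E n s"
      proof (rule mult_left_mono)
        have "sqrt (real n) * sqrt (real m) \<le> sqrt (real n) * sqrt (real n)"
          using n by (intro mult_left_mono) auto
        then have "K * (sqrt (real n) * sqrt (real m)) \<le> K * real n"
          using C1 C(1) by (intro mult_left_mono) (auto simp: K_def)
        then have "K * sqrt (real n) \<le> \<alpha> * real n"
          using m by (simp add: \<alpha>_def field_simps)
        moreover have "2 \<le> 2 * sqrt (real n)" using n m by simp
        moreover have "K * sqrt (real n) = 2 * sqrt (real n) + C1 * sqrt (real n) + 4 * C * sqrt (real n)"
          by (simp add: K_def algebra_simps)
        ultimately show "2 + C1 * sqrt (real n) \<le> \<alpha> * real n - 4 * C * sqrt (real n)"
          by linarith
      qed simp
      finally show "norm (chf n s - G n s) \<le> ?E n s" .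
    next
      fix a b :: nat
      assume a: "a \<ge> m" and b: "b = a \<or> b = Suc a"
        and A: "norm (chf a s - G a s) \<le> ?E a s"
        and B: "norm (chf b s - G b s) \<le> ?E b s"
      have ab: "a \<ge> 1" "b \<ge> 1" using a b m by auto
      \<comment> \<open>The difference of the two products telescopes, and all factors have norm at
        most 1.\<close>
      have "chf (a + b) s - G (a + b) s = (chf (a + b) s - chf a s * chf b s)
          + ((chf a s - G a s) * chf b s + G a s * (chf b s - G b s))"
        by (simp add: Gadd algebra_simps)
      then have "norm (chf (a + b) s - G (a + b) s) \<le> norm (chf (a + b) s - chf a s * chf b s)
          + (norm ((chf a s - G a s) * chf b s) + norm (G a s * (chf b s - G b s)))"
        using norm_triangle_ineq[of "chf (a + b) s - chf a s * chf b s" "(chf a s - G a s) * chf b s + G a s * (chf b s - G b s)"]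
          norm_triangle_ineq[of "(chf a s - G a s) * chf b s" "G a s * (chf b s - G b s)"] by (simp only:)
      also have "norm ((chf a s - G a s) * chf b s) \<le> norm (chf a s - G a s)"
        unfolding norm_mult using norm_chf by (intro mult_left_le) auto
      also have "norm (G a s * (chf b s - G b s)) \<le> norm (chf b s - G b s)"
        unfolding norm_mult using normG by (intro mult_left_le_one_le) auto
      also note C(2)[OF ab] also note A also note B
      finally have "norm (chf (a + b) s - G (a + b) s) \<le> s\<^sup>2 * (C * sqrt (real (a + b)))
        + (?E a s + ?E b s)" by simp
      also have "\<dots> = s\<^sup>2 * (\<alpha> * real (a + b) - C * (4 * (sqrt (real a) + sqrt (real b))) + C * sqrt (real (a + b)))"
        by (simp add: algebra_simps)
      also have "\<dots> \<le> s\<^sup>2 * (\<alpha> * real (a + b) - C * (5 * sqrt (real (a + b))) + C * sqrt (real (a + b)))"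
        using mult_left_mono[OF sqrt_balanced[OF ab(1) b] C(1)] by (intro mult_left_mono) auto
      also have "\<dots> = ?E (a + b) s"
        by (simp add: algebra_simps)
      finally show "norm (chf (a + b) s - G (a + b) s) \<le> ?E (a + b) s" .
    qed
    moreover have "?E n s \<le> s\<^sup>2 * (K * real n / sqrt (real m))" for s n
      using C(1) by (intro mult_left_mono) (auto simp: \<alpha>_def)
    ultimately have "\<bar>s\<bar> < \<delta> \<Longrightarrow> n \<ge> m \<Longrightarrow> norm (chf n s - G n s) \<le> s\<^sup>2 * (K * real n / sqrt (real m))" for s n
      by (rule order_trans)
    then show ?thesis using \<delta> by blast
  qed
  moreover have "K \<ge> 0" using C1 C(1) by (simp add: K_def)
  ultimately show ?thesis unfolding G_def by blast
qed

end

abbreviation std_normal_cdf :: "real \<Rightarrow> real" where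
  "std_normal_cdf t \<equiv> 1 / sqrt (2 * pi) * (LBINT x:{..t}. exp (- (x\<^sup>2) / 2))"

context quasi_additive begin

lemma clt:
  assumes \<sigma>: "\<sigma> > 0" and var: "\<And>n. n \<ge> 1 \<Longrightarrow> \<bar>var n - real n * \<sigma>\<^sup>2\<bar> \<le> C1 * sqrt (real n)"
    and mean: "\<And>n. n \<ge> 1 \<Longrightarrow> \<bar>mean n - real n * \<gamma>\<bar> \<le> D"
  shows "(\<lambda>n. measure (mu n) {x. (Q x - real n * \<gamma>) / (\<sigma> * sqrt (real n)) < t})
    \<longlonglongrightarrow> std_normal_cdf t"
proof -
  define Z where "Z n x = (Q x - real n * \<gamma>) / (\<sigma> * sqrt (real n))" for n x
  let ?M = "\<lambda>n. distr (mu n) borel (Z n)"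
  have "weak_conv_m ?M std_normal_distribution"
  proof (rule levy_continuity)
    show "real_distribution (?M n)" for n
      by (rule prob_space.real_distribution_distr[OF prob_space_measure_pmf]) simp
    fix u :: real
    obtain K where K: "K \<ge> 0" "\<And>m. m \<ge> 1 \<Longrightarrow> \<exists>\<delta>>0. \<forall>s. \<bar>s\<bar> < \<delta> \<longrightarrow> (\<forall>n\<ge>m.
      norm (chf n s - complex_of_real (exp (- (\<sigma>\<^sup>2 * real n * s\<^sup>2 / 2)))) \<le> s\<^sup>2 * (K * real n / sqrt (real m)))"
      using chf_gauss[of "\<sigma>\<^sup>2" C1] var by auto
    \<comment> \<open>At this scale \<open>n (s n)\<^sup>2\<close> is the constant
      \<open>u\<^sup>2 / \<sigma>\<^sup>2\<close>.\<close>
    define s where "s n = u / (\<sigma> * sqrt (real n))" for n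
    have s0: "s \<longlonglongrightarrow> 0"
      unfolding s_def using \<sigma>
      by (intro tendsto_divide_0[OF tendsto_const] filterlim_at_top_imp_at_infinity
          filterlim_tendsto_pos_mult_at_top[OF tendsto_const]
          filterlim_compose[OF sqrt_at_top filterlim_real_sequentially])
    have s2: "real n * (s n)\<^sup>2 = u\<^sup>2 / \<sigma>\<^sup>2" if "n \<ge> 1" for n
      using that \<sigma> by (simp add: s_def power_divide power_mult_distrib)
    have lim: "(\<lambda>n. chf n (s n)) \<longlonglongrightarrow> complex_of_real (exp (- (u\<^sup>2 / 2)))"
    proof (rule metric_LIMSEQ_I)
      fix e :: real assume e: "e > 0"
      have "(\<lambda>m. u\<^sup>2 / \<sigma>\<^sup>2 * K / sqrt (real m)) \<longlonglongrightarrow> 0"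
        by (intro tendsto_divide_0[OF tendsto_const] filterlim_at_top_imp_at_infinity
            filterlim_compose[OF sqrt_at_top filterlim_real_sequentially])
      then have "\<forall>\<^sub>F m in sequentially. u\<^sup>2 / \<sigma>\<^sup>2 * K / sqrt (real m) < e"
        using e by (rule order_tendstoD(2))
      then obtain m0 where m0: "\<And>m. m \<ge> m0 \<Longrightarrow> u\<^sup>2 / \<sigma>\<^sup>2 * K / sqrt (real m) < e"
        unfolding eventually_sequentially by blast
      have m: "u\<^sup>2 / \<sigma>\<^sup>2 * K / sqrt (real (Suc m0)) < e" by (rule m0) simp
      obtain \<delta> where \<delta>: "\<delta> > 0" "\<And>s n. \<bar>s\<bar> < \<delta> \<Longrightarrow> n \<ge> Suc m0 \<Longrightarrow>
        norm (chf n s - complex_of_real (exp (- (\<sigma>\<^sup>2 * real n * s\<^sup>2 / 2)))) \<le> s\<^sup>2 * (K * real n / sqrt (real (Suc m0)))"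
        using K(2)[of "Suc m0"] by auto
      obtain n0 where n0: "\<And>n. n \<ge> n0 \<Longrightarrow> \<bar>s n\<bar> < \<delta>"
        using metric_LIMSEQ_D[OF s0 \<delta>(1)] by auto
      show "\<exists>no. \<forall>n\<ge>no. dist (chf n (s n)) (complex_of_real (exp (- (u\<^sup>2 / 2)))) < e"
      proof (intro exI[of _ "max n0 (Suc m0)"] allI impI)
        fix n assume n: "n \<ge> max n0 (Suc m0)"
        have "\<sigma>\<^sup>2 * real n * (s n)\<^sup>2 / 2 = u\<^sup>2 / 2"
          using s2[of n] n \<sigma> by (simp add: mult.assoc)
        then have "dist (chf n (s n)) (complex_of_real (exp (- (u\<^sup>2 / 2))))
          \<le> (s n)\<^sup>2 * (K * real n / sqrt (real (Suc m0)))"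
          using \<delta>(2)[OF n0, of n n] n by (simp add: dist_norm)
        also have "\<dots> = (real n * (s n)\<^sup>2) * K / sqrt (real (Suc m0))" by simp
        also have "\<dots> < e" using m s2[of n] n by simp
        finally show "dist (chf n (s n)) (complex_of_real (exp (- (u\<^sup>2 / 2)))) < e" .
      qed
    qed
    \<comment> \<open>Centring at \<open>n \<gamma>\<close> instead of the mean adds a phase that
      tends to 1, as the two differ by a bounded amount.\<close>
    have ph: "(\<lambda>n. iexp (s n * (mean n - real n * \<gamma>))) \<longlonglongrightarrow> iexp 0"
    proof (rule isCont_tendsto_compose[OF isCont_iexp])
      show "(\<lambda>n. s n * (mean n - real n * \<gamma>)) \<longlonglongrightarrow> 0"
      proof (rule Lim_null_comparison)
        show "\<forall>\<^sub>F n in sequentially. norm (s n * (mean n - real n * \<gamma>)) \<le> \<bar>s n\<bar> * D"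
          using eventually_ge_at_top[of 1]
          by eventually_elim (auto simp: abs_mult intro!: mult_left_mono mean)
        show "(\<lambda>n. \<bar>s n\<bar> * D) \<longlonglongrightarrow> 0"
          using tendsto_mult[OF tendsto_rabs[OF s0] tendsto_const[of D]] by simp
      qed
    qed
    have "char (?M n) u = iexp (s n * (mean n - real n * \<gamma>)) * chf n (s n)" for n
    proof -
      have "char (?M n) u = (\<integral>x. iexp (u * Z n x) \<partial>mu n)"
        by (simp add: char_def integral_distr)
      also have "\<dots> = (\<integral>x. iexp (s n * (mean n - real n * \<gamma>)) * iexp (s n * (Q x - mean n)) \<partial>mu n)"
      proof (intro Bochner_Integration.integral_cong refl)
        fix x
        have "u * Z n x = s n * (mean n - real n * \<gamma>) + s n * (Q x - mean n)"
          by (simp add: Z_def s_def diff_divide_distrib[symmetric] add_divide_distrib[symmetric] algebra_simps)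
        then show "iexp (u * Z n x) = iexp (s n * (mean n - real n * \<gamma>)) * iexp (s n * (Q x - mean n))"
          by (simp only: of_real_add distrib_left exp_add)
      qed
      finally show ?thesis by (simp add: chf_def)
    qed
    then show "(\<lambda>n. char (?M n) u) \<longlonglongrightarrow> char std_normal_distribution u"
      using tendsto_mult[OF ph lim] by (simp add: char_std_normal_distribution)
  qed (rule real_dist_normal_dist)
  \<comment> \<open>The normal law has no atom at \<open>t\<close>, so weak convergence also gives
    the limit for the strict inequality.\<close>
  moreover have "emeasure std_normal_distribution (frontier {..<t}) = 0"
  proof -
    have "emeasure std_normal_distribution {t} = 0"
      by (subst emeasure_density) (auto simp: nn_integral_null_set)
    then show ?thesis by (simp)
  qed
  ultimately have "(\<lambda>n. measure (?M n) {..<t}) \<longlonglongrightarrow> measure std_normal_distribution {..<t}"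
    by (intro weak_conv_imp_continuity_set_conv)
       (auto intro: real_dist_normal_dist prob_space.real_distribution_distr[OF prob_space_measure_pmf])
  moreover have "measure (?M n) {..<t} = measure (mu n) {x. (Q x - real n * \<gamma>) / (\<sigma> * sqrt (real n)) < t}" for n
    by (subst measure_distr) (auto simp: Z_def vimage_def)
  moreover have "measure std_normal_distribution {..<t} = std_normal_cdf t"
  proof -
    interpret N: prob_space std_normal_distribution
      using real_dist_normal_dist by (simp add: real_distribution_def)
    have "measure std_normal_distribution {..<t} = (\<integral>x. indicator {..<t} x \<partial>std_normal_distribution)" by simp
    also have "\<dots> = (\<integral>x. std_normal_density x *\<^sub>R indicator {..<t} x \<partial>lborel)"
      by (rule integral_density) auto
    also have "\<dots> = (\<integral>x. 1 / sqrt (2 * pi) * (indicator {..t} x *\<^sub>R exp (- (x\<^sup>2) / 2)) \<partial>lborel)"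
    proof (rule integral_cong_AE)
      have "AE x in lborel. x \<noteq> t" by (rule AE_lborel_singleton)
      then show "AE x in lborel. std_normal_density x *\<^sub>R indicator {..<t} x
        = 1 / sqrt (2 * pi) * (indicator {..t} x *\<^sub>R exp (- (x\<^sup>2) / 2))"
        by eventually_elim (auto simp: std_normal_density_def split: split_indicator)
    qed auto
    also have "\<dots> = std_normal_cdf t"
      by (simp add: set_lebesgue_integral_def)
    finally show ?thesis .
  qed
  ultimately show ?thesis by simp
qed

end

section \<open>Positivity of the variance\<close>

context quasi_additive begin

text \<open>The covariance of \<open>Q\<close> with a sum of independent centred scores of \<open>N\<close> blocks grows like \<open>N\<close>,
  while the variance of that sum is at most linear in \<open>N\<close>; by Cauchy--Schwarz the variance of \<open>Q\<close>
  grows at least linearly. Below, \<open>jt N\<close> is the joint law of the product of \<open>N\<close> blocks and of their total score.\<close>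

lemma var_lower_bound:
  assumes g: "g \<in> set_pmf (conv_power \<nu> J)" and h: "h \<in> set_pmf (conv_power \<nu> J)"
    and int: "\<And>a b. integrable (pr a b) (\<lambda>z. Q (fst z * g * snd z))"
      "\<And>a b. integrable (pr a b) (\<lambda>z. Q (fst z * h * snd z))"
    and gap: "\<And>a b. (\<integral>z. Q (fst z * g * snd z) \<partial>pr a b) - (\<integral>z. Q (fst z * h * snd z) \<partial>pr a b) \<ge> 1"
  shows "\<exists>c>0. \<forall>N. var (N * J) \<ge> c * real N"
proof -
  let ?p = "conv_power \<nu> J"
  \<comment> \<open>The density that conditions a block on being \<open>y\<close>. It has mean 1, so
    the score \<theta> is centred.\<close>
  define wt where "wt y x = (if x = y then 1 / pmf ?p y else 0)" for x y
  define \<theta> where "\<theta> x = wt g x - wt h x" for x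
  have pos: "pmf ?p g > 0" "pmf ?p h > 0" using g h by (simp_all add: pmf_positive)
  define b where "b = 1 / pmf ?p g + 1 / pmf ?p h"
  have b: "b > 0" using pos by (simp add: b_def add_pos_pos)
  have \<theta>b: "\<bar>\<theta> x\<bar> \<le> b" for x using pos by (auto simp: \<theta>_def wt_def b_def)
  have Ewt: "(\<integral>x. wt y x \<partial>?p) = 1" if "pmf ?p y > 0" for y
    using that integral_measure_pmf_real[of "{y}" ?p "wt y"] by (auto simp: wt_def split: if_splits)
  have iwt: "integrable (measure_pmf ?p) (wt y)" for y
    by (rule measure_pmf.integrable_const_bound[of _ "1 / pmf ?p y"]) (auto simp: wt_def)
  have E\<theta>: "(\<integral>x. \<theta> x \<partial>?p) = 0" unfolding \<theta>_def using iwt pos Ewt by simp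
  define jt where "jt = rec_nat (return_pmf (1 :: 'a, 0 :: real))
    (\<lambda>_ W. map_pmf (\<lambda>(w, x). (fst w * x, snd w + \<theta> x)) (pair_pmf W ?p))"
  let ?V = "\<lambda>N. pair_pmf (jt N) ?p"
  have jt0: "jt 0 = return_pmf (1, 0)" by (simp add: jt_def)
  have jtS: "jt (Suc N) = map_pmf (\<lambda>(w, x). (fst w * x, snd w + \<theta> x)) (?V N)" for N
    by (simp add: jt_def)
  have fst_jt: "map_pmf fst (jt N) = conv_power \<nu> (N * J)" for N
  proof (induction N)
    case (Suc N)
    have "map_pmf fst (jt (Suc N)) = map_pmf (\<lambda>(x, y). x * y) (pair_pmf (map_pmf fst (jt N)) ?p)"
      by (simp add: jtS map_pmf_comp split_def pair_map_pmf1)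
    then show ?case by (simp add: Suc.IH add.commute[of J] conv_power_add conv_pmf_def)
  qed (simp add: jt0)
  have bd: "w \<in> set_pmf (jt N) \<Longrightarrow> \<bar>snd w\<bar> \<le> real N * b" for N w
  proof (induction N arbitrary: w)
    case (Suc N)
    then obtain v x where v: "v \<in> set_pmf (jt N)" "snd w = snd v + \<theta> x" by (auto simp: jtS)
    then show ?case using Suc.IH[OF v(1)] \<theta>b[of x] by (simp add: algebra_simps)
  qed (simp add: jt0)
  have iH: "integrable (jt N) snd" "integrable (jt N) (\<lambda>w. (snd w)\<^sup>2)" for N
  proof -
    show "integrable (jt N) snd"
      by (rule measure_pmf.integrable_const_bound[of _ "real N * b"]) (auto intro!: AE_pmfI bd)
    show "integrable (jt N) (\<lambda>w. (snd w)\<^sup>2)"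
      by (rule measure_pmf.integrable_const_bound[of _ "(real N * b)\<^sup>2"])
         (use b in \<open>auto intro!: AE_pmfI simp: abs_le_square_iff[symmetric] dest!: bd\<close>)
  qed
  have i\<theta>: "integrable (measure_pmf ?p) \<theta>" unfolding \<theta>_def using iwt by simp
  have i\<theta>2: "integrable (measure_pmf ?p) (\<lambda>x. (\<theta> x)\<^sup>2)"
    by (rule measure_pmf.integrable_const_bound[of _ "b\<^sup>2"])
       (use b \<theta>b in \<open>auto simp: abs_le_square_iff[symmetric]\<close>)
  have EH: "(\<integral>w. snd w \<partial>jt N) = 0" for N
  proof (induction N)
    case (Suc N)
    have "(\<integral>w. snd w \<partial>jt (Suc N)) = (\<integral>z. snd (fst z) + \<theta> (snd z) \<partial>?V N)"
      by (simp add: jtS split_def integral_map_pmf)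
    also have "\<dots> = (\<integral>w. snd w \<partial>jt N) + (\<integral>x. \<theta> x \<partial>?p)"
      using integrable_pair_pmf_fst[OF iH(1), of N ?p] integrable_pair_pmf_snd[OF i\<theta>, of "jt N"] by simp
    finally show ?case by (simp add: Suc.IH E\<theta>)
  qed (simp add: jt0)
  have EH2: "(\<integral>w. (snd w)\<^sup>2 \<partial>jt N) \<le> real N * b\<^sup>2" for N
  proof (induction N)
    case (Suc N)
    define f k where "f = (\<lambda>z :: ('a \<times> real) \<times> 'a. snd (fst z))" and "k = (\<lambda>z :: ('a \<times> real) \<times> 'a. \<theta> (snd z))"
    have i: "integrable (?V N) (\<lambda>z. (f z)\<^sup>2)" "integrable (?V N) (\<lambda>z. (k z)\<^sup>2)"
      "integrable (?V N) (\<lambda>z. f z * k z)"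
      unfolding f_def k_def
      by (fact integrable_pair_pmf_fst[OF iH(2)] integrable_pair_pmf_snd[OF i\<theta>2] integral_pair_pmf_mult(1)[OF iH(1) i\<theta>])+
    have "(\<integral>w. (snd w)\<^sup>2 \<partial>jt (Suc N)) = (\<integral>z. (f z)\<^sup>2 + 2 * (f z * k z) + (k z)\<^sup>2 \<partial>?V N)"
      unfolding jtS integral_map_pmf
      by (intro Bochner_Integration.integral_cong) (simp_all add: split_def f_def k_def power2_sum)
    also have "\<dots> = (\<integral>z. (f z)\<^sup>2 \<partial>?V N) + 2 * (\<integral>z. f z * k z \<partial>?V N)
      + (\<integral>z. (k z)\<^sup>2 \<partial>?V N)" using i by simp
    also have "(\<integral>z. f z * k z \<partial>?V N) = 0"
      using integral_pair_pmf_mult(2)[OF iH(1) i\<theta>, of N] by (simp add: f_def k_def E\<theta>)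
    also have "(\<integral>z. (f z)\<^sup>2 \<partial>?V N) = (\<integral>w. (snd w)\<^sup>2 \<partial>jt N)"
      unfolding f_def by (rule expectation_pair_pmf_fst)
    also have "(\<integral>z. (k z)\<^sup>2 \<partial>?V N) = (\<integral>x. (\<theta> x)\<^sup>2 \<partial>?p)"
      unfolding k_def by (rule expectation_pair_pmf_snd)
    also have "(\<integral>x. (\<theta> x)\<^sup>2 \<partial>?p) \<le> (\<integral>x. b\<^sup>2 \<partial>?p)"
      using i\<theta>2 \<theta>b b by (intro integral_mono) (auto simp: abs_le_square_iff[symmetric])
    finally show ?case using Suc.IH by (simp add: algebra_simps)
  qed (simp add: jt0)
  let ?W = "\<lambda>N k. pair_pmf (jt N) (conv_power \<nu> k)"
  let ?F = "\<lambda>N k. \<integral>z. Q (fst (fst z) * snd z) * snd (fst z) \<partial>?W N k"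
  \<comment> \<open>The tail length \<open>k\<close> is kept general: when the last block is peeled
    off, its own score contributes the gap, while for the scores of the first \<open>N\<close>
    blocks it is part of a tail of length \<open>J + k\<close>.\<close>
  have F: "?F N k \<ge> real N" for N k
  proof (induction N arbitrary: k)
    case (Suc N)
    \<comment> \<open>An independent triple: the last block, the first \<open>N\<close> blocks with
      their score, and the tail.\<close>
    define U where "U = pair_pmf ?p (?W N k)"
    have U1: "pair_pmf (jt (Suc N)) (conv_power \<nu> k)
        = map_pmf (\<lambda>z. ((fst (fst (snd z)) * fst z, snd (fst (snd z)) + \<theta> (fst z)), snd (snd z))) U"
      unfolding U_def jtS pair_pmf_def map_pmf_def bind_assoc_pmf bind_return_pmf
      by (subst bind_commute_pmf) (simp add: bind_return_pmf bind_assoc_pmf split_def)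
    have U2: "pair_pmf (jt N) (conv_power \<nu> (J + k))
        = map_pmf (\<lambda>z. (fst (snd z), fst z * snd (snd z))) U"
      unfolding U_def conv_power_add conv_pmf_def pair_pmf_def map_pmf_def bind_assoc_pmf bind_return_pmf
      by (subst (2) bind_commute_pmf) (simp add: bind_return_pmf bind_assoc_pmf split_def)
    have U3: "map_pmf (\<lambda>z. (fst (fst z), snd z)) (?W N k)
        = pair_pmf (conv_power \<nu> (N * J)) (conv_power \<nu> k)"
      using map_pair[of fst "\<lambda>x. x" "jt N" "conv_power \<nu> k"] by (simp add: fst_jt split_def)
    define q where "q = (\<lambda>z :: 'a \<times> ('a \<times> real) \<times> 'a. Q (fst (fst (snd z)) * fst z * snd (snd z)))"
    define H where "H = (\<lambda>z :: 'a \<times> ('a \<times> real) \<times> 'a. snd (fst (snd z)))"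
    have "map_pmf (\<lambda>z. fst (fst (snd z)) * fst z * snd (snd z)) U = conv_power \<nu> (N * J + (J + k))"
    proof -
      have "map_pmf (\<lambda>z. fst (fst (snd z)) * fst z * snd (snd z)) U
        = map_pmf (\<lambda>z. fst (fst z) * snd z) (pair_pmf (jt N) (conv_power \<nu> (J + k)))"
        by (simp add: U2 map_pmf_comp mult.assoc)
      also have "\<dots> = map_pmf (\<lambda>z. fst z * snd z) (pair_pmf (map_pmf fst (jt N)) (conv_power \<nu> (J + k)))"
        by (simp add: pair_map_pmf1 map_pmf_comp)
      finally show ?thesis by (simp add: fst_jt conv_power_pair)
    qed
    then have "integrable (map_pmf (\<lambda>z. fst (fst (snd z)) * fst z * snd (snd z)) U) (\<lambda>x. (Q x)\<^sup>2)"
      using integrable_square by simp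
    then have iq: "integrable U (\<lambda>z. (q z)\<^sup>2)" by (simp add: q_def integrable_map_pmf_eq)
    have iHU: "integrable U (\<lambda>z. (H z)\<^sup>2)"
      unfolding U_def H_def by (rule integrable_pair_pmf_snd[OF integrable_pair_pmf_fst[OF iH(2)]])
    have iT: "integrable U (\<lambda>z. (\<theta> (fst z))\<^sup>2)"
      unfolding U_def by (rule integrable_pair_pmf_fst[OF i\<theta>2])
    \<comment> \<open>Weighting by \<open>wt y\<close> freezes the middle block at
      \<open>y\<close>.\<close>
    have key: "(\<integral>z. q z * wt y (fst z) \<partial>U) = (\<integral>z. Q (fst z * y * snd z) \<partial>pr (N * J) k)"
      and iwtU: "integrable U (\<lambda>z. q z * wt y (fst z))"
      if y: "pmf ?p y > 0" and iy: "\<And>a b. integrable (pr a b) (\<lambda>z. Q (fst z * y * snd z))" for y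
    proof -
      have eq: "q z * wt y (fst z) = wt y (fst z) * Q (fst (fst (snd z)) * y * snd (snd z))" for z
        by (simp add: q_def wt_def)
      have iR: "integrable (?W N k) (\<lambda>z. Q (fst (fst z) * y * snd z))"
        using iy[of "N * J" k] unfolding U3[symmetric] by (simp add: integrable_map_pmf_eq)
      show "integrable U (\<lambda>z. q z * wt y (fst z))"
        unfolding eq U_def by (rule integral_pair_pmf_mult(1)[OF iwt iR])
      have "(\<integral>z. q z * wt y (fst z) \<partial>U)
          = (\<integral>z. Q (fst (fst z) * y * snd z) \<partial>?W N k)"
        unfolding eq U_def using integral_pair_pmf_mult(2)[OF iwt iR] Ewt[OF y] by simp
      also have "\<dots> = (\<integral>z. Q (fst z * y * snd z) \<partial>pr (N * J) k)"
        unfolding U3[symmetric] by (simp add: integral_map_pmf)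
      finally show "(\<integral>z. q z * wt y (fst z) \<partial>U) = (\<integral>z. Q (fst z * y * snd z) \<partial>pr (N * J) k)" .
    qed
    have "?F (Suc N) k = (\<integral>z. q z * (H z + \<theta> (fst z)) \<partial>U)"
      unfolding U1 integral_map_pmf by (simp add: q_def H_def)
    also have "\<dots> = (\<integral>z. q z * H z + (q z * wt g (fst z) - q z * wt h (fst z)) \<partial>U)"
      by (simp add: \<theta>_def algebra_simps)
    also have "\<dots> = (\<integral>z. q z * H z \<partial>U)
        + ((\<integral>z. q z * wt g (fst z) \<partial>U) - (\<integral>z. q z * wt h (fst z) \<partial>U))"
      using integrable_square_mult[OF iq iHU] iwtU[OF pos(1) int(1)] iwtU[OF pos(2) int(2)] by simp
    also have "(\<integral>z. q z * H z \<partial>U) = ?F N (J + k)"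
      unfolding U2 integral_map_pmf by (simp add: q_def H_def mult.assoc)
    finally have "?F (Suc N) k = ?F N (J + k)
      + ((\<integral>z. q z * wt g (fst z) \<partial>U) - (\<integral>z. q z * wt h (fst z) \<partial>U))" .
    then show ?case
      using Suc.IH[of "J + k"] gap[of "N * J" k] key[OF pos(1) int(1)] key[OF pos(2) int(2)] by simp
  qed (simp add: jt0 pair_return_pmf1 integral_map_pmf)
  have "var (N * J) \<ge> 1 / b\<^sup>2 * real N" for N
  proof -
    let ?e = "mean (N * J)"
    have Q2: "integrable (jt N) (\<lambda>w. (Q (fst w) - ?e)\<^sup>2)" "(\<integral>w. (Q (fst w) - ?e)\<^sup>2 \<partial>jt N) = var (N * J)"
      using integrable_square_diff_const[OF integrable_square[of "N * J"], of ?e]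
      unfolding var_def fst_jt[symmetric] by (simp_all add: integrable_map_pmf_eq integral_map_pmf)
    have iQ: "integrable (jt N) (\<lambda>w. Q (fst w) * snd w)"
      using integrable_square[of "N * J"] unfolding fst_jt[symmetric]
      by (intro integrable_square_mult iH) (simp add: integrable_map_pmf_eq)
    have "real N \<le> ?F N 0" by (rule F)
    also have "?F N 0 = (\<integral>w. Q (fst w) * snd w \<partial>jt N)"
      by (simp add: pair_return_pmf2 integral_map_pmf)
    also have "\<dots> = (\<integral>w. Q (fst w) * snd w - ?e * snd w \<partial>jt N)"
      using iQ iH(1)[of N] by (simp add: EH)
    \<comment> \<open>The total score has second moment at most \<open>N b\<^sup>2\<close>, which
      the weight \<open>1 / b\<^sup>2\<close> turns into \<open>N\<close>; from
      \<open>N \<le> (N + b\<^sup>2 var) / 2\<close> half of the left-hand side survives.\<close>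
    also have "\<dots> \<le> (\<integral>w. (1 / b\<^sup>2 * (snd w)\<^sup>2 + (Q (fst w) - ?e)\<^sup>2 / (1 / b\<^sup>2)) / 2 \<partial>jt N)"
    proof (rule integral_mono)
      show "integrable (jt N) (\<lambda>w. Q (fst w) * snd w - ?e * snd w)" using iQ iH(1)[of N] by simp
      show "integrable (jt N) (\<lambda>w. (1 / b\<^sup>2 * (snd w)\<^sup>2 + (Q (fst w) - ?e)\<^sup>2 / (1 / b\<^sup>2)) / 2)"
        using Q2(1) iH(2)[of N] by simp
      fix w
      have "2 * (Q (fst w) * snd w - ?e * snd w) \<le> 2 * \<bar>snd w * (Q (fst w) - ?e)\<bar>"
        using abs_ge_self[of "snd w * (Q (fst w) - ?e)"] by (simp add: algebra_simps)
      also have "\<dots> \<le> 1 / b\<^sup>2 * (snd w)\<^sup>2 + (Q (fst w) - ?e)\<^sup>2 / (1 / b\<^sup>2)"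
        using b by (intro two_mult_le_weighted) simp
      finally show "Q (fst w) * snd w - ?e * snd w
        \<le> (1 / b\<^sup>2 * (snd w)\<^sup>2 + (Q (fst w) - ?e)\<^sup>2 / (1 / b\<^sup>2)) / 2" by simp
    qed
    also have "\<dots> = (1 / b\<^sup>2 * (\<integral>w. (snd w)\<^sup>2 \<partial>jt N) + b\<^sup>2 * var (N * J)) / 2"
      using Q2 iH(2)[of N] by (simp add: mult.commute)
    also have "\<dots> \<le> (1 / b\<^sup>2 * (real N * b\<^sup>2) + b\<^sup>2 * var (N * J)) / 2"
      using EH2[of N] b by (intro divide_right_mono add_right_mono mult_left_mono) auto
    also have "1 / b\<^sup>2 * (real N * b\<^sup>2) = real N" using b by simp
    finally have "real N \<le> b\<^sup>2 * var (N * J)" by simp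
    then show ?thesis using b by (simp add: divide_le_eq mult.commute)
  qed
  then show ?thesis using b by (intro exI[of _ "1 / b\<^sup>2"]) auto
qed

text \<open>Two junctions give two defects: \<open>right\<close> bounds the one at
  \<open>x * g\<close>, \<open>left\<close> the other one, with \<open>x * g\<close> as fixed
  factor. Each has mean at most \<open>(B + 1) / 2\<close> in absolute value.\<close>

lemma expectation_insert:
  "integrable (pr a b) (\<lambda>z. Q (fst z * g * snd z))"
  "\<bar>(\<integral>z. Q (fst z * g * snd z) \<partial>pr a b) - mean a - mean b - Q g\<bar> \<le> B + 1"
proof -
  define d1 d2 where "d1 = (\<lambda>z :: 'a \<times> 'a. Q (fst z * g) - Q (fst z) - Q g)"
    and "d2 = (\<lambda>z :: 'a \<times> 'a. Q (fst z * g * snd z) - Q (fst z * g) - Q (snd z))"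
  have "(\<integral>\<^sup>+ z. ennreal ((d1 z)\<^sup>2) \<partial>pr a b)
    = (\<integral>\<^sup>+ x. ennreal ((Q (x * g) - Q x - Q g)\<^sup>2) \<partial>map_pmf fst (pair_pmf (conv_power \<nu> a) (conv_power \<nu> b)))"
    by (simp add: d1_def)
  also have "\<dots> \<le> ennreal B" unfolding map_fst_pair_pmf by (rule right)
  finally have "(\<integral>\<^sup>+ z. ennreal ((d1 z)\<^sup>2) \<partial>pr a b) \<le> ennreal B" .
  note d1 = square_nn_integral_bound[OF this B_nonneg]
  have "(\<integral>\<^sup>+ z. ennreal ((d2 z)\<^sup>2) \<partial>pr a b) \<le> ennreal B"
    by (rule nn_integral_pair_pmf_le) (simp add: d2_def left)
  note d2 = square_nn_integral_bound[OF this B_nonneg]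
  have i: "integrable (pr a b) (\<lambda>z. Q (fst z))" "integrable (pr a b) (\<lambda>z. Q (snd z))"
    "integrable (pr a b) d1" "integrable (pr a b) d2"
    by (fact integrable_pair_pmf_fst[OF integrable_Q] integrable_pair_pmf_snd[OF integrable_Q]
        integrable_square_imp[OF d1(1)] integrable_square_imp[OF d2(1)])+
  have eq: "Q (fst z * g * snd z) = Q (fst z) + Q (snd z) + Q g + d1 z + d2 z" for z
    by (simp add: d1_def d2_def)
  show "integrable (pr a b) (\<lambda>z. Q (fst z * g * snd z))" unfolding eq using i by simp
  have "(\<integral>z. Q (fst z * g * snd z) \<partial>pr a b) = mean a + mean b + Q g
    + (\<integral>z. d1 z \<partial>pr a b) + (\<integral>z. d2 z \<partial>pr a b)"
    unfolding eq using i by (simp add: mean_def)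
  then show "\<bar>(\<integral>z. Q (fst z * g * snd z) \<partial>pr a b) - mean a - mean b - Q g\<bar> \<le> B + 1"
    using d1(3) d2(3) by simp
qed

text \<open>Of the gap \<open>2 B + 3\<close>, the insertion errors take \<open>B + 1\<close> twice
  and leave the 1 needed for \<open>var_lower_bound\<close>. Linear growth along multiples of
  \<open>J\<close> excludes the limit 0, for which the variance would be of order sqrt n.\<close>

lemma var_limit_pos:
  assumes g: "g \<in> set_pmf (conv_power \<nu> J)" and h: "h \<in> set_pmf (conv_power \<nu> J)"
    and gap: "Q g - Q h \<ge> 2 * B + 3"
  shows "\<exists>\<sigma>>0. \<exists>C. \<forall>n\<ge>1. \<bar>var n - real n * \<sigma>\<^sup>2\<bar> \<le> C * sqrt (real n)"
proof -
  obtain \<sigma>2 C where \<sigma>2: "\<sigma>2 \<ge> 0" "C \<ge> 0" "\<And>n. n \<ge> 1 \<Longrightarrow> \<bar>var n - real n * \<sigma>2\<bar> \<le> C * sqrt (real n)"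
    using var_limit by blast
  have "(\<integral>z. Q (fst z * g * snd z) \<partial>pr a b) - (\<integral>z. Q (fst z * h * snd z) \<partial>pr a b) \<ge> 1" for a b
    using expectation_insert(2)[of a b g] expectation_insert(2)[of a b h] gap by linarith
  from var_lower_bound[OF g h expectation_insert(1) expectation_insert(1) this]
  obtain c where c: "c > 0" "\<And>N. var (N * J) \<ge> c * real N" by blast
  have J: "J \<ge> 1"
  proof (rule ccontr)
    assume "\<not> J \<ge> 1"
    then have "J = 0" by simp
    then have "g = h" using g h by simp
    then show False using gap B_nonneg by simp
  qed
  have "\<sigma>2 \<noteq> 0"
  proof
    assume "\<sigma>2 = 0"
    then have cN: "c * real N \<le> C * sqrt (real (N * J))" if "N \<ge> 1" for N
      using \<sigma>2(3)[of "N * J"] c(2)[of N] that J by simp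
    have le: "c * real N \<le> C * sqrt (real J) * sqrt (real N)" if "N \<ge> 1" for N
    proof -
      have "sqrt (real (N * J)) = sqrt (real J) * sqrt (real N)"
        by (simp add: real_sqrt_mult)
      then show ?thesis using cN[OF that] by (simp only: mult.assoc)
    qed
    obtain N :: nat where N: "real N > (C * sqrt (real J) / c)\<^sup>2" using reals_Archimedean2 by blast
    then have N1: "N \<ge> 1" by (cases N) auto
    have "C * sqrt (real J) / c < sqrt (real N)"
      using N by (rule real_less_rsqrt)
    then have "C * sqrt (real J) < c * sqrt (real N)" using c(1) by (simp add: divide_less_eq mult.commute)
    then have "C * sqrt (real J) * sqrt (real N) < c * sqrt (real N) * sqrt (real N)"
      using N1 by (intro mult_strict_right_mono) auto
    also have "c * sqrt (real N) * sqrt (real N) = c * real N" by (simp add: mult.assoc)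
    finally have "C * sqrt (real J) * sqrt (real N) < c * real N" .
    then show False using le[OF N1] by simp
  qed
  then have "sqrt \<sigma>2 > 0" "(sqrt \<sigma>2)\<^sup>2 = \<sigma>2" using \<sigma>2(1) by simp_all
  moreover have "\<exists>C. \<forall>n\<ge>1. \<bar>var n - real n * \<sigma>2\<bar> \<le> C * sqrt (real n)"
    using \<sigma>2(3) by blast
  ultimately show ?thesis by (intro exI[of _ "sqrt \<sigma>2"]) (simp only: simp_thms)
qed

end

section \<open>Law of large numbers and drift\<close>

lemma measurable_mult_count_space:
  fixes f g :: "'w \<Rightarrow> 'a :: {monoid_mult, countable}"
  assumes "f \<in> measurable M (count_space UNIV)" "g \<in> measurable M (count_space UNIV)"
  shows "(\<lambda>w. f w * g w) \<in> measurable M (count_space UNIV)"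
proof (rule measurable_compose_countable[OF _ assms(1), of "\<lambda>a w. a * g w"])
  show "(\<lambda>w. a * g w) \<in> measurable M (count_space UNIV)" for a
    by (rule measurable_compose[OF assms(2)]) simp
qed

lemma walk_0: "walk x 0 w = 1"
  by (simp add: walk_def)

lemma walk_Suc: "walk x (Suc n) w = walk x n w * x (Suc n) w"
  by (simp add: walk_def)

section \<open>Laws of the walk and of its steps\<close>

locale iid_walk = prob_space M for M :: "'w measure" +
  fixes \<nu> :: "'a :: {monoid_mult, countable} pmf" and x :: "nat \<Rightarrow> 'w \<Rightarrow> 'a"
  assumes indep: "indep_vars (\<lambda>_. count_space UNIV) x {1..}"
    and distr_x: "\<And>i. i \<ge> 1 \<Longrightarrow> distr M (count_space UNIV) (x i) = measure_pmf \<nu>"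
begin

abbreviation "CU \<equiv> count_space (UNIV :: 'a set)"

lemma measurable_x: "i \<ge> 1 \<Longrightarrow> x i \<in> measurable M (CU)"
  using indep by (auto simp: indep_vars_def)

lemma measurable_walk: "walk x n \<in> measurable M (CU)"
proof (induction n)
  case (Suc n)
  have "(\<lambda>w. walk x n w * x (Suc n) w) \<in> measurable M (CU)"
    by (intro measurable_mult_count_space Suc.IH measurable_x) simp
  then show ?case by (simp add: walk_Suc[abs_def] cong: measurable_cong)
qed (simp add: walk_0[abs_def] cong: measurable_cong)

lemma indep_walk: "indep_var (CU) (walk x n) (CU) (x (Suc n))"
proof -
  let ?N = "\<lambda>A. \<Pi>\<^sub>M i\<in>A. CU"
  have "indep_var (?N {1..n}) (\<lambda>w. restrict (\<lambda>i. x i w) {1..n}) (?N {Suc n}) (\<lambda>w. restrict (\<lambda>i. x i w) {Suc n})"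
    using indep by (rule indep_var_restrict) auto
  moreover have "(\<lambda>f. prod_list (map f [1..<n + 1])) \<in> measurable (?N {1..n}) (CU)"
  proof -
    have "k \<le> n \<Longrightarrow> (\<lambda>f. prod_list (map f [1..<k + 1])) \<in> measurable (?N {1..n}) (CU)" for k
    proof (induction k)
      case (Suc k)
      have "(\<lambda>f. prod_list (map f [1..<k + 1]) * f (Suc k)) \<in> measurable (?N {1..n}) (CU)"
        using Suc by (intro measurable_mult_count_space measurable_component_singleton) auto
      then show ?case by simp
    qed simp
    then show ?thesis by blast
  qed
  moreover have "(\<lambda>f. f (Suc n)) \<in> measurable (?N {Suc n}) (CU)"
    by (rule measurable_component_singleton) simp
  ultimately have "indep_var (CU) ((\<lambda>f. prod_list (map f [1..<n + 1])) \<circ> (\<lambda>w. restrict (\<lambda>i. x i w) {1..n}))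
      (CU) ((\<lambda>f. f (Suc n)) \<circ> (\<lambda>w. restrict (\<lambda>i. x i w) {Suc n}))"
    by (rule indep_var_compose)
  moreover have "(\<lambda>f. prod_list (map f [1..<n + 1])) \<circ> (\<lambda>w. restrict (\<lambda>i. x i w) {1..n}) = walk x n"
  proof
    fix w
    have "map (restrict (\<lambda>i. x i w) {1..n}) [1..<n + 1] = map (\<lambda>i. x i w) [1..<n + 1]"
      by (rule map_cong) auto
    then show "((\<lambda>f. prod_list (map f [1..<n + 1])) \<circ> (\<lambda>w. restrict (\<lambda>i. x i w) {1..n})) w = walk x n w"
      by (simp only: comp_def walk_def)
  qed
  moreover have "(\<lambda>f. f (Suc n)) \<circ> (\<lambda>w. restrict (\<lambda>i. x i w) {Suc n}) = x (Suc n)"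
    by (auto simp: fun_eq_iff)
  ultimately show ?thesis by simp
qed

lemma distr_walk: "distr M (CU) (walk x n) = measure_pmf (conv_power \<nu> n)"
proof (induction n)
  case 0
  have "distr M (CU) (walk x 0) = return (CU) 1"
    unfolding walk_0[abs_def] by (rule distr_const) simp
  then show ?case by (simp add: return_pmf.rep_eq)
next
  case (Suc n)
  let ?p = "conv_power \<nu> n"
  have mW: "walk x n \<in> measurable M CU" and mx: "x (Suc n) \<in> measurable M CU"
    by (simp_all add: measurable_walk measurable_x)
  have "distr M CU (walk x n) \<Otimes>\<^sub>M distr M CU (x (Suc n)) = distr M (CU \<Otimes>\<^sub>M CU) (\<lambda>w. (walk x n w, x (Suc n) w))"
    using indep_walk[of n] unfolding indep_var_distribution_eq by blast
  then have joint: "measure_pmf ?p \<Otimes>\<^sub>M measure_pmf \<nu> = distr M (CU \<Otimes>\<^sub>M CU) (\<lambda>w. (walk x n w, x (Suc n) w))"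
    using Suc.IH distr_x[of "Suc n"] by simp
  show ?case
  proof (rule measure_eqI)
    fix A assume "A \<in> sets (distr M CU (walk x (Suc n)))"
    have mm: "(\<lambda>z. fst z * snd z) \<in> measurable (CU \<Otimes>\<^sub>M CU) CU"
      by (intro measurable_mult_count_space measurable_fst measurable_snd)
    then have mi: "(\<lambda>z. indicator A (fst z * snd z) :: ennreal) \<in> borel_measurable (CU \<Otimes>\<^sub>M CU)"
      by (rule measurable_compose) simp
    have "emeasure (distr M CU (walk x (Suc n))) A = (\<integral>\<^sup>+ z. indicator A z \<partial>distr M CU (walk x (Suc n)))"
      by simp
    also have "\<dots> = (\<integral>\<^sup>+ w. indicator A (walk x n w * x (Suc n) w) \<partial>M)"
      by (subst nn_integral_distr) (auto simp: measurable_walk walk_Suc)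
    also have "\<dots> = (\<integral>\<^sup>+ z. indicator A (fst z * snd z) \<partial>distr M (CU \<Otimes>\<^sub>M CU) (\<lambda>w. (walk x n w, x (Suc n) w)))"
      by (subst nn_integral_distr) (auto intro!: measurable_Pair mW mx mi)
    also have "\<dots> = (\<integral>\<^sup>+ z. indicator A (fst z * snd z) \<partial>(measure_pmf ?p \<Otimes>\<^sub>M measure_pmf \<nu>))"
      unfolding joint ..
    also have "\<dots> = (\<integral>\<^sup>+ a. \<integral>\<^sup>+ b. indicator A (a * b) \<partial>\<nu> \<partial>?p)"
    proof (subst sigma_finite_measure.nn_integral_fst[symmetric])
      show "sigma_finite_measure (measure_pmf \<nu>)"
        by (rule prob_space_imp_sigma_finite[OF prob_space_measure_pmf])
      have "sets (measure_pmf ?p \<Otimes>\<^sub>M measure_pmf \<nu>) = sets (CU \<Otimes>\<^sub>M CU)"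
        by (rule sets_pair_measure_cong) auto
      then show "(\<lambda>z. indicator A (fst z * snd z) :: ennreal) \<in> borel_measurable (measure_pmf ?p \<Otimes>\<^sub>M measure_pmf \<nu>)"
        using mi by (simp cong: measurable_cong_sets)
    qed simp
    also have "\<dots> = emeasure (conv_power \<nu> (Suc n)) A"
      using nn_integral_conv_pmf[where f = "indicator A" and \<mu> = ?p and \<nu> = \<nu>] by simp
    finally show "emeasure (distr M CU (walk x (Suc n))) A = emeasure (conv_power \<nu> (Suc n)) A" .
  qed simp
qed

lemma measure_walk: "measure M {w \<in> space M. P (walk x n w)} = measure (conv_power \<nu> n) {g. P g}"
proof -
  have "measure (conv_power \<nu> n) {g. P g} = measure (distr M (count_space UNIV) (walk x n)) {g. P g}"
    by (simp add: distr_walk)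
  also have "\<dots> = measure M {w \<in> space M. P (walk x n w)}"
    by (subst measure_distr) (auto simp: measurable_walk vimage_def Int_def conj_commute)
  finally show ?thesis ..
qed

lemma nn_integral_walk: "(\<integral>\<^sup>+ w. f (walk x n w) \<partial>M) = (\<integral>\<^sup>+ g. f g \<partial>conv_power \<nu> n)"
  unfolding distr_walk[symmetric] by (rule nn_integral_distr[symmetric]) (auto simp: measurable_walk)

lemma nn_integral_x: "i \<ge> 1 \<Longrightarrow> (\<integral>\<^sup>+ w. f (x i w) \<partial>M) = (\<integral>\<^sup>+ g. f g \<partial>\<nu>)"
  unfolding distr_x[of i, symmetric] by (rule nn_integral_distr[symmetric]) (auto simp: measurable_x)

lemma AE_x: "AE w in M. \<forall>i\<ge>1. x i w \<in> set_pmf \<nu>"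
proof -
  have "AE w in M. x i w \<in> set_pmf \<nu>" if i: "i \<ge> 1" for i
  proof -
    have "AE g in distr M (count_space UNIV) (x i). g \<in> set_pmf \<nu>"
      unfolding distr_x[OF i] by (rule AE_measure_pmf)
    then show ?thesis by (subst (asm) AE_distr_iff) (auto simp: measurable_x[OF i])
  qed
  then show ?thesis by (subst AE_all_countable) auto
qed

end

text \<open>The series of squares has finite expectation, hence converges almost surely, and its
  terms tend to 0.\<close>

lemma AE_tendsto_0_of_square_sums:
  fixes Y :: "nat \<Rightarrow> 'w \<Rightarrow> real"
  assumes Y: "\<And>k. Y k \<in> borel_measurable M"
    and bound: "\<And>k. (\<integral>\<^sup>+ w. ennreal ((Y k w)\<^sup>2) \<partial>M) \<le> ennreal (c k)"
    and c: "summable c" "\<And>k. c k \<ge> 0"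
  shows "AE w in M. (\<lambda>k. Y k w) \<longlonglongrightarrow> 0"
proof -
  have "(\<integral>\<^sup>+ w. (\<Sum>k. ennreal ((Y k w)\<^sup>2)) \<partial>M) = (\<Sum>k. \<integral>\<^sup>+ w. ennreal ((Y k w)\<^sup>2) \<partial>M)"
    using Y by (intro nn_integral_suminf) auto
  also have "\<dots> \<le> (\<Sum>k. ennreal (c k))" by (intro suminf_le bound) auto
  also have "\<dots> = ennreal (suminf c)" using c by (intro suminf_ennreal2) auto
  also have "\<dots> < \<infinity>" by simp
  finally have "AE w in M. (\<Sum>k. ennreal ((Y k w)\<^sup>2)) \<noteq> \<infinity>"
    using Y by (intro nn_integral_PInf_AE) auto
  then show ?thesis
  proof eventually_elim
    case (elim w)
    have "summable (\<lambda>k. (Y k w)\<^sup>2)"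
      using elim by (intro summable_suminf_not_top) auto
    then have "(\<lambda>k. (Y k w)\<^sup>2) \<longlonglongrightarrow> 0" by (rule summable_LIMSEQ_zero)
    then have "(\<lambda>k. sqrt ((Y k w)\<^sup>2)) \<longlonglongrightarrow> sqrt 0" by (rule tendsto_real_sqrt)
    then show ?case by (simp add: tendsto_rabs_zero_iff)
  qed
qed

lemma ex_square_interval: "\<exists>k. k\<^sup>2 \<le> n \<and> n < (Suc k)\<^sup>2" for n :: nat
proof (induction n)
  case 0
  then show ?case by (intro exI[of _ 0]) simp
next
  case (Suc n)
  then obtain k where k: "k\<^sup>2 \<le> n" "n < (Suc k)\<^sup>2" by blast
  show ?case
  proof (cases "Suc n < (Suc k)\<^sup>2")
    case True
    then show ?thesis using k by (intro exI[of _ k]) simp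
  next
    case False
    then have "Suc n = (Suc k)\<^sup>2" using k by simp
    moreover have "(Suc k)\<^sup>2 < (Suc (Suc k))\<^sup>2" by (rule power_strict_mono) auto
    ultimately show ?thesis by (intro exI[of _ "Suc k"]) simp
  qed
qed

section \<open>Strong law by interpolation between square times\<close>

locale quasi_additive_walk = iid_walk M \<nu> x + quasi_additive \<nu> Q B
  for M :: "'w measure" and \<nu> :: "'a :: {monoid_mult, countable} pmf" and x Q B +
  assumes Q_step: "\<And>g y. y \<in> set_pmf \<nu> \<Longrightarrow> \<bar>Q (g * y) - Q g\<bar> \<le> \<bar>Q y\<bar> + 1"
begin

text \<open>The error at time n has second moment O(1/n), which is summable along squares.\<close>

lemma squares_slln:
  assumes \<gamma>: "\<forall>n\<ge>1. \<bar>mean n - real n * \<gamma>\<bar> \<le> D"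
  shows "AE w in M. (\<lambda>k. Q (walk x (k\<^sup>2) w) / real (k\<^sup>2) - \<gamma>) \<longlonglongrightarrow> 0"
proof -
  obtain A where A: "A > 0" "\<And>n. n \<ge> 1 \<Longrightarrow> var n \<le> A * real n" using var_linear by blast
  let ?c = "\<lambda>k. (A + D\<^sup>2) * inverse ((real (Suc k))\<^sup>2)"
  have "AE w in M. (\<lambda>k. Q (walk x ((Suc k)\<^sup>2) w) / real ((Suc k)\<^sup>2) - \<gamma>) \<longlonglongrightarrow> 0"
  proof (rule AE_tendsto_0_of_square_sums)
    show "(\<lambda>w. Q (walk x ((Suc k)\<^sup>2) w) / real ((Suc k)\<^sup>2) - \<gamma>) \<in> borel_measurable M" for k
      using measurable_compose[OF measurable_walk, of Q borel "(Suc k)\<^sup>2"] by simp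
    show "summable (\<lambda>k. ?c k)"
      using inverse_power_summable[of 2, where 'a = real]
      by (intro summable_mult) (simp add: summable_Suc_iff[of "\<lambda>k. inverse ((real k)\<^sup>2)"] del: of_nat_Suc)
    show "?c k \<ge> 0" for k using A(1) by simp
    fix k
    define n where "n = (Suc k)\<^sup>2"
    have n: "n \<ge> 1" "real n \<ge> 1" by (auto simp: n_def)
    let ?V = "\<integral>g. (Q g - real n * \<gamma>)\<^sup>2 \<partial>mu n"
    have i: "integrable (mu n) (\<lambda>g. Q g - mean n)" "integrable (mu n) (\<lambda>g. (Q g - mean n)\<^sup>2)"
      using integrable_Q integrable_square_diff_const[OF integrable_square] by auto
    have "?V
      = (\<integral>g. (Q g - mean n)\<^sup>2 + 2 * (mean n - real n * \<gamma>) * (Q g - mean n) + (mean n - real n * \<gamma>)\<^sup>2 \<partial>mu n)"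
      by (intro Bochner_Integration.integral_cong) (auto simp: power2_eq_square algebra_simps)
    also have "\<dots> = var n + 2 * (mean n - real n * \<gamma>) * (\<integral>g. Q g - mean n \<partial>mu n) + (mean n - real n * \<gamma>)\<^sup>2"
      using i unfolding var_def by (simp del: Bochner_Integration.integral_diff)
    also have "(\<integral>g. Q g - mean n \<partial>mu n) = 0" using integrable_Q by (simp add: mean_def)
    finally have "?V = var n + (mean n - real n * \<gamma>)\<^sup>2" by simp
    also have "(mean n - real n * \<gamma>)\<^sup>2 \<le> D\<^sup>2"
      using \<gamma>[rule_format, OF n(1)] by (simp add: abs_le_square_iff[symmetric])
    also have "var n \<le> A * real n" using A(2) n by simp
    also have "A * real n + D\<^sup>2 \<le> (A + D\<^sup>2) * real n"
      using n(2) mult_left_mono[of 1 "real n" "D\<^sup>2"] by (simp add: algebra_simps)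
    finally have le: "?V \<le> (A + D\<^sup>2) * real n" by simp
    have "(\<integral>\<^sup>+ w. ennreal ((Q (walk x n w) / real n - \<gamma>)\<^sup>2) \<partial>M) = (\<integral>\<^sup>+ g. ennreal ((Q g / real n - \<gamma>)\<^sup>2) \<partial>conv_power \<nu> n)"
      by (rule nn_integral_walk)
    also have "\<dots> = (\<integral>\<^sup>+ g. ennreal (inverse ((real n)\<^sup>2) * (Q g - real n * \<gamma>)\<^sup>2) \<partial>conv_power \<nu> n)"
      using n by (intro nn_integral_cong arg_cong[of _ _ ennreal]) (simp add: power2_eq_square field_simps)
    also have "\<dots> = ennreal (\<integral>g. inverse ((real n)\<^sup>2) * (Q g - real n * \<gamma>)\<^sup>2 \<partial>mu n)"
      by (intro nn_integral_eq_integral integrable_mult_right integrable_square_diff_const integrable_square) auto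
    also have "\<dots> \<le> ennreal (?c k)"
    proof (rule ennreal_leI)
      have "(\<integral>g. inverse ((real n)\<^sup>2) * (Q g - real n * \<gamma>)\<^sup>2 \<partial>mu n) = inverse ((real n)\<^sup>2) * ?V"
        by simp
      also have "\<dots> \<le> inverse ((real n)\<^sup>2) * ((A + D\<^sup>2) * real n)" by (intro mult_left_mono le) simp
      also have "\<dots> = (A + D\<^sup>2) * inverse (real n)" using n by (simp add: power2_eq_square field_simps)
      finally show "(\<integral>g. inverse ((real n)\<^sup>2) * (Q g - real n * \<gamma>)\<^sup>2 \<partial>mu n) \<le> ?c k"
        by (simp add: n_def)
    qed
    finally show "(\<integral>\<^sup>+ w. ennreal ((Q (walk x ((Suc k)\<^sup>2) w) / real ((Suc k)\<^sup>2) - \<gamma>)\<^sup>2) \<partial>M)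
      \<le> ennreal (?c k)" by (simp only: n_def)
  qed
  then show ?thesis
    by eventually_elim (rule LIMSEQ_imp_Suc)
qed

definition "incr k w = (\<Sum>i\<in>{k\<^sup>2<..(Suc k)\<^sup>2}. \<bar>Q (x i w)\<bar> + 1)"

text \<open>By Cauchy-Schwarz a window of 2k + 1 steps has second moment O(k^2); division by k^4
  makes it summable.\<close>

lemma incr_slln: "AE w in M. (\<lambda>k. incr k w / real (k\<^sup>2)) \<longlonglongrightarrow> 0"
proof -
  let ?b = "\<lambda>i w. \<bar>Q (x i w)\<bar> + 1"
  let ?I = "\<lambda>i. \<integral>\<^sup>+ w. ennreal ((?b i w)\<^sup>2) \<partial>M"
  define \<kappa> where "\<kappa> = (\<integral>g. (\<bar>Q g\<bar> + 1)\<^sup>2 \<partial>\<nu>)"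
  have i\<kappa>: "integrable \<nu> (\<lambda>g. (\<bar>Q g\<bar> + 1)\<^sup>2)"
    using square by (intro integrable_square_add) auto
  have \<kappa>: "\<kappa> \<ge> 0" by (simp add: \<kappa>_def)
  have "AE w in M. (\<lambda>k. incr (Suc k) w / real ((Suc k)\<^sup>2)) \<longlonglongrightarrow> 0"
  proof (rule AE_tendsto_0_of_square_sums)
    have mi: "(?b i) \<in> borel_measurable M" if "i \<ge> 1" for i
      using measurable_compose[OF measurable_x[OF that], of "\<lambda>g. \<bar>Q g\<bar> + 1" borel] by simp
    show "(\<lambda>w. incr (Suc k) w / real ((Suc k)\<^sup>2)) \<in> borel_measurable M" for k
      unfolding incr_def by (intro borel_measurable_divide borel_measurable_const borel_measurable_sum mi) auto
    show "summable (\<lambda>k. 9 * \<kappa> * inverse ((real (Suc k))\<^sup>2))"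
      using inverse_power_summable[of 2, where 'a = real]
      by (intro summable_mult) (simp add: summable_Suc_iff[of "\<lambda>k. inverse ((real k)\<^sup>2)"] del: of_nat_Suc)
    show "9 * \<kappa> * inverse ((real (Suc k))\<^sup>2) \<ge> 0" for k using \<kappa> by simp
    fix k
    define K where "K = Suc k"
    define I where "I = {K\<^sup>2<..(Suc K)\<^sup>2}"
    have cI: "card I = 2 * K + 1" by (simp add: I_def power2_eq_square)
    have I1: "i \<ge> 1" if "i \<in> I" for i using that by (auto simp: I_def)
    have "(\<integral>\<^sup>+ w. ennreal ((incr K w / real (K\<^sup>2))\<^sup>2) \<partial>M)
      \<le> (\<integral>\<^sup>+ w. ennreal (real (card I) / (real (K\<^sup>2))\<^sup>2) * (\<Sum>i\<in>I. ennreal ((?b i w)\<^sup>2)) \<partial>M)"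
    proof (intro nn_integral_mono)
      fix w
      have "(incr K w)\<^sup>2 \<le> (\<Sum>i\<in>I. (?b i w)\<^sup>2) * real (card I)"
        unfolding incr_def I_def[symmetric]
        by (rule sum_squared_le_sum_of_squares)
      then have "(incr K w / real (K\<^sup>2))\<^sup>2 \<le> real (card I) / (real (K\<^sup>2))\<^sup>2 * (\<Sum>i\<in>I. (?b i w)\<^sup>2)"
        by (simp add: power_divide divide_right_mono mult.commute)
      then have "ennreal ((incr K w / real (K\<^sup>2))\<^sup>2) \<le> ennreal (real (card I) / (real (K\<^sup>2))\<^sup>2 * (\<Sum>i\<in>I. (?b i w)\<^sup>2))"
        by (rule ennreal_leI)
      then show "ennreal ((incr K w / real (K\<^sup>2))\<^sup>2) \<le> ennreal (real (card I) / (real (K\<^sup>2))\<^sup>2) * (\<Sum>i\<in>I. ennreal ((?b i w)\<^sup>2))"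
        by (subst (asm) ennreal_mult) (auto intro: sum_nonneg)
    qed
    also have "\<dots> = ennreal (real (card I) / (real (K\<^sup>2))\<^sup>2) * (\<Sum>i\<in>I. ?I i)"
      using mi I1 by (subst nn_integral_cmult, simp, subst nn_integral_sum) auto
    also have "(\<Sum>i\<in>I. ?I i) = (\<Sum>i\<in>I. ennreal \<kappa>)"
    proof (intro sum.cong refl)
      fix i assume "i \<in> I"
      then have "?I i = (\<integral>\<^sup>+ g. ennreal ((\<bar>Q g\<bar> + 1)\<^sup>2) \<partial>\<nu>)"
        by (intro nn_integral_x I1)
      then show "?I i = ennreal \<kappa>"
        using nn_integral_eq_integral[OF i\<kappa>] by (simp add: \<kappa>_def)
    qed
    also have "ennreal (real (card I) / (real (K\<^sup>2))\<^sup>2) * (\<Sum>i\<in>I. ennreal \<kappa>)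
      = ennreal (real (card I) / (real (K\<^sup>2))\<^sup>2 * (real (card I) * \<kappa>))"
    proof -
      have "(\<Sum>i\<in>I. ennreal \<kappa>) = ennreal (real (card I) * \<kappa>)"
        using \<kappa> by (simp add: ennreal_mult ennreal_of_nat_eq_real_of_nat)
      then show ?thesis using \<kappa> by (simp only:) (rule ennreal_mult[symmetric]; simp)
    qed
    also have "\<dots> \<le> ennreal (9 * \<kappa> * inverse ((real K)\<^sup>2))"
    proof (rule ennreal_leI)
      \<comment> \<open>\<open>2 K + 1 \<le> 3 K\<close> because \<open>K \<ge> 1\<close>; the
        square is the 9.\<close>
      have "(real (card I))\<^sup>2 \<le> (3 * real K)\<^sup>2" by (rule power_mono) (auto simp: cI K_def)
      then have "(real (card I))\<^sup>2 * (\<kappa> / (real (K\<^sup>2))\<^sup>2) \<le> (3 * real K)\<^sup>2 * (\<kappa> / (real (K\<^sup>2))\<^sup>2)"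
        using \<kappa> by (intro mult_right_mono) auto
      also have "\<dots> = 9 * \<kappa> * inverse ((real K)\<^sup>2)"
      proof -
        have "(3 * r)\<^sup>2 * (\<kappa> / (r\<^sup>2)\<^sup>2) = 9 * \<kappa> * inverse (r\<^sup>2)" if "r > 0" for r :: real
          using that by (simp add: power2_eq_square field_simps)
        from this[of "real K"] show ?thesis by (simp add: K_def)
      qed
      finally show "real (card I) / (real (K\<^sup>2))\<^sup>2 * (real (card I) * \<kappa>) \<le> 9 * \<kappa> * inverse ((real K)\<^sup>2)"
        by (simp add: power2_eq_square mult_ac)
    qed
    finally show "(\<integral>\<^sup>+ w. ennreal ((incr (Suc k) w / real ((Suc k)\<^sup>2))\<^sup>2) \<partial>M) \<le> ennreal (9 * \<kappa> * inverse ((real (Suc k))\<^sup>2))"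
      by (simp only: K_def)
  qed
  then show ?thesis by eventually_elim (rule LIMSEQ_imp_Suc)
qed

lemma abs_Q_walk_diff:
  assumes "\<forall>i\<ge>1. x i w \<in> set_pmf \<nu>" "m \<le> n"
  shows "\<bar>Q (walk x n w) - Q (walk x m w)\<bar> \<le> (\<Sum>i\<in>{m<..n}. \<bar>Q (x i w)\<bar> + 1)"
  using assms(2)
proof (induction n rule: dec_induct)
  case (step n)
  have "\<bar>Q (walk x (Suc n) w) - Q (walk x n w)\<bar> \<le> \<bar>Q (x (Suc n) w)\<bar> + 1"
    unfolding walk_Suc using assms(1) by (intro Q_step) auto
  moreover have "{m<..Suc n} = insert (Suc n) {m<..n}" using step by auto
  ultimately show ?case using step.IH by simp
qed simp

text \<open>Between squares, \<open>Q\<close> moves by at most \<open>incr k\<close>, and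
  \<open>n\<close> exceeds \<open>k\<^sup>2\<close> by O(k), which accounts for the last term of
  \<open>e\<close>.\<close>

lemma slln:
  assumes \<gamma>: "\<forall>n\<ge>1. \<bar>mean n - real n * \<gamma>\<bar> \<le> D"
  shows "AE w in M. (\<lambda>n. Q (walk x n w) / real n) \<longlonglongrightarrow> \<gamma>"
  using squares_slln[OF \<gamma>] incr_slln AE_x
proof eventually_elim
  case (elim w)
  let ?S = "\<lambda>n. Q (walk x n w) - real n * \<gamma>"
  define e where "e k = incr k w / real (k\<^sup>2) + \<bar>Q (walk x (k\<^sup>2) w) / real (k\<^sup>2) - \<gamma>\<bar> + 3 * \<bar>\<gamma>\<bar> / real k" for k
  have "e \<longlonglongrightarrow> 0 + \<bar>0\<bar> + 0" unfolding e_def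
    by (intro tendsto_add tendsto_rabs elim tendsto_divide_0[OF tendsto_const]
        filterlim_at_top_imp_at_infinity filterlim_real_sequentially)
  then have e0: "e \<longlonglongrightarrow> 0" by simp
  have bound: "\<bar>Q (walk x n w) / real n - \<gamma>\<bar> \<le> e k" if k: "k \<ge> 1" "k\<^sup>2 \<le> n" "n < (Suc k)\<^sup>2" for n k
  proof -
    have "real (k\<^sup>2) > 0" using k(1) by simp
    moreover have "real (k\<^sup>2) \<le> real n" using k(2) by (simp only: of_nat_le_iff)
    ultimately have kp: "real (k\<^sup>2) > 0" "real (k\<^sup>2) \<le> real n" "real n > 0" by linarith+
    have "n - k\<^sup>2 \<le> 2 * k" using k(3) by (simp add: power2_eq_square)
    then have nk: "real n - real (k\<^sup>2) \<le> 3 * real k" using k(2) by linarith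
    have "\<bar>Q (walk x n w) - Q (walk x (k\<^sup>2) w)\<bar> \<le> (\<Sum>i\<in>{k\<^sup>2<..n}. \<bar>Q (x i w)\<bar> + 1)"
      using elim(3) k(2) by (rule abs_Q_walk_diff)
    also have "\<dots> \<le> incr k w" unfolding incr_def using k(3) by (intro sum_mono2) auto
    finally have 1: "\<bar>Q (walk x n w) - Q (walk x (k\<^sup>2) w)\<bar> \<le> incr k w" .
    have "\<bar>?S n\<bar>
      \<le> incr k w + \<bar>?S (k\<^sup>2)\<bar> + \<bar>(real n - real (k\<^sup>2)) * \<gamma>\<bar>"
    proof -
      have "?S n = (Q (walk x n w) - Q (walk x (k\<^sup>2) w))
        + ?S (k\<^sup>2) - (real n - real (k\<^sup>2)) * \<gamma>"
        by (simp add: left_diff_distrib)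
      then show ?thesis using 1 by linarith
    qed
    also have "\<bar>(real n - real (k\<^sup>2)) * \<gamma>\<bar> \<le> 3 * real k * \<bar>\<gamma>\<bar>"
      unfolding abs_mult using nk kp(2) by (intro mult_right_mono) auto
    finally have 2: "\<bar>?S n\<bar>
      \<le> incr k w + \<bar>?S (k\<^sup>2)\<bar> + 3 * real k * \<bar>\<gamma>\<bar>" by simp
    have "\<bar>Q (walk x n w) / real n - \<gamma>\<bar> = \<bar>?S n\<bar> / real n"
    proof -
      have "Q (walk x n w) / real n - \<gamma> = ?S n / real n"
        using kp(3) by (simp add: field_simps)
      then show ?thesis by simp
    qed
    also have "\<dots> \<le> \<bar>?S n\<bar> / real (k\<^sup>2)"
      using kp by (intro divide_left_mono) auto
    also have "\<dots> \<le> (incr k w + \<bar>?S (k\<^sup>2)\<bar> + 3 * real k * \<bar>\<gamma>\<bar>) / real (k\<^sup>2)"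
      using 2 by (intro divide_right_mono) auto
    also have "\<dots> = e k"
    proof -
      have "\<bar>Q (walk x (k\<^sup>2) w) / real (k\<^sup>2) - \<gamma>\<bar> = \<bar>?S (k\<^sup>2) / real (k\<^sup>2)\<bar>"
        using kp(1) by (simp add: diff_divide_distrib)
      also have "\<dots> = \<bar>?S (k\<^sup>2)\<bar> / real (k\<^sup>2)" by simp
      finally have a: "\<bar>Q (walk x (k\<^sup>2) w) / real (k\<^sup>2) - \<gamma>\<bar> = \<bar>?S (k\<^sup>2)\<bar> / real (k\<^sup>2)" .
      have "3 * real k * \<bar>\<gamma>\<bar> / real (k\<^sup>2) = 3 * \<bar>\<gamma>\<bar> / real k"
        using k(1) by (simp add: power2_eq_square)
      then show ?thesis unfolding e_def a by (simp only: add_divide_distrib)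
    qed
    finally show ?thesis .
  qed
  show ?case
  proof (rule metric_LIMSEQ_I)
    fix r :: real assume "r > 0"
    then obtain K where "\<forall>k\<ge>K. dist (e k) 0 < r"
      using metric_LIMSEQ_D[OF e0] by blast
    then have K: "\<bar>e k\<bar> < r" if "k \<ge> K" for k using that by (simp add: dist_real_def)
    show "\<exists>no. \<forall>n\<ge>no. dist (Q (walk x n w) / real n) \<gamma> < r"
    proof (intro exI[of _ "(Suc K)\<^sup>2"] allI impI)
      fix n assume n: "n \<ge> (Suc K)\<^sup>2"
      obtain k where k: "k\<^sup>2 \<le> n" "n < (Suc k)\<^sup>2" using ex_square_interval by blast
      have "(Suc K)\<^sup>2 < (Suc k)\<^sup>2" using n k(2) by simp
      then have "Suc K < Suc k" by (rule power_less_imp_less_base) simp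
      then have "\<bar>Q (walk x n w) / real n - \<gamma>\<bar> \<le> e k" "\<bar>e k\<bar> < r" using bound[of k n] k K[of k] by auto
      then show "dist (Q (walk x n w) / real n) \<gamma> < r" by (simp add: dist_real_def)
    qed
  qed
qed

lemma drift_eq:
  assumes \<gamma>: "\<forall>n\<ge>1. \<bar>mean n - real n * \<gamma>\<bar> \<le> D"
  shows "drift M (\<lambda>n w. Q (walk x n w)) = \<gamma>"
  unfolding drift_def
proof (rule the_equality)
  show lim: "AE w in M. (\<lambda>n. Q (walk x n w) / real n) \<longlonglongrightarrow> \<gamma>" by (rule slln[OF \<gamma>])
  fix c assume "AE w in M. (\<lambda>n. Q (walk x n w) / real n) \<longlonglongrightarrow> c"
  with lim have "AE w in M. c = \<gamma>"
    by eventually_elim (rule LIMSEQ_unique)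
  then show "c = \<gamma>" using eventually_happens'[OF ae_filter_bot] by blast
qed

end

section \<open>The central limit theorem on the braid group\<close>

context braid_walk begin

text \<open>The walk may be periodic, so a high power of \<open>y\<close> and 1 have to be reached
  at the same time. A loop through \<open>y\<close> and its inverse, of length \<open>j\<close>,
  repeated \<open>i N\<close> times, and \<open>y\<close>, reached in \<open>i\<close> steps,
  repeated \<open>j N\<close> times, both take \<open>i j N\<close> steps.\<close>

lemma powers_and_one_reachable:
  assumes "y \<noteq> 1"
  shows "\<exists>s\<ge>N. \<exists>J. y ^ s \<in> set_pmf (conv_power \<nu> J) \<and> 1 \<in> set_pmf (conv_power \<nu> J)"
proof -
  obtain i where i: "y \<in> set_pmf (conv_power \<nu> i)" using generates by blast
  obtain i' where i': "inverse y \<in> set_pmf (conv_power \<nu> i')" using generates by blast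
  define j where "j = i + i'"
  have "i \<noteq> 0" using i assms by (cases i) auto
  then have j: "j \<ge> 1" by (simp add: j_def)
  have "y * inverse y \<in> set_pmf (conv_power \<nu> j)"
    unfolding j_def conv_power_add set_conv_pmf using i i' by blast
  then have "1 \<in> set_pmf (conv_power \<nu> j)" by simp
  from set_conv_power_mult[OF this, of "i * N"] have "1 \<in> set_pmf (conv_power \<nu> (i * (j * N)))"
    by (simp add: mult_ac)
  moreover have "y ^ (j * N) \<in> set_pmf (conv_power \<nu> (i * (j * N)))"
    by (rule set_conv_power_mult[OF i])
  moreover have "j * N \<ge> N" using j by simp
  ultimately show ?thesis by blast
qed

end

lemma T_length_power_a: "T_length (br_a ^ s) = s"
proof -
  have "code (br_a ^ s) = (replicate s (GA, GA), 0)"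
  proof (induction s)
    case (Suc s)
    have "code (br_a ^ Suc s) = act GA (code (br_a ^ s))"
      unfolding power_Suc2 br_a_def code_mult_gen ..
    then show ?case using Suc.IH by (cases s) (auto simp: act_def)
  qed (simp add: code_1)
  then show ?thesis by (simp add: T_length_code)
qed

lemma Delta_exp_power_Delta: "Delta_exp (Delta ^ s) = int s"
  using code_Delta_powi[of "int s"] by (simp add: Delta_exp_code)

text \<open>An exponential dominates a square: \<open>y\<^sup>2 \<le> 2 exp y\<close> at
  \<open>c\<close> times the word length plus 2, the 2 coming from
  \<open>abs_Delta_exp_le_word_length\<close>. This gives
  \<open>C = 2 exp (2 c) / c\<^sup>2\<close>.\<close>

lemma integrable_Delta_exp_square:
  assumes supp: "set_pmf \<nu> \<subseteq> U_set" and c: "c > 0"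
    and mom: "(\<lambda>g. exp (c * real (word_length g)) * pmf \<nu> g) summable_on U_set"
  shows "integrable \<nu> (\<lambda>g. (real_of_int (Delta_exp g))\<^sup>2)"
proof (rule integrableI_nonneg)
  let ?k = "\<lambda>g. (real_of_int (Delta_exp g))\<^sup>2" and ?e = "\<lambda>g. exp (c * real (word_length g))"
  let ?f = "\<lambda>g. ?e g * pmf \<nu> g"
  define C where "C = 2 * exp (2 * c) / c\<^sup>2"
  have C: "C \<ge> 0" by (simp add: C_def)
  have le: "?k g \<le> C * ?e g" if "g \<in> U_set" for g
  proof -
    have "3 * \<bar>Delta_exp g\<bar> \<le> int (word_length g) + 2" by (rule abs_Delta_exp_le_word_length[OF that])
    then have "\<bar>real_of_int (Delta_exp g)\<bar> \<le> real (word_length g) + 2" by linarith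
    then have "?k g \<le> (real (word_length g) + 2)\<^sup>2"
      by (simp add: abs_le_square_iff[symmetric])
    also have "\<dots> = (c * (real (word_length g) + 2))\<^sup>2 / c\<^sup>2" using c by (simp add: power_mult_distrib)
    also have "\<dots> \<le> 2 * exp (c * (real (word_length g) + 2)) / c\<^sup>2"
    proof (rule divide_right_mono)
      define y where "y = c * (real (word_length g) + 2)"
      have "y \<ge> 0" using c by (simp add: y_def)
      then show "y\<^sup>2 \<le> 2 * exp y" using exp_lower_Taylor_quadratic[of y] by simp
    qed simp
    also have "\<dots> = C * ?e g"
      by (simp add: C_def distrib_left exp_add mult_ac)
    finally show ?thesis .
  qed
  have "(\<lambda>g. norm (?f g)) summable_on U_set"
    using mom by (rule summable_on_iff_abs_summable_on_real[THEN iffD1])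
  then have int: "integrable (count_space U_set) ?f"
    using abs_summable_equivalent[of ?f U_set] by (simp only: abs_summable_on_def)
  have "(\<integral>\<^sup>+ g. ennreal (?k g) \<partial>\<nu>)
    = (\<integral>\<^sup>+ g. ennreal (pmf \<nu> g) * ennreal (?k g) \<partial>count_space UNIV)"
    by (rule nn_integral_measure_pmf)
  also have "\<dots> \<le> (\<integral>\<^sup>+ g. ennreal C * ennreal (?f g) * indicator U_set g \<partial>count_space UNIV)"
  proof (rule nn_integral_mono)
    fix g
    show "ennreal (pmf \<nu> g) * ennreal (?k g) \<le> ennreal C * ennreal (?f g) * indicator U_set g"
    proof (cases "g \<in> U_set")
      case True
      have "pmf \<nu> g * ?k g \<le> pmf \<nu> g * (C * ?e g)"
        by (intro mult_left_mono le True) simp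
      then have "ennreal (pmf \<nu> g * ?k g) \<le> ennreal (C * ?f g)"
        by (intro ennreal_leI) (simp add: mult_ac)
      then show ?thesis using True C by (simp add: ennreal_mult)
    next
      case False
      then have "pmf \<nu> g = 0" using supp by (auto simp: set_pmf_iff)
      then show ?thesis by simp
    qed
  qed
  also have "\<dots> = (\<integral>\<^sup>+ g. ennreal C * ennreal (?f g) \<partial>count_space U_set)"
    by (simp add: nn_integral_count_space_indicator)
  also have "\<dots> = ennreal C * ennreal (\<integral>g. ?f g \<partial>count_space U_set)"
    by (subst nn_integral_cmult, simp, subst nn_integral_eq_integral[OF int]) auto
  also have "\<dots> < \<infinity>" by (simp add: ennreal_mult_less_top)
  finally show "(\<integral>\<^sup>+ g. ennreal (?k g) \<partial>\<nu>) < \<infinity>" .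
qed auto

lemma central_limit_of_quasi_additive:
  fixes \<nu> :: "'a :: {monoid_mult, countable} pmf" and M :: "'w measure" and Q :: "'a \<Rightarrow> real"
  assumes real: "is_realization M \<nu> X"
    and quasi: "quasi_additive \<nu> Q B"
    and step: "\<And>g y. y \<in> set_pmf \<nu> \<Longrightarrow> \<bar>Q (g * y) - Q g\<bar> \<le> \<bar>Q y\<bar> + 1"
    and g: "g \<in> set_pmf (conv_power \<nu> J)" and h: "h \<in> set_pmf (conv_power \<nu> J)"
    and gap: "Q g - Q h \<ge> 2 * B + 3"
  shows "\<exists>\<sigma>>0. \<forall>t. (\<lambda>n. measure M {\<omega> \<in> space M.
      (Q (X n \<omega>) - real n * drift M (\<lambda>n \<omega>. Q (X n \<omega>))) / (\<sigma> * sqrt (real n)) < t})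
    \<longlonglongrightarrow> std_normal_cdf t"
proof -
  interpret quasi_additive \<nu> Q B by (rule quasi)
  obtain x where x: "prob_space M" "prob_space.indep_vars M (\<lambda>_. count_space UNIV) x {1..}"
    "\<And>i. i \<ge> 1 \<Longrightarrow> distr M (count_space UNIV) (x i) = measure_pmf \<nu>" and X: "X = walk x"
    using real by (auto simp: is_realization_def)
  interpret prob_space M by (rule x(1))
  interpret quasi_additive_walk M \<nu> x Q B
    by unfold_locales (use x step in auto)
  obtain \<gamma> where \<gamma>: "\<forall>n\<ge>1. \<bar>mean n - real n * \<gamma>\<bar> \<le> 3 * ((B + 1) / 2)"
    using mean_limit by blast
  have d: "drift M (\<lambda>n \<omega>. Q (X n \<omega>)) = \<gamma>" unfolding X by (rule drift_eq[OF \<gamma>])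
  obtain \<sigma> C where \<sigma>: "\<sigma> > 0" "\<And>n. n \<ge> 1 \<Longrightarrow> \<bar>var n - real n * \<sigma>\<^sup>2\<bar> \<le> C * sqrt (real n)"
    using var_limit_pos[OF g h gap] by blast
  have "(\<lambda>n. measure M {\<omega> \<in> space M. (Q (X n \<omega>) - real n * \<gamma>) / (\<sigma> * sqrt (real n)) < t})
    \<longlonglongrightarrow> std_normal_cdf t" for t
    unfolding X measure_walk[where P = "\<lambda>g. (Q g - real _ * \<gamma>) / (\<sigma> * sqrt (real _)) < t"]
    by (rule clt[OF \<sigma> \<gamma>[rule_format]])
  then show ?thesis unfolding d by (intro exI[of _ \<sigma>] conjI allI \<sigma>(1))
qed

theorem proposition5p2:
  fixes \<nu> :: "braid3 pmf"
    and M :: "'w measure"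
    and X :: "nat \<Rightarrow> 'w \<Rightarrow> braid3"
    and gamma_Sigma gamma_Delta :: real
  assumes supp: "set_pmf \<nu> \<subseteq> U_set"
    and generates: "(\<Union>n. set_pmf (conv_power \<nu> n)) = UNIV"
    and exp_moment: "\<exists>c>0::real. (\<lambda>g. exp (c * real (word_length g)) * pmf \<nu> g) summable_on U_set"
    and walk: "is_realization M \<nu> X"
  defines "gamma_Sigma \<equiv> drift M (\<lambda>n \<omega>. real (T_length (X n \<omega>)))"
    and "gamma_Delta \<equiv> drift M (\<lambda>n \<omega>. real_of_int (Delta_exp (X n \<omega>)))"
  shows "\<exists>sigma_Sigma > (0 :: real). \<exists>sigma_Delta > (0 :: real). \<forall>t :: real.
     (\<lambda>n. measure M {\<omega> \<in> space M.
        (real (T_length (X n \<omega>)) - real n * gamma_Sigma) / (sigma_Sigma * sqrt (real n)) < t})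
       \<longlonglongrightarrow> 1 / sqrt (2 * pi) * (LBINT x:{..t}. exp (- (x\<^sup>2) / 2)) \<and>
     (\<lambda>n. measure M {\<omega> \<in> space M.
        (real_of_int (Delta_exp (X n \<omega>)) - real n * gamma_Delta) / (sigma_Delta * sqrt (real n)) < t})
       \<longlonglongrightarrow> 1 / sqrt (2 * pi) * (LBINT x:{..t}. exp (- (x\<^sup>2) / 2))"
proof -
  interpret braid_walk \<nu> by unfold_locales (fact supp generates)+
  obtain B1 where B1: "B1 \<ge> 0"
    "\<And>g m. (\<integral>\<^sup>+ h. ennreal ((T_defect g h)\<^sup>2) \<partial>conv_power \<nu> m) \<le> ennreal B1"
    "\<And>g m. (\<integral>\<^sup>+ h. ennreal ((Delta_defect g h)\<^sup>2) \<partial>conv_power \<nu> m) \<le> ennreal B1"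
    using defect_left by blast
  obtain B2 where B2: "B2 \<ge> 0"
    "\<And>g m. (\<integral>\<^sup>+ h. ennreal ((T_defect h g)\<^sup>2) \<partial>conv_power \<nu> m) \<le> ennreal B2"
    "\<And>g m. (\<integral>\<^sup>+ h. ennreal ((Delta_defect h g)\<^sup>2) \<partial>conv_power \<nu> m) \<le> ennreal B2"
    using defect_right by blast
  define B where "B = max B1 B2"
  have B: "B \<ge> 0" "ennreal B1 \<le> ennreal B" "ennreal B2 \<le> ennreal B"
    using B1(1) by (auto simp: B_def intro!: ennreal_leI)
  note le = order_trans[OF B1(2) B(2)] order_trans[OF B1(3) B(2)] order_trans[OF B2(2) B(3)] order_trans[OF B2(3) B(3)]
  have sqT: "integrable \<nu> (\<lambda>g. (real (T_length g))\<^sup>2)"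
    by (rule measure_pmf.integrable_const_bound[of _ 1]) (use supp T_length_U in \<open>auto intro!: AE_pmfI\<close>)
  have T: "quasi_additive \<nu> (\<lambda>g. real (T_length g)) B"
    by unfold_locales (fact sqT B(1) le)+
  have sqK: "integrable \<nu> (\<lambda>g. (real_of_int (Delta_exp g))\<^sup>2)"
    using exp_moment integrable_Delta_exp_square[OF supp] by blast
  have K: "quasi_additive \<nu> (\<lambda>g. real_of_int (Delta_exp g)) B"
    by unfold_locales (fact sqK B(1) le)+
  \<comment> \<open>Powers of a and of \<Delta> with exponent at least \<open>N\<close> realise the
    gap against 1, for the T-length and for the exponent of \<Delta> respectively.\<close>
  obtain N where N: "real N \<ge> 2 * B + 3" using real_arch_simple by blast
  have "br_a \<noteq> 1" using T_length_power_a[of 1] by (auto simp: T_length_code code_1)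
  then obtain s J where s: "s \<ge> N" "br_a ^ s \<in> set_pmf (conv_power \<nu> J)" "1 \<in> set_pmf (conv_power \<nu> J)"
    using powers_and_one_reachable by blast
  have "Delta \<noteq> 1" using Delta_exp_power_Delta[of 1] by (auto simp: Delta_exp_code code_1)
  then obtain s' J' where s': "s' \<ge> N" "Delta ^ s' \<in> set_pmf (conv_power \<nu> J')" "1 \<in> set_pmf (conv_power \<nu> J')"
    using powers_and_one_reachable by blast
  have "\<exists>\<sigma>>0. \<forall>t. (\<lambda>n. measure M {\<omega> \<in> space M.
      (real (T_length (X n \<omega>)) - real n * gamma_Sigma) / (\<sigma> * sqrt (real n)) < t})
    \<longlonglongrightarrow> std_normal_cdf t"
    unfolding gamma_Sigma_def
  proof (rule central_limit_of_quasi_additive[OF walk T _ s(2,3)])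
    show "real (T_length (br_a ^ s)) - real (T_length 1) \<ge> 2 * B + 3"
      using N s(1) by (simp add: T_length_power_a T_length_code[of 1] code_1)
    fix g y assume "y \<in> set_pmf \<nu>"
    then have "y \<in> U_set" using supp by blast
    then show "\<bar>real (T_length (g * y)) - real (T_length g)\<bar> \<le> \<bar>real (T_length y)\<bar> + 1"
      using T_length_mult_U_right[of y g] by (simp add: T_length_U)
  qed
  moreover have "\<exists>\<sigma>>0. \<forall>t. (\<lambda>n. measure M {\<omega> \<in> space M.
      (real_of_int (Delta_exp (X n \<omega>)) - real n * gamma_Delta) / (\<sigma> * sqrt (real n)) < t})
    \<longlonglongrightarrow> std_normal_cdf t"
    unfolding gamma_Delta_def
  proof (rule central_limit_of_quasi_additive[OF walk K _ s'(2,3)])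
    show "real_of_int (Delta_exp (Delta ^ s')) - real_of_int (Delta_exp 1) \<ge> 2 * B + 3"
      using N s'(1) by (simp add: Delta_exp_power_Delta Delta_exp_code[of 1] code_1)
    fix g y assume "y \<in> set_pmf \<nu>"
    then have "y \<in> U_set" using supp by blast
    from Delta_exp_step[OF this, of g]
    show "\<bar>real_of_int (Delta_exp (g * y)) - real_of_int (Delta_exp g)\<bar> \<le> \<bar>real_of_int (Delta_exp y)\<bar> + 1"
      by auto
  qed
  ultimately show ?thesis by blast
qed

end
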